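(* Let $G\in C(Q)$ be such that $m=1$ in the factorization $\det G=\gamma_-(\lambda_-/\lambda_+)^m\gamma_+$, and let $g$ be its $\Sigma$-symbol. Then neither of the Riemann–Hilbert problems $$G\phi_+=\phi_-,\qquad \phi_+\in(C_\mu^+(\dot{\mathbb R}))^2,\ \phi_-\in(C_{\mu0}^-(\dot{\mathbb R}))^2,$$ $$g\psi_+=\frac{\tau}{\mathfrak p_1}\psi_-\ \text{ on }\Gamma,\qquad \psi_+\in C_\mu^+(\Gamma),\ \psi_-\in C_{\mu0}^-(\Gamma),$$ admits non-zero solutions, and $G$ admits a non-canonical bounded factorization with partial indices $0$ and $1$.
   Context: Fix $k_0>1$, $\mu\in(0,1)$. $\Sigma$ is the compact Riemann surface of genus $1$ obtained from the curve $\tau^2=\mathfrak p(\xi)=(1+\xi^2)(k_0^2+\xi^2)$ in $\mathbb C^2$ by adding two points at infinity; $\Pi(\xi,\tau)=\xi$; functions of $\xi$ are regarded as functions on $\Sigma$ via $\Pi$. $\dot{\mathbb R}=\mathbb R\cup\{\infty\}$, $\Sigma^\pm=\Pi^{-1}(\mathbb C^\pm)$, $\Gamma=\Pi^{-1}(\dot{\mathbb R})$, the disjoint union of two closed curves $\Gamma_1$ ($\tau>0$ over $\mathbb R$) and $\Gamma_2$ ($\tau<0$ over $\mathbb R$). $C_\mu(\dot{\mathbb R})$: continuous functions on $\dot{\mathbb R}$ satisfying a Hölder condition of exponent $\mu$ (Hölder after transplanting to the unit circle by $\xi\mapsto(\xi-i)/(\xi+i)$); $C_\mu^\pm(\dot{\mathbb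 R})=C_\mu(\dot{\mathbb R})\cap H^\infty(\mathbb C^\pm)$. $C_\mu(\Gamma)$: functions on $\Gamma$ whose restrictions to $\Gamma_1,\Gamma_2$, viewed via $\Pi$ on $\dot{\mathbb R}$, are in $C_\mu(\dot{\mathbb R})$. $C_\mu^\pm(\Gamma)$: elements of $C_\mu(\Gamma)$ extending continuously to $\Sigma^\pm\cup\Gamma$ and analytically to $\Sigma^\pm$. $\lambda_\pm(\xi)=\xi\pm i$; $C_{\mu0}^-(\dot{\mathbb R})=\frac{\lambda_+}{\lambda_-}C_\mu^-(\dot{\mathbb R})$, $C_{\mu0}^-(\Gamma)=\frac{\lambda_+}{\lambda_-}C_\mu^-(\Gamma)$. $\mathcal G\mathcal A$: invertible elements of $\mathcal A$. $\mathfrak p_1(\xi)=(\xi+i)(\xi+ik_0)$, $\mathfrak p_2(\xi)=(\xi-i)(\xi-ik_0)$, $q=\mathfrak p_1/\mathfrak p_2$, $Q=\begin{bmatrix}-q&0\\ 0&1\end{bmatrix}$. $C(Q)$ is the set of $G\in\mathcal G(C_\mu(\dot{\mathbb R}))^{2\times2}$ with $G^TQG=\det G\cdot Q$; such $G$ have the form $G=\begin{bmatrix}\alpha&\delta\\ q\delta&\alpha\end{bmatrix}$ with $\alpha,\delta\in C_\mu(\dot{\mathbb R})$. The $\Sigma$-symbol of $G$ is $g=\alpha+\frac{\tau}{\mathfrak p_2}\delta\in\mathcal GC_\mu(\Gamma)$. $\det G=\gamma_-(\lambda_-/\lambda_+)^m\gamma_+$ with $\gamma_\pm\in\mathcal GC_\mu^\pm(\dot{\mathbb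 R})$, $m\in\mathbb Z$. A bounded (Wiener–Hopf) factorization of $G$ is $G=G_-DG_+$ with $G_\pm\in\mathcal G(C_\mu^\pm(\dot{\mathbb R}))^{2\times2}$ and $D=\operatorname{diag}((\lambda_-/\lambda_+)^{k_1},(\lambda_-/\lambda_+)^{k_2})$, $k_1,k_2\in\mathbb Z$ (the partial indices, unique up to order); it is canonical if $k_1=k_2=0$. *)

theory Defs
  imports "HOL-Analysis.Analysis"
begin

text \<open>The extended real line is the type \<open>real option\<close>, with \<open>None\<close> for the point at infinity;
  likewise \<open>complex option\<close> is the Riemann sphere.  Rational functions with a finite limit at
  infinity are extended by that limit.\<close>

type_synonym rdot = "real option"

text \<open>The quotient \<open>\<lambda>\<^sub>- / \<lambda>\<^sub>+\<close>, i.e. \<open>\<xi> \<mapsto> (\<xi> - \<i>) / (\<xi> + \<i>)\<close>, which is also the map that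
  transplants the extended line to the unit circle.\<close>

definition lam_ratio :: "rdot \<Rightarrow> complex" where
  "lam_ratio x = (case x of None \<Rightarrow> 1
     | Some r \<Rightarrow> (complex_of_real r - \<i>) / (complex_of_real r + \<i>))"

text \<open>Continuity on the extended line is implied by the Hoelder estimate, as \<open>\<mu> > 0\<close>.\<close>

definition C_hoelder :: "real \<Rightarrow> (rdot \<Rightarrow> complex) set" where
  "C_hoelder \<mu> =
     {f. \<exists>C. \<forall>x y. norm (f x - f y) \<le> C * dist (lam_ratio x) (lam_ratio y) powr \<mu>}"

definition upper :: "complex set" where "upper = {z. Im z > 0}"
definition lower :: "complex set" where "lower = {z. Im z < 0}"

text \<open>\<open>f\<close> belongs to \<open>H\<^sup>\<infinity>\<close> of the half-plane \<open>S\<close> in the usual identification of a bounded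
  analytic function with its almost everywhere defined non-tangential boundary function.\<close>

definition H_inf :: "complex set \<Rightarrow> (rdot \<Rightarrow> complex) set" where
  "H_inf S = {f. \<exists>F. F holomorphic_on S \<and> bounded (F ` S) \<and>
     (AE x in lborel. \<forall>c>0.
        (F \<longlongrightarrow> f (Some x))
          (at (complex_of_real x) within {z \<in> S. \<bar>Re z - x\<bar> < c * \<bar>Im z\<bar>}))}"

definition C_plus :: "real \<Rightarrow> (rdot \<Rightarrow> complex) set" where
  "C_plus \<mu> = C_hoelder \<mu> \<inter> H_inf upper"

definition C_minus :: "real \<Rightarrow> (rdot \<Rightarrow> complex) set" where
  "C_minus \<mu> = C_hoelder \<mu> \<inter> H_inf lower"

definition C_minus0 :: "real \<Rightarrow> (rdot \<Rightarrow> complex) set" where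
  "C_minus0 \<mu> = {\<lambda>x. inverse (lam_ratio x) * f x | f. f \<in> C_minus \<mu>}"

definition units_of_fun :: "(rdot \<Rightarrow> complex) set \<Rightarrow> (rdot \<Rightarrow> complex) set" where
  "units_of_fun A = {f \<in> A. \<exists>h\<in>A. \<forall>x. f x * h x = 1}"

definition vec_over :: "(rdot \<Rightarrow> complex) set \<Rightarrow> (rdot \<Rightarrow> complex^2) set" where
  "vec_over A = {\<phi>. \<forall>i. (\<lambda>x. \<phi> x $ i) \<in> A}"

definition mat_over :: "(rdot \<Rightarrow> complex) set \<Rightarrow> (rdot \<Rightarrow> complex^2^2) set" where
  "mat_over A = {M. \<forall>i j. (\<lambda>x. M x $ i $ j) \<in> A}"

definition units_of_mat :: "(rdot \<Rightarrow> complex) set \<Rightarrow> (rdot \<Rightarrow> complex^2^2) set" where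
  "units_of_mat A =
     {M \<in> mat_over A. \<exists>N\<in>mat_over A. \<forall>x. M x ** N x = mat 1 \<and> N x ** M x = mat 1}"

definition scalar_factorization_index :: "real \<Rightarrow> (rdot \<Rightarrow> complex) \<Rightarrow> int \<Rightarrow> bool" where
  "scalar_factorization_index \<mu> f m \<longleftrightarrow>
     (\<exists>\<gamma>m \<in> units_of_fun (C_minus \<mu>). \<exists>\<gamma>p \<in> units_of_fun (C_plus \<mu>).
        \<forall>x. f x = \<gamma>m x * lam_ratio x powi m * \<gamma>p x)"

definition bounded_factorization ::
  "real \<Rightarrow> (rdot \<Rightarrow> complex^2^2) \<Rightarrow> (rdot \<Rightarrow> complex^2^2) \<Rightarrow> (rdot \<Rightarrow> complex^2^2) \<Rightarrow>
   int \<Rightarrow> int \<Rightarrow> bool" where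
  "bounded_factorization \<mu> G Gm Gp k1 k2 \<longleftrightarrow>
     Gm \<in> units_of_mat (C_minus \<mu>) \<and> Gp \<in> units_of_mat (C_plus \<mu>) \<and>
     (\<forall>x. G x = Gm x **
            vector [vector [lam_ratio x powi k1, 0], vector [0, lam_ratio x powi k2]] ** Gp x)"

definition canonical_indices :: "int \<Rightarrow> int \<Rightarrow> bool" where
  "canonical_indices k1 k2 \<longleftrightarrow> k1 = 0 \<and> k2 = 0"

definition p_poly :: "real \<Rightarrow> complex \<Rightarrow> complex" where
  "p_poly k0 \<xi> = (1 + \<xi>\<^sup>2) * ((complex_of_real k0)\<^sup>2 + \<xi>\<^sup>2)"

definition p1 :: "real \<Rightarrow> complex \<Rightarrow> complex" where
  "p1 k0 \<xi> = (\<xi> + \<i>) * (\<xi> + \<i> * complex_of_real k0)"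

definition p2 :: "real \<Rightarrow> complex \<Rightarrow> complex" where
  "p2 k0 \<xi> = (\<xi> - \<i>) * (\<xi> - \<i> * complex_of_real k0)"

definition q_fun :: "real \<Rightarrow> rdot \<Rightarrow> complex" where
  "q_fun k0 x = (case x of None \<Rightarrow> 1 | Some r \<Rightarrow> p1 k0 (complex_of_real r) / p2 k0 (complex_of_real r))"

definition Q_mat :: "real \<Rightarrow> rdot \<Rightarrow> complex^2^2" where
  "Q_mat k0 x = vector [vector [- q_fun k0 x, 0], vector [0, 1]]"

definition C_Q :: "real \<Rightarrow> real \<Rightarrow> (rdot \<Rightarrow> complex^2^2) set" where
  "C_Q k0 \<mu> = {G \<in> units_of_mat (C_hoelder \<mu>).
     \<forall>x. transpose (G x) ** Q_mat k0 x ** G x = (\<chi> i j. det (G x) * Q_mat k0 x $ i $ j)}"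

text \<open>The compact surface is glued from the affine curves \<open>\<tau>\<^sup>2 = \<pp>(\<xi>)\<close> and
  \<open>t\<^sup>2 = (s\<^sup>2 + 1) (k\<^sub>0\<^sup>2 s\<^sup>2 + 1)\<close> along \<open>s = 1 / \<xi>\<close>, \<open>t = \<tau> / \<xi>\<^sup>2\<close>.  \<open>Aff \<xi> \<tau>\<close> is the point
  \<open>(\<xi>, \<tau>)\<close> of the first curve; \<open>AtInf t\<close> is the point at infinity \<open>(s, t) = (0, t)\<close> of the
  second, where \<open>t = \<plusminus>1\<close> is the limit of \<open>\<tau> / \<xi>\<^sup>2\<close>.\<close>

datatype surf = Aff complex complex | AtInf complex

definition curve :: "real \<Rightarrow> (complex \<times> complex) set" where
  "curve k0 = {(\<xi>, \<tau>). \<tau>\<^sup>2 = p_poly k0 \<xi>}"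

definition curve_inf :: "real \<Rightarrow> (complex \<times> complex) set" where
  "curve_inf k0 = {(s, t). t\<^sup>2 = (s\<^sup>2 + 1) * ((complex_of_real k0)\<^sup>2 * s\<^sup>2 + 1)}"

definition Aff_inf :: "complex \<Rightarrow> complex \<Rightarrow> surf" where
  "Aff_inf s t = (if s = 0 then AtInf t else Aff (1 / s) (t / s\<^sup>2))"

definition surface :: "real \<Rightarrow> surf set" where
  "surface k0 = case_prod Aff ` curve k0 \<union> {AtInf 1, AtInf (-1)}"

definition surface_open :: "real \<Rightarrow> surf set \<Rightarrow> bool" where
  "surface_open k0 U \<longleftrightarrow> U \<subseteq> surface k0 \<and>
     openin (top_of_set (curve k0)) {z \<in> curve k0. case_prod Aff z \<in> U} \<and>
     openin (top_of_set (curve_inf k0)) {z \<in> curve_inf k0. case_prod Aff_inf z \<in> U}"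

definition surface_top :: "real \<Rightarrow> surf topology" where
  "surface_top k0 = topology (surface_open k0)"

lemma istopology_surface_open: "istopology (surface_open k0)"
  unfolding istopology_def
proof (intro conjI allI impI)
  fix S T assume "surface_open k0 S" "surface_open k0 T"
  moreover have "{z \<in> A. f z \<in> S \<inter> T} = {z \<in> A. f z \<in> S} \<inter> {z \<in> A. f z \<in> T}"
    for A and f :: "complex \<times> complex \<Rightarrow> surf" by auto
  ultimately show "surface_open k0 (S \<inter> T)"
    by (auto simp: surface_open_def intro!: openin_Int)
next
  fix K assume K: "\<forall>U\<in>K. surface_open k0 U"
  have "{z \<in> A. f z \<in> \<Union>K} = (\<Union>U\<in>K. {z \<in> A. f z \<in> U})"
    for A and f :: "complex \<times> complex \<Rightarrow> surf" by auto
  with K show "surface_open k0 (\<Union>K)"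
    by (auto simp: surface_open_def intro!: openin_Union)
qed

lemma openin_surface_top: "openin (surface_top k0) U \<longleftrightarrow> surface_open k0 U"
  by (simp add: surface_top_def istopology_surface_open)

lemma Aff_inf_in_surface:
  assumes "(s, t) \<in> curve_inf k0"
  shows "Aff_inf s t \<in> surface k0"
proof (cases "s = 0")
  case True
  with assms show ?thesis
    by (auto simp: curve_inf_def Aff_inf_def surface_def power2_eq_1_iff)
next
  case False
  with assms have "(1 / s, t / s\<^sup>2) \<in> curve k0"
    by (simp add: curve_inf_def curve_def p_poly_def field_simps power2_eq_square)
  with False show ?thesis
    by (force simp: Aff_inf_def surface_def)
qed

lemma topspace_surface_top: "topspace (surface_top k0) = surface k0"
proof -
  have "surface_open k0 (surface k0)"
  proof -
    have "{z \<in> curve k0. case_prod Aff z \<in> surface k0} = curve k0"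
      by (auto simp: surface_def)
    moreover have "{z \<in> curve_inf k0. case_prod Aff_inf z \<in> surface k0} = curve_inf k0"
      using Aff_inf_in_surface by auto
    ultimately show ?thesis by (simp add: surface_open_def)
  qed
  then show ?thesis
    unfolding topspace_def openin_surface_top by (auto simp: surface_open_def)
qed

text \<open>Analyticity with respect to the complex structure of the surface.  The local coordinate is
  \<open>\<xi>\<close> at finite points with \<open>\<tau> \<noteq> 0\<close>, \<open>\<tau>\<close> at the four branch points, and \<open>s = 1 / \<xi>\<close> at the
  points at infinity.\<close>

definition surf_analytic_on :: "real \<Rightarrow> (surf \<Rightarrow> complex) \<Rightarrow> surf set \<Rightarrow> bool" where
  "surf_analytic_on k0 F S \<longleftrightarrow>
     (\<forall>\<xi>0 \<tau>0. Aff \<xi>0 \<tau>0 \<in> S \<and> \<tau>0 \<noteq> 0 \<longrightarrow>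
        (\<exists>h. h analytic_on {\<xi>0} \<and>
          (\<forall>\<^sub>F (\<xi>, \<tau>) in nhds (\<xi>0, \<tau>0). (\<xi>, \<tau>) \<in> curve k0 \<longrightarrow> F (Aff \<xi> \<tau>) = h \<xi>))) \<and>
     (\<forall>\<xi>0. Aff \<xi>0 0 \<in> S \<longrightarrow>
        (\<exists>h. h analytic_on {0} \<and>
          (\<forall>\<^sub>F (\<xi>, \<tau>) in nhds (\<xi>0, 0). (\<xi>, \<tau>) \<in> curve k0 \<longrightarrow> F (Aff \<xi> \<tau>) = h \<tau>))) \<and>
     (\<forall>t0. AtInf t0 \<in> S \<longrightarrow>
        (\<exists>h. h analytic_on {0} \<and>
          (\<forall>\<^sub>F (s, t) in nhds (0, t0). (s, t) \<in> curve_inf k0 \<longrightarrow> F (Aff_inf s t) = h s)))"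

definition surf_proj :: "surf \<Rightarrow> complex option" where
  "surf_proj P = (case P of Aff \<xi> \<tau> \<Rightarrow> Some \<xi> | AtInf t \<Rightarrow> None)"

definition surf_plus :: "real \<Rightarrow> surf set" where
  "surf_plus k0 = {P \<in> surface k0. surf_proj P \<in> Some ` upper}"

definition surf_minus :: "real \<Rightarrow> surf set" where
  "surf_minus k0 = {P \<in> surface k0. surf_proj P \<in> Some ` lower}"

definition Gam :: "real \<Rightarrow> surf set" where
  "Gam k0 = {P \<in> surface k0. surf_proj P \<in> range (map_option complex_of_real)}"

text \<open>The inverses of the projection on the two components of \<open>\<Gamma>\<close>: \<open>\<Gamma>\<^sub>1\<close> is the range for
  \<open>e = 1\<close>, \<open>\<Gamma>\<^sub>2\<close> the range for \<open>e = - 1\<close>.\<close>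

definition Gam_lift :: "real \<Rightarrow> real \<Rightarrow> rdot \<Rightarrow> surf" where
  "Gam_lift k0 e x = (case x of None \<Rightarrow> AtInf (complex_of_real e)
     | Some r \<Rightarrow> Aff (complex_of_real r) (complex_of_real (e * sqrt ((1 + r\<^sup>2) * (k0\<^sup>2 + r\<^sup>2)))))"

lemma Gam_eq_range:
  "Gam k0 = range (Gam_lift k0 1) \<union> range (Gam_lift k0 (-1))"
proof -
  define R where "R r = sqrt ((1 + r\<^sup>2) * (k0\<^sup>2 + r\<^sup>2))" for r :: real
  have R: "p_poly k0 (complex_of_real r) = (complex_of_real (R r))\<^sup>2" for r
  proof -
    have "(R r)\<^sup>2 = (1 + r\<^sup>2) * (k0\<^sup>2 + r\<^sup>2)" by (simp add: R_def)
    then show ?thesis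
      by (metis (no_types, lifting) p_poly_def of_real_1 of_real_add of_real_mult of_real_power)
  qed
  have A: "Aff (complex_of_real r) \<tau> \<in> surface k0 \<longleftrightarrow>
      \<tau> = complex_of_real (R r) \<or> \<tau> = - complex_of_real (R r)" for r \<tau>
    by (auto simp: surface_def curve_def R power2_eq_iff)
  have L: "Gam_lift k0 e x = (case x of None \<Rightarrow> AtInf (complex_of_real e)
     | Some r \<Rightarrow> Aff (complex_of_real r) (complex_of_real (e * R r)))" for e x
    unfolding Gam_lift_def R_def ..
  have I: "Gam_lift k0 e x \<in> Gam k0" if "e = 1 \<or> e = -1" for e x
  proof -
    have *: "Some (complex_of_real r) \<in> range (map_option complex_of_real)"
      "None \<in> range (map_option complex_of_real)" for r
      by (rule range_eqI[of _ _ "Some r"], simp) (rule range_eqI[of _ _ None], simp)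
    have "AtInf 1 \<in> surface k0" "AtInf (-1) \<in> surface k0"
      by (auto simp: surface_def)
    with that show ?thesis
      by (cases x) (auto simp: L Gam_def surf_proj_def A *)
  qed
  have "P \<in> range (Gam_lift k0 1) \<union> range (Gam_lift k0 (-1))" if P: "P \<in> Gam k0" for P
  proof (cases P)
    case (Aff \<xi> \<tau>)
    with P obtain r where r: "\<xi> = complex_of_real r" "Aff \<xi> \<tau> \<in> surface k0"
      by (auto simp: Gam_def surf_proj_def map_option_case split: option.splits)
    with A have "P = Gam_lift k0 1 (Some r) \<or> P = Gam_lift k0 (-1) (Some r)"
      using Aff by (auto simp: L)
    then show ?thesis by blast
  next
    case (AtInf t)
    with P have "P = Gam_lift k0 1 None \<or> P = Gam_lift k0 (-1) None"
      by (auto simp: Gam_def surface_def L)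
    then show ?thesis by blast
  qed
  with I show ?thesis by blast
qed

text \<open>Pullback to \<open>\<Gamma>\<close> of a function on the extended real line; only meaningful on \<open>Gam k0\<close>,
  where the projection is real or infinite.\<close>

definition pull :: "(rdot \<Rightarrow> complex) \<Rightarrow> surf \<Rightarrow> complex" where
  "pull f P = f (map_option Re (surf_proj P))"

lemma pull_Gam_lift: "pull f (Gam_lift k0 e x) = f x"
  by (cases x) (simp_all add: pull_def Gam_lift_def surf_proj_def)

text \<open>A function on \<open>\<Gamma>\<close> is represented by any function on \<open>surf\<close> having the prescribed values on
  \<open>Gam k0\<close>; the following sets do not depend on the other values.\<close>

definition CG_hoelder :: "real \<Rightarrow> real \<Rightarrow> (surf \<Rightarrow> complex) set" where
  "CG_hoelder k0 \<mu> = {f. (\<lambda>x. f (Gam_lift k0 1 x)) \<in> C_hoelder \<mu> \<and>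
                         (\<lambda>x. f (Gam_lift k0 (-1) x)) \<in> C_hoelder \<mu>}"

definition extends_analytically_to :: "real \<Rightarrow> surf set \<Rightarrow> (surf \<Rightarrow> complex) \<Rightarrow> bool" where
  "extends_analytically_to k0 S f \<longleftrightarrow>
     (\<exists>F. continuous_map (subtopology (surface_top k0) (S \<union> Gam k0)) euclidean F \<and>
          surf_analytic_on k0 F S \<and> (\<forall>P\<in>Gam k0. F P = f P))"

definition CG_plus :: "real \<Rightarrow> real \<Rightarrow> (surf \<Rightarrow> complex) set" where
  "CG_plus k0 \<mu> = {f \<in> CG_hoelder k0 \<mu>. extends_analytically_to k0 (surf_plus k0) f}"

definition CG_minus :: "real \<Rightarrow> real \<Rightarrow> (surf \<Rightarrow> complex) set" where
  "CG_minus k0 \<mu> = {f \<in> CG_hoelder k0 \<mu>. extends_analytically_to k0 (surf_minus k0) f}"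

definition CG_minus0 :: "real \<Rightarrow> real \<Rightarrow> (surf \<Rightarrow> complex) set" where
  "CG_minus0 k0 \<mu> = {\<psi>. \<exists>f \<in> CG_minus k0 \<mu>. \<forall>P\<in>Gam k0.
     \<psi> P = pull (\<lambda>x. inverse (lam_ratio x)) P * f P}"

definition tau_over_p1 :: "real \<Rightarrow> surf \<Rightarrow> complex" where
  "tau_over_p1 k0 P = (case P of Aff \<xi> \<tau> \<Rightarrow> \<tau> / p1 k0 \<xi> | AtInf t \<Rightarrow> t)"

definition tau_over_p2 :: "real \<Rightarrow> surf \<Rightarrow> complex" where
  "tau_over_p2 k0 P = (case P of Aff \<xi> \<tau> \<Rightarrow> \<tau> / p2 k0 \<xi> | AtInf t \<Rightarrow> t)"

text \<open>For \<open>G\<close> in \<open>C_Q k0 \<mu>\<close> the functions \<open>\<alpha>\<close> and \<open>\<delta>\<close> form the first row of \<open>G\<close>.\<close>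

lemma C_Q_form:
  assumes "G \<in> C_Q k0 \<mu>"
  shows "G x $ 2 $ 2 = G x $ 1 $ 1" "G x $ 2 $ 1 = q_fun k0 x * G x $ 1 $ 2"
proof -
  obtain N where N: "G x ** N = mat 1"
    using assms by (auto simp: C_Q_def units_of_mat_def)
  have d: "det (G x) \<noteq> 0"
    using N by (metis invertible_def invertible_det_nz matrix_left_right_inverse)
  have e: "transpose (G x) ** Q_mat k0 x ** G x = (\<chi> i j. det (G x) * Q_mat k0 x $ i $ j)"
    using assms by (auto simp: C_Q_def)
  define a b c w q where abc: "a = G x $ 1 $ 1" "b = G x $ 1 $ 2" "c = G x $ 2 $ 1"
    "w = G x $ 2 $ 2" "q = q_fun k0 x"
  have D: "det (G x) = a * w - b * c" by (simp add: det_2 abc)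
  have 1: "c * c - q * a * a = - (det (G x) * q)"
    using arg_cong[OF e, of "\<lambda>M. M $ 1 $ 1"]
    by (simp add: matrix_matrix_mult_def sum_2 transpose_def Q_mat_def abc algebra_simps)
  have 2: "c * w = q * a * b"
    using arg_cong[OF e, of "\<lambda>M. M $ 1 $ 2"]
    by (simp add: matrix_matrix_mult_def sum_2 transpose_def Q_mat_def abc algebra_simps)
  have 3: "w * w - q * b * b = det (G x)"
    using arg_cong[OF e, of "\<lambda>M. M $ 2 $ 2"]
    by (simp add: matrix_matrix_mult_def sum_2 transpose_def Q_mat_def abc algebra_simps)
  have "det (G x) * (c - q * b) = 0"
    using 1 2 3 unfolding D by algebra
  moreover have "det (G x) * (w - a) = 0"
    using 1 2 3 unfolding D by algebra
  ultimately show "G x $ 2 $ 2 = G x $ 1 $ 1" "G x $ 2 $ 1 = q_fun k0 x * G x $ 1 $ 2"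
    using d by (auto simp: abc)
qed

definition Sigma_symbol :: "real \<Rightarrow> (rdot \<Rightarrow> complex^2^2) \<Rightarrow> surf \<Rightarrow> complex" where
  "Sigma_symbol k0 G P =
     pull (\<lambda>x. G x $ 1 $ 1) P + tau_over_p2 k0 P * pull (\<lambda>x. G x $ 1 $ 2) P"

end

theory Submission
  imports Defs "HOL-Complex_Analysis.Complex_Analysis"
begin

text \<open>
  Throughout, \<open>z\<close> stands for \<open>lam_ratio\<close>, the coordinate that maps the extended line to the unit circle,
  and \<open>\<kappa>\<close> for the image \<open>kap\<close> of \<open>i k0\<close>; then \<open>q = (1 - \<kappa> z) / (z (z - \<kappa>))\<close>.

  \<^bold>\<open>The vector problem.\<close>  The relation \<open>G\<^sup>T Q G = det G Q\<close> says that \<open>G\<close> multiplies the quadratic form of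
  \<open>Q\<close> by its determinant.  If \<open>G \<phi>p = \<phi>m\<close>, the value of the form at \<open>\<phi>p\<close>, freed of poles and multiplied
  by a unit, is analytic and bounded in the upper half-plane.  It coincides on the line with a function
  that is analytic and bounded in the lower half-plane and, because the index of the determinant is 1
  and \<open>\<phi>m\<close> vanishes at \<open>-i\<close>, has a zero at \<open>-i\<close>.  A Liouville theorem
  (\<open>Liouville_across_line\<close>) makes it zero.  The form represents zero only trivially, because its
  discriminant has simple zeros at the branch points (\<open>quadratic_form_anisotropic\<close>); so \<open>\<phi>p = 0\<close>.

  \<^bold>\<open>The problem on the surface.\<close>  The even and odd parts of \<open>\<psi>p\<close> and \<open>\<psi>m\<close> under the exchange of sheets are
  functions on the half-planes, up to the factors \<open>\<tau>/\<pp>\<^sub>1\<close> and \<open>\<tau>/\<pp>\<^sub>2\<close>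
  (\<open>even_odd_boundary_functions\<close>).  They form a solution of the vector problem.

  \<^bold>\<open>Existence of a factorization.\<close>  The matrices in question form a commutative algebra, in which
  \<open>G\<close> is given by the two functions \<open>\<alpha> \<plusminus> (\<tau>/\<pp>\<^sub>2) \<delta>\<close> on the line, its eigenvalues.  Up to rational elements
  with the right winding numbers, both have Hoelder logarithms.  By Privalov's theorem
  (\<open>Privalov_decomposition\<close>) such a logarithm splits into a plus and a minus part.  In the matrix algebra the
  splitting meets one scalar obstruction, since the surface has genus 1.  This obstruction is removed
  by a power of a rational matrix with eigenvalues \<open>1 \<plusminus> \<epsilon> \<sigma>\<close>, where \<open>\<sigma> = z \<tau>/\<pp>\<^sub>2\<close>: it depends
  holomorphically on \<open>\<epsilon>\<close> and is not constant, so every value is an integer multiple of an attained one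
  (\<open>obstruction_realized\<close>).  Hence \<open>G\<close> is a minus factor times a rational matrix times a plus factor, and
  rational matrices are factored by elementary operations (\<open>polynomial_matrix_factorization\<close>).

  \<^bold>\<open>The partial indices.\<close>  Their sum is the index of the determinant, which is 1.  A negative index would give
  a nonzero solution of the vector problem.  So the indices are 0 and 1.
\<close>

text \<open>The symbol \<open>$\<close> is reserved for vector components; leaving it to power series as well would make the
  formulas below ambiguous.\<close>

no_notation fps_nth (infixl "$" 75)

section \<open>Function algebras on the extended line\<close>

text \<open>The four function spaces of the problem (Hoelder functions, \<open>C_plus\<close>, \<open>C_minus\<close>, the disc
  algebra) enter all constructions only through these three closure properties.\<close>

locale fun_algebra =
  fixes A :: "('a \<Rightarrow> complex) set"
  assumes const [intro, simp]: "(\<lambda>_. c) \<in> A"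
    and add [intro]: "f \<in> A \<Longrightarrow> g \<in> A \<Longrightarrow> (\<lambda>x. f x + g x) \<in> A"
    and mult [intro]: "f \<in> A \<Longrightarrow> g \<in> A \<Longrightarrow> (\<lambda>x. f x * g x) \<in> A"
begin

lemma uminus [intro]: "f \<in> A \<Longrightarrow> (\<lambda>x. - f x) \<in> A"
  using mult[OF const[of "-1"], of f] by simp

lemma diff [intro]: "f \<in> A \<Longrightarrow> g \<in> A \<Longrightarrow> (\<lambda>x. f x - g x) \<in> A"
  using add[OF _ uminus, of f g] by simp

lemma power [intro]: "f \<in> A \<Longrightarrow> (\<lambda>x. f x ^ n) \<in> A"
  by (induction n) auto

lemma sum [intro]: "(\<And>i. i \<in> I \<Longrightarrow> f i \<in> A) \<Longrightarrow> (\<lambda>x. \<Sum>i\<in>I. f i x) \<in> A"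
  by (induction I rule: infinite_finite_induct) auto

lemma poly [intro]: "f \<in> A \<Longrightarrow> (\<lambda>x. poly p (f x)) \<in> A"
  unfolding poly_altdef by (intro sum mult const power)

end

lemma fun_algebra_Int:
  assumes "fun_algebra A" "fun_algebra B"
  shows "fun_algebra (A \<inter> B)"
proof -
  interpret A: fun_algebra A by fact
  interpret B: fun_algebra B by fact
  show ?thesis by unfold_locales auto
qed

lemma lam_ratio_denom: "complex_of_real r + \<i> \<noteq> 0" "complex_of_real r - \<i> \<noteq> 0"
  by (auto simp: complex_eq_iff)

lemma norm_lam_ratio [simp]: "norm (lam_ratio x) = 1"
proof -
  have "norm (complex_of_real r - \<i>) = norm (complex_of_real r + \<i>)" for r
    by (simp add: norm_complex_def)
  then show ?thesis
    using lam_ratio_denom by (auto simp: lam_ratio_def norm_divide split: option.splits)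
qed

lemma lam_ratio_nonzero [simp]: "lam_ratio x \<noteq> 0"
  using norm_lam_ratio[of x] by (metis norm_zero zero_neq_one)

lemma inj_lam_ratio: "lam_ratio x = lam_ratio y \<longleftrightarrow> x = y"
proof -
  have "lam_ratio (Some r) \<noteq> 1" for r
  proof
    assume "lam_ratio (Some r) = 1"
    then have "complex_of_real r - \<i> = complex_of_real r + \<i>"
      by (simp add: lam_ratio_def lam_ratio_denom divide_eq_eq)
    then show False by (simp add: complex_eq_iff)
  qed
  moreover have "r = t" if "lam_ratio (Some r) = lam_ratio (Some t)" for r t
    using that by (simp add: lam_ratio_def lam_ratio_denom frac_eq_eq) (auto simp: complex_eq_iff)
  ultimately show ?thesis
    by (cases x; cases y) (auto simp: lam_ratio_def[of None] dest: sym)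
qed

lemma range_lam_ratio: "range lam_ratio = sphere 0 1"
proof -
  have "z \<in> range lam_ratio" if "norm z = 1" for z
  proof (cases "z = 1")
    case True
    then have "z = lam_ratio None" by (simp add: lam_ratio_def)
    then show ?thesis by blast
  next
    case False
    define w where "w = \<i> * (1 + z) / (1 - z)"
    have "cnj z = 1 / z"
      using that by (metis complex_norm_square divide_eq_eq mult.commute norm_zero of_real_1 one_power2 zero_neq_one)
    moreover have "z \<noteq> 0" using that by auto
    ultimately have "cnj w = w"
      using False by (simp add: w_def divide_simps) (simp add: algebra_simps)
    then have w: "complex_of_real (Re w) = w" by (simp add: complex_eq_iff)
    have "lam_ratio (Some (Re w)) = z"
      unfolding lam_ratio_def option.case w using False by (simp add: w_def field_simps)
    then show ?thesis by (metis rangeI)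
  qed
  then show ?thesis by auto
qed

text \<open>The map \<open>lam_ratio\<close> is a bijection of the extended line onto the unit circle; its inverse makes
  compactness of the circle and integration over the angle available.\<close>

definition circle_pt :: "complex \<Rightarrow> rdot" where
  "circle_pt z = inv_into UNIV lam_ratio z"

lemma lam_ratio_circle_pt [simp]: "norm z = 1 \<Longrightarrow> lam_ratio (circle_pt z) = z"
  unfolding circle_pt_def by (rule f_inv_into_f) (simp add: range_lam_ratio)

lemma circle_pt_lam_ratio [simp]: "circle_pt (lam_ratio x) = x"
  using inj_lam_ratio lam_ratio_circle_pt norm_lam_ratio by blast

section \<open>Hoelder functions\<close>

lemma hoelderI:
  assumes "\<And>x y. norm (f x - f y) \<le> C * dist (lam_ratio x) (lam_ratio y) powr \<mu>"
  shows "f \<in> C_hoelder \<mu>"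
  using assms by (auto simp: C_hoelder_def)

lemma hoelderE:
  assumes "f \<in> C_hoelder \<mu>"
  obtains C where "C \<ge> 0"
    "\<And>x y. norm (f x - f y) \<le> C * dist (lam_ratio x) (lam_ratio y) powr \<mu>"
proof -
  obtain C where C: "norm (f x - f y) \<le> C * dist (lam_ratio x) (lam_ratio y) powr \<mu>" for x y
    using assms by (auto simp: C_hoelder_def)
  have "norm (f x - f y) \<le> \<bar>C\<bar> * dist (lam_ratio x) (lam_ratio y) powr \<mu>" for x y
    using C[of x y] by (smt (verit) mult_right_mono powr_ge_zero)
  then show ?thesis using that[of "\<bar>C\<bar>"] by simp
qed

lemma hoelder_continuous:
  assumes "f \<in> C_hoelder \<mu>" "\<mu> > 0"
  shows "continuous_on (sphere 0 1) (\<lambda>z. f (circle_pt z))"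
proof -
  obtain C where C: "C \<ge> 0"
      "\<And>x y. norm (f x - f y) \<le> C * dist (lam_ratio x) (lam_ratio y) powr \<mu>"
    using hoelderE[OF assms(1)] by metis
  have "((\<lambda>z. f (circle_pt z)) \<longlongrightarrow> f (circle_pt a)) (at a within sphere 0 1)"
    if "a \<in> sphere 0 1" for a
  proof (rule LIM_zero_cancel, rule Lim_null_comparison)
    show "\<forall>\<^sub>F z in at a within sphere 0 1.
        norm (f (circle_pt z) - f (circle_pt a)) \<le> C * dist z a powr \<mu>"
    proof -
      have "norm (f (circle_pt z) - f (circle_pt a)) \<le> C * dist z a powr \<mu>" if "z \<in> sphere 0 1" for z
        using C(2)[of "circle_pt z" "circle_pt a"] that \<open>a \<in> sphere 0 1\<close> by simp
      then show ?thesis by (auto simp: eventually_at_filter intro!: always_eventually)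
    qed
    have "((\<lambda>z. C * dist z a powr \<mu>) \<longlongrightarrow> C * 0 powr \<mu>) (at a within sphere 0 1)"
      using assms(2) by (intro tendsto_intros tendsto_powr') (auto intro!: tendsto_eq_intros)
    then show "((\<lambda>z. C * dist z a powr \<mu>) \<longlongrightarrow> 0) (at a within sphere 0 1)"
      by simp
  qed
  then show ?thesis by (auto simp: continuous_on_def)
qed

lemma compact_range_hoelder:
  assumes "f \<in> C_hoelder \<mu>" "\<mu> > 0"
  shows "compact (range f)"
proof -
  have "range f = (\<lambda>z. f (circle_pt z)) ` sphere 0 1"
    by (auto simp: image_iff) (metis circle_pt_lam_ratio mem_sphere_0 norm_lam_ratio)
  then show ?thesis
    using compact_continuous_image[OF hoelder_continuous[OF assms]] by simp
qed

lemma hoelder_bounded: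
  assumes "f \<in> C_hoelder \<mu>" "\<mu> > 0"
  obtains B where "B > 0" "\<And>x. norm (f x) \<le> B"
  using compact_imp_bounded[OF compact_range_hoelder[OF assms]]
  by (metis bounded_pos rangeI)

text \<open>Stated for a function \<open>H\<close> of the point rather than a composition, so that it covers
  \<open>\<Phi> (f x)\<close> with \<open>\<Phi>\<close> Lipschitz merely on the range of \<open>f\<close>.\<close>

lemma hoelder_lipschitz_comp:
  assumes "f \<in> C_hoelder \<mu>" and "\<And>x y. norm (H x - H y) \<le> L * norm (f x - f y)" "L \<ge> 0"
  shows "H \<in> C_hoelder \<mu>"
proof -
  obtain C where C: "C \<ge> 0"
      "\<And>x y. norm (f x - f y) \<le> C * dist (lam_ratio x) (lam_ratio y) powr \<mu>"
    using hoelderE[OF assms(1)] by metis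
  show ?thesis
  proof (rule hoelderI)
    fix x y
    show "norm (H x - H y) \<le> (L * C) * dist (lam_ratio x) (lam_ratio y) powr \<mu>"
      using assms(2)[of x y] mult_left_mono[OF C(2)[of x y] assms(3)] by (simp add: mult.assoc)
  qed
qed

lemma fun_algebra_hoelder:
  assumes "\<mu> > 0"
  shows "fun_algebra (C_hoelder \<mu>)"
proof
  show "(\<lambda>_. c) \<in> C_hoelder \<mu>" for c by (rule hoelderI[of _ 0]) simp
next
  fix f g assume fg: "f \<in> C_hoelder \<mu>" "g \<in> C_hoelder \<mu>"
  let ?d = "\<lambda>x y. dist (lam_ratio x) (lam_ratio y) powr \<mu>"
  obtain C where C: "C \<ge> 0" "\<And>x y. norm (f x - f y) \<le> C * ?d x y" using hoelderE[OF fg(1)] by metis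
  obtain D where D: "D \<ge> 0" "\<And>x y. norm (g x - g y) \<le> D * ?d x y" using hoelderE[OF fg(2)] by metis
  show "(\<lambda>x. f x + g x) \<in> C_hoelder \<mu>"
  proof (rule hoelderI)
    fix x y
    have "norm (f x + g x - (f y + g y)) \<le> norm (f x - f y) + norm (g x - g y)"
      by (metis add_diff_add norm_triangle_ineq)
    also have "\<dots> \<le> C * ?d x y + D * ?d x y" using C(2) D(2) by (intro add_mono)
    finally show "norm (f x + g x - (f y + g y)) \<le> (C + D) * ?d x y" by (simp add: algebra_simps)
  qed
  obtain B where B: "B > 0" "\<And>x. norm (f x) \<le> B" using hoelder_bounded[OF fg(1) assms] by metis
  obtain E where E: "E > 0" "\<And>x. norm (g x) \<le> E" using hoelder_bounded[OF fg(2) assms] by metis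
  show "(\<lambda>x. f x * g x) \<in> C_hoelder \<mu>"
  proof (rule hoelderI)
    fix x y
    have "f x * g x - f y * g y = f x * (g x - g y) + (f x - f y) * g y" by (simp add: algebra_simps)
    then have "norm (f x * g x - f y * g y) \<le> norm (f x) * norm (g x - g y) + norm (f x - f y) * norm (g y)"
      by (metis norm_mult norm_triangle_ineq)
    also have "\<dots> \<le> B * (D * ?d x y) + (C * ?d x y) * E"
      using B E C D by (intro add_mono mult_mono) (auto simp: less_imp_le)
    finally show "norm (f x * g x - f y * g y) \<le> (B * D + C * E) * ?d x y" by (simp add: algebra_simps)
  qed
qed

text \<open>Distances on the circle are at most 2, hence \<open>d = d\<^sup>\<mu> d\<^sup>1\<^sup>-\<^sup>\<mu> \<le> 2 d\<^sup>\<mu>\<close>.\<close>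

lemma hoelder_lam_ratio:
  assumes "0 < \<mu>" "\<mu> \<le> 1"
  shows "lam_ratio \<in> C_hoelder \<mu>"
proof (rule hoelderI)
  fix x y
  let ?d = "dist (lam_ratio x) (lam_ratio y)"
  have d: "?d \<le> 2" using norm_triangle_ineq4[of "lam_ratio x" "lam_ratio y"] by (simp add: dist_norm)
  have "?d = ?d powr \<mu> * ?d powr (1 - \<mu>)"
    by (cases "?d = 0") (simp_all flip: powr_add)
  also have "\<dots> \<le> ?d powr \<mu> * 2 powr 1"
  proof (intro mult_left_mono)
    have "?d powr (1 - \<mu>) \<le> 2 powr (1 - \<mu>)" using d assms by (intro powr_mono2) auto
    also have "\<dots> \<le> 2 powr 1" using assms by (intro powr_mono) auto
    finally show "?d powr (1 - \<mu>) \<le> 2 powr 1" .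
  qed simp
  finally show "norm (lam_ratio x - lam_ratio y) \<le> 2 * ?d powr \<mu>" by (simp add: dist_norm mult.commute)
qed

lemma hoelder_inverse:
  assumes "f \<in> C_hoelder \<mu>" "\<mu> > 0" "\<And>x. f x \<noteq> 0"
  shows "(\<lambda>x. inverse (f x)) \<in> C_hoelder \<mu>"
proof -
  have "compact ((\<lambda>z. norm z) ` range f)"
    by (intro compact_continuous_image compact_range_hoelder[OF assms(1,2)] continuous_intros)
  then obtain a where "a \<in> (\<lambda>z. norm z) ` range f" and a: "\<And>t. t \<in> (\<lambda>z. norm z) ` range f \<Longrightarrow> a \<le> t"
    using compact_attains_inf[of "(\<lambda>z. norm z) ` range f"] by auto
  then have a0: "a > 0" using assms(3) by auto
  have a': "a \<le> norm (f x)" for x using a by auto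
  show ?thesis
  proof (rule hoelder_lipschitz_comp[OF assms(1)])
    fix x y
    have "norm (inverse (f x) - inverse (f y)) = norm (f x - f y) / (norm (f x) * norm (f y))"
      using assms(3) by (simp add: inverse_diff_inverse norm_mult norm_inverse norm_minus_commute divide_inverse mult_ac)
    also have "\<dots> \<le> norm (f x - f y) / (a * a)"
      using a0 a' by (intro divide_left_mono mult_mono) (auto simp: assms(3) intro!: mult_pos_pos less_imp_le)
    finally show "norm (inverse (f x) - inverse (f y)) \<le> (1 / (a * a)) * norm (f x - f y)" by simp
  qed (use a0 in simp)
qed

lemma hoelder_divide:
  assumes "f \<in> C_hoelder \<mu>" "g \<in> C_hoelder \<mu>" "\<mu> > 0" "\<And>x. g x \<noteq> 0"
  shows "(\<lambda>x. f x / g x) \<in> C_hoelder \<mu>"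
  unfolding divide_inverse
  by (intro fun_algebra.mult fun_algebra_hoelder hoelder_inverse assms)

lemma hoelder_entire:
  assumes "f \<in> C_hoelder \<mu>" "\<mu> > 0" "H holomorphic_on UNIV"
  shows "(\<lambda>x. H (f x)) \<in> C_hoelder \<mu>"
proof -
  obtain B where B: "B > 0" "\<And>x. norm (f x) \<le> B" using hoelder_bounded[OF assms(1,2)] by metis
  have "compact (deriv H ` cball 0 B)"
    by (intro compact_continuous_image holomorphic_on_imp_continuous_on holomorphic_on_subset[OF holomorphic_deriv[OF assms(3)]]) auto
  then obtain L where L: "L > 0" "\<And>z. z \<in> cball 0 B \<Longrightarrow> norm (deriv H z) \<le> L"
    by (metis bounded_pos compact_imp_bounded imageI)
  show ?thesis
  proof (rule hoelder_lipschitz_comp[OF assms(1)])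
    fix x y
    show "norm (H (f x) - H (f y)) \<le> L * norm (f x - f y)"
    proof (rule field_differentiable_bound[of "cball 0 B" H "deriv H"])
      show "(H has_field_derivative deriv H z) (at z within cball 0 B)" for z
        using assms(3) holomorphic_derivI[of H UNIV z] by (auto intro: DERIV_subset)
    qed (use B L in auto)
  qed (use L in simp)
qed

section \<open>Bounded analytic functions with boundary values\<close>

lemma H_infE:
  assumes "f \<in> H_inf S"
  obtains F B where "F holomorphic_on S" "B > 0" "\<And>z. z \<in> S \<Longrightarrow> norm (F z) \<le> B"
    "AE x in lborel. \<forall>c>0. (F \<longlongrightarrow> f (Some x))
          (at (complex_of_real x) within {z \<in> S. \<bar>Re z - x\<bar> < c * \<bar>Im z\<bar>})"
proof -
  from assms obtain F where F: "F holomorphic_on S" "bounded (F ` S)"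
    "AE x in lborel. \<forall>c>0. (F \<longlongrightarrow> f (Some x))
          (at (complex_of_real x) within {z \<in> S. \<bar>Re z - x\<bar> < c * \<bar>Im z\<bar>})"
    by (auto simp: H_inf_def)
  from F(2) obtain B where "B > 0" "\<And>z. z \<in> S \<Longrightarrow> norm (F z) \<le> B"
    by (auto simp: bounded_pos)
  with F(1,3) that show ?thesis by blast
qed

lemma H_infI:
  assumes "F holomorphic_on S" "\<And>z. z \<in> S \<Longrightarrow> norm (F z) \<le> B"
    "AE x in lborel. \<forall>c>0. (F \<longlongrightarrow> f (Some x))
          (at (complex_of_real x) within {z \<in> S. \<bar>Re z - x\<bar> < c * \<bar>Im z\<bar>})"
  shows "f \<in> H_inf S"
  using assms by (auto simp: H_inf_def bounded_iff)

lemma fun_algebra_H_inf: "fun_algebra (H_inf S)"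
proof
  show "(\<lambda>_. c) \<in> H_inf S" for c
    by (rule H_infI[of "\<lambda>_. c" _ "norm c"]) auto
next
  fix f g assume f: "f \<in> H_inf S" and g: "g \<in> H_inf S"
  from f obtain F B where F: "F holomorphic_on S" "B > 0" "\<And>z. z \<in> S \<Longrightarrow> norm (F z) \<le> B"
    "AE x in lborel. \<forall>c>0. (F \<longlongrightarrow> f (Some x))
          (at (complex_of_real x) within {z \<in> S. \<bar>Re z - x\<bar> < c * \<bar>Im z\<bar>})" by (rule H_infE) blast
  from g obtain G C where G: "G holomorphic_on S" "C > 0" "\<And>z. z \<in> S \<Longrightarrow> norm (G z) \<le> C"
    "AE x in lborel. \<forall>c>0. (G \<longlongrightarrow> g (Some x))
          (at (complex_of_real x) within {z \<in> S. \<bar>Re z - x\<bar> < c * \<bar>Im z\<bar>})" by (rule H_infE) blast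
  show "(\<lambda>x. f x + g x) \<in> H_inf S"
  proof (rule H_infI[of "\<lambda>z. F z + G z" _ "B + C"])
    show "norm (F z + G z) \<le> B + C" if "z \<in> S" for z
      using norm_triangle_mono F(3) G(3) that by blast
    show "AE x in lborel. \<forall>c>0. ((\<lambda>z. F z + G z) \<longlongrightarrow> f (Some x) + g (Some x))
          (at (complex_of_real x) within {z \<in> S. \<bar>Re z - x\<bar> < c * \<bar>Im z\<bar>})"
      using F(4) G(4) by eventually_elim (auto intro: tendsto_add)
  qed (intro holomorphic_intros F G)
  show "(\<lambda>x. f x * g x) \<in> H_inf S"
  proof (rule H_infI[of "\<lambda>z. F z * G z" _ "B * C"])
    show "norm (F z * G z) \<le> B * C" if "z \<in> S" for z
      using F(2,3) G(3) that by (simp add: norm_mult mult_mono less_imp_le)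
    show "AE x in lborel. \<forall>c>0. ((\<lambda>z. F z * G z) \<longlongrightarrow> f (Some x) * g (Some x))
          (at (complex_of_real x) within {z \<in> S. \<bar>Re z - x\<bar> < c * \<bar>Im z\<bar>})"
      using F(4) G(4) by eventually_elim (auto intro: tendsto_mult)
  qed (intro holomorphic_intros F G)
qed

text \<open>The membership is witnessed by the extension \<open>H \<circ> F\<close>: no unique extension has to be identified,
  and the boundary values pass through by continuity of \<open>H\<close>.\<close>

lemma H_inf_entire:
  assumes "f \<in> H_inf S" "H holomorphic_on UNIV"
  shows "(\<lambda>x. H (f x)) \<in> H_inf S"
proof -
  from assms(1) obtain F B where F: "F holomorphic_on S" "B > 0" "\<And>z. z \<in> S \<Longrightarrow> norm (F z) \<le> B"
    "AE x in lborel. \<forall>c>0. (F \<longlongrightarrow> f (Some x))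
          (at (complex_of_real x) within {z \<in> S. \<bar>Re z - x\<bar> < c * \<bar>Im z\<bar>})" by (rule H_infE) blast
  have cont: "continuous_on UNIV H" using assms(2) by (rule holomorphic_on_imp_continuous_on)
  have "compact (H ` cball 0 B)"
    by (intro compact_continuous_image continuous_on_subset[OF cont]) auto
  then obtain L where L: "\<And>z. z \<in> cball 0 B \<Longrightarrow> norm (H z) \<le> L"
    by (metis bounded_pos compact_imp_bounded imageI)
  show ?thesis
  proof (rule H_infI[of "\<lambda>z. H (F z)" _ L])
    show "(\<lambda>z. H (F z)) holomorphic_on S"
      using holomorphic_on_compose_gen[OF F(1) assms(2)] by (simp add: o_def)
    show "norm (H (F z)) \<le> L" if "z \<in> S" for z using L F(3)[OF that] by simp
    have H: "isCont H w" for w using cont by (simp add: continuous_on_eq_continuous_at)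
    from F(4) show "AE x in lborel. \<forall>c>0. ((\<lambda>z. H (F z)) \<longlongrightarrow> H (f (Some x)))
          (at (complex_of_real x) within {z \<in> S. \<bar>Re z - x\<bar> < c * \<bar>Im z\<bar>})"
      by eventually_elim (auto intro: isCont_tendsto_compose[OF H])
  qed
qed

lemma fun_algebra_C_plus: "0 < \<mu> \<Longrightarrow> fun_algebra (C_plus \<mu>)"
  and fun_algebra_C_minus: "0 < \<mu> \<Longrightarrow> fun_algebra (C_minus \<mu>)"
  unfolding C_plus_def C_minus_def
  by (intro fun_algebra_Int fun_algebra_H_inf fun_algebra_hoelder; assumption)+

definition cayley :: "complex \<Rightarrow> complex" where
  "cayley \<xi> = (\<xi> - \<i>) / (\<xi> + \<i>)"

lemma lam_ratio_Some: "lam_ratio (Some x) = cayley (complex_of_real x)"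
  by (simp add: lam_ratio_def cayley_def)

lemma cayley_denom: "Im \<xi> \<ge> 0 \<Longrightarrow> \<xi> + \<i> \<noteq> 0" "Im \<xi> \<le> 0 \<Longrightarrow> \<xi> - \<i> \<noteq> 0"
  by (auto simp: complex_eq_iff)

lemma norm_cayley_less: "Im \<xi> > 0 \<Longrightarrow> norm (cayley \<xi>) < 1"
proof -
  assume "Im \<xi> > 0"
  then have "norm (\<xi> - \<i>) < norm (\<xi> + \<i>)"
    unfolding norm_complex_def by (intro real_sqrt_less_mono) (simp add: power2_eq_square algebra_simps)
  then show ?thesis using cayley_denom[of \<xi>] \<open>Im \<xi> > 0\<close> by (simp add: cayley_def norm_divide)
qed

lemma cayley_minus: "cayley (- \<xi>) = 1 / cayley \<xi>"
proof -
  have "cayley (- \<xi>) = (- (\<xi> + \<i>)) / (- (\<xi> - \<i>))" by (simp add: cayley_def)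
  also have "\<dots> = (\<xi> + \<i>) / (\<xi> - \<i>)" by (metis minus_divide_left minus_divide_right minus_minus)
  finally show ?thesis by (simp add: cayley_def)
qed

lemma norm_inverse_cayley_less: "Im \<xi> < 0 \<Longrightarrow> norm (1 / cayley \<xi>) < 1"
  using norm_cayley_less[of "- \<xi>"] by (simp add: cayley_minus)

lemma holomorphic_cayley: "cayley holomorphic_on {\<xi>. Im \<xi> \<ge> 0}"
  unfolding cayley_def by (intro holomorphic_intros) (auto simp: cayley_denom)

text \<open>Explicit elements of \<open>C_plus\<close> and \<open>C_minus\<close> are produced on the disc, by substituting
  \<open>lam_ratio\<close> or its inverse into a function of this algebra.\<close>

definition disc_algebra :: "(complex \<Rightarrow> complex) set" where
  "disc_algebra = {\<Phi>. continuous_on (cball 0 1) \<Phi> \<and> \<Phi> holomorphic_on ball 0 1}"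

lemma fun_algebra_disc_algebra: "fun_algebra disc_algebra"
  by standard (auto simp: disc_algebra_def intro!: continuous_intros holomorphic_intros)

lemma H_inf_disc:
  assumes \<Phi>: "\<Phi> \<in> disc_algebra" and c: "c holomorphic_on S" "\<And>z. z \<in> S \<Longrightarrow> norm (c z) < 1"
    and real: "\<And>x. isCont c (complex_of_real x)" "\<And>x. norm (c (complex_of_real x)) \<le> 1"
    and f: "\<And>x. f (Some x) = \<Phi> (c (complex_of_real x))"
  shows "f \<in> H_inf S"
proof -
  have cont: "continuous_on (cball 0 1) \<Phi>" and holo: "\<Phi> holomorphic_on ball 0 1"
    using \<Phi> by (auto simp: disc_algebra_def)
  have "compact (\<Phi> ` cball 0 1)" using compact_continuous_image[OF cont] by simp
  then obtain L where L: "\<And>z. z \<in> cball 0 1 \<Longrightarrow> norm (\<Phi> z) \<le> L"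
    by (metis bounded_pos compact_imp_bounded imageI)
  have into: "c z \<in> cball 0 1" if "z \<in> S" for z
    using c(2)[OF that] by simp
  show ?thesis
  proof (rule H_infI[of "\<lambda>z. \<Phi> (c z)" _ L])
    have "\<Phi> \<circ> c holomorphic_on S"
      by (rule holomorphic_on_compose_gen[OF c(1) holo]) (use c(2) in auto)
    then show "(\<lambda>z. \<Phi> (c z)) holomorphic_on S" by (simp add: o_def)
    show "norm (\<Phi> (c z)) \<le> L" if "z \<in> S" for z using L into[OF that] by blast
    have "((\<lambda>z. \<Phi> (c z)) \<longlongrightarrow> f (Some x)) (at (complex_of_real x) within {z \<in> S. \<bar>Re z - x\<bar> < d * \<bar>Im z\<bar>})" for x d
    proof -
      let ?F = "at (complex_of_real x) within {z \<in> S. \<bar>Re z - x\<bar> < d * \<bar>Im z\<bar>}"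
      have "(c \<longlongrightarrow> c (complex_of_real x)) ?F"
        using real(1)[of x] by (meson continuous_at_imp_continuous_at_within continuous_within)
      moreover have "\<forall>\<^sub>F z in ?F. c z \<in> cball 0 1"
        unfolding eventually_at_filter using into by (auto intro!: always_eventually)
      moreover have "c (complex_of_real x) \<in> cball 0 1" using real(2) by simp
      ultimately show ?thesis unfolding f using continuous_on_tendsto_compose[OF cont] by blast
    qed
    then show "AE x in lborel. \<forall>d>0. ((\<lambda>z. \<Phi> (c z)) \<longlongrightarrow> f (Some x))
        (at (complex_of_real x) within {z \<in> S. \<bar>Re z - x\<bar> < d * \<bar>Im z\<bar>})" by simp
  qed
qed

lemma H_inf_upper_disc:
  assumes "\<Phi> \<in> disc_algebra"
  shows "(\<lambda>x. \<Phi> (lam_ratio x)) \<in> H_inf upper"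
proof (rule H_inf_disc[OF assms, of cayley])
  show "cayley holomorphic_on upper"
    by (rule holomorphic_on_subset[OF holomorphic_cayley]) (auto simp: upper_def)
  show "isCont cayley (complex_of_real x)" for x
    unfolding cayley_def by (intro continuous_intros) (simp add: lam_ratio_denom)
qed (auto simp: upper_def norm_cayley_less simp flip: lam_ratio_Some)

lemma H_inf_lower_disc:
  assumes "\<Phi> \<in> disc_algebra"
  shows "(\<lambda>x. \<Phi> (inverse (lam_ratio x))) \<in> H_inf lower"
proof (rule H_inf_disc[OF assms, of "\<lambda>\<xi>. cayley (- \<xi>)"])
  have lam: "cayley (- complex_of_real x) = inverse (lam_ratio (Some x))" for x
    unfolding lam_ratio_Some cayley_minus by (simp add: inverse_eq_divide)
  show "(\<lambda>\<xi>. cayley (- \<xi>)) holomorphic_on lower"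
    unfolding cayley_def by (intro holomorphic_intros) (auto simp: cayley_denom lower_def)
  show "norm (cayley (- \<xi>)) < 1" if "\<xi> \<in> lower" for \<xi>
    using norm_cayley_less[of "- \<xi>"] that by (simp add: lower_def)
  show "isCont (\<lambda>\<xi>. cayley (- \<xi>)) (complex_of_real x)" for x
    unfolding cayley_def using cayley_denom(1)[of "- complex_of_real x"] by (intro continuous_intros) simp
  show "norm (cayley (- complex_of_real x)) \<le> 1" for x
    unfolding lam by (simp add: norm_inverse)
  show "\<Phi> (inverse (lam_ratio (Some x))) = \<Phi> (cayley (- complex_of_real x))" for x
    unfolding lam ..
qed

section \<open>A Liouville theorem across the real line\<close>

text \<open>A primitive of a bounded function is Lipschitz, so it has boundary values everywhere, even where
  the function itself has none.\<close>

lemma bounded_deriv_extends_to_closure: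
  assumes S: "convex S" "open S" and F: "F holomorphic_on S" "\<And>z. z \<in> S \<Longrightarrow> norm (F z) \<le> B"
  obtains P where "continuous_on (closure S) P"
    "\<And>z. z \<in> S \<Longrightarrow> (P has_field_derivative F z) (at z)"
proof -
  obtain G where G: "\<And>z. z \<in> S \<Longrightarrow> (G has_field_derivative F z) (at z within S)"
    using holomorphic_convex_primitive'[OF S F(1)] by blast
  have G': "(G has_field_derivative F z) (at z)" if "z \<in> S" for z
    using G[OF that] at_within_open[OF that S(2)] by simp
  have lip: "norm (G w - G z) \<le> B * norm (w - z)" if "z \<in> S" "w \<in> S" for z w
    using field_differentiable_bound[OF S(1) G F(2) that] by (simp add: norm_minus_commute)
  have "uniformly_continuous_on S G"
  proof -
    have "(max B 0)-lipschitz_on S G"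
    proof (rule lipschitz_onI)
      show "dist (G x) (G y) \<le> max B 0 * dist x y" if "x \<in> S" "y \<in> S" for x y
        using lip[OF that(2,1)] mult_right_mono[of B "max B 0" "norm (x - y)"]
        by (simp add: dist_norm)
    qed simp
    then show ?thesis by (rule lipschitz_on_uniformly_continuous)
  qed
  then obtain P where P: "uniformly_continuous_on (closure S) P" "\<And>x. x \<in> S \<Longrightarrow> G x = P x"
    by (rule uniformly_continuous_on_extension_on_closure) blast
  have "(P has_field_derivative F z) (at z)" if "z \<in> S" for z
    using has_field_derivative_transform_within_open[OF G'[OF that] S(2) that] P(2) by blast
  then show ?thesis using P(1) that uniformly_continuous_imp_continuous by blast
qed

lemma closure_upper: "closure upper = {z. Im z \<ge> 0}"
  and closure_lower: "closure lower = {z. Im z \<le> 0}"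
  using closure_halfspace_gt[of "\<i>" 0] closure_halfspace_lt[of "\<i>" 0]
  by (auto simp: upper_def lower_def inner_complex_def)

lemma open_upper [simp]: "open upper" and open_lower [simp]: "open lower"
  and convex_upper [simp]: "convex upper" and convex_lower [simp]: "convex lower"
  using open_halfspace_Im_gt[of 0] open_halfspace_Im_lt[of 0] convex_halfspace_Im_gt[of 0] convex_halfspace_Im_lt[of 0]
  by (auto simp: upper_def lower_def)

lemma primitive_horizontal:
  assumes "\<And>z. z \<in> S \<Longrightarrow> (P has_field_derivative F z) (at z)" "F holomorphic_on S"
    "\<And>t. t \<in> {a..b} \<Longrightarrow> complex_of_real t + c \<in> S" "a \<le> b"
  shows "((\<lambda>t. F (complex_of_real t + c)) has_integral
           (P (complex_of_real b + c) - P (complex_of_real a + c))) {a..b}"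
proof (rule fundamental_theorem_of_calculus[OF assms(4)])
  fix t assume t: "t \<in> {a..b}"
  have "((\<lambda>t. complex_of_real t + c) has_vector_derivative 1) (at t within {a..b})"
    by (auto intro!: derivative_eq_intros)
  then have "((P \<circ> (\<lambda>t. complex_of_real t + c)) has_vector_derivative 1 * F (complex_of_real t + c)) (at t within {a..b})"
    by (rule field_vector_diff_chain_within) (use assms(1)[OF assms(3)[OF t]] in \<open>auto intro: DERIV_subset\<close>)
  then show "((\<lambda>t. P (complex_of_real t + c)) has_vector_derivative F (complex_of_real t + c)) (at t within {a..b})"
    by (simp add: o_def)
qed

text \<open>Boundary values that exist only almost everywhere do not allow \<open>F\<close> and \<open>G\<close> to be glued directly.
  Their primitives \<open>P\<close> and \<open>R\<close> are continuous up to the line, and by dominated convergence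
  \<open>P - R\<close> is constant there.  After correction by that constant the two primitives form one
  function that is continuous on the plane and holomorphic off the line, hence entire; its
  derivative is bounded, hence constant.\<close>

theorem Liouville_across_line:
  fixes F G :: "complex \<Rightarrow> complex"
  assumes F: "F holomorphic_on upper" "\<And>z. z \<in> upper \<Longrightarrow> norm (F z) \<le> B"
    and G: "G holomorphic_on lower" "\<And>z. z \<in> lower \<Longrightarrow> norm (G z) \<le> B"
    and bd: "AE x in lborel. ((\<lambda>e. F (Complex x e) - G (Complex x (- e))) \<longlongrightarrow> 0) (at_right 0)"
  obtains c where "\<And>z. z \<in> upper \<Longrightarrow> F z = c" "\<And>z. z \<in> lower \<Longrightarrow> G z = c"
proof -
  obtain P where P: "continuous_on {z. Im z \<ge> 0} P"
      "\<And>z. z \<in> upper \<Longrightarrow> (P has_field_derivative F z) (at z)"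
    using bounded_deriv_extends_to_closure[OF convex_upper open_upper F] closure_upper by metis
  obtain R where R: "continuous_on {z. Im z \<le> 0} R"
      "\<And>z. z \<in> lower \<Longrightarrow> (R has_field_derivative G z) (at z)"
    using bounded_deriv_extends_to_closure[OF convex_lower open_lower G] closure_lower by metis
  define D where "D x = P (complex_of_real x) - R (complex_of_real x)" for x
  have D_eq: "D b = D a" if ab: "a \<le> b" for a b
  proof -
    define e where "e n = 1 / real (Suc n)" for n
    have e0: "e n > 0" for n by (simp add: e_def)
    have elim: "e \<longlonglongrightarrow> 0" unfolding e_def using LIMSEQ_inverse_real_of_nat by (simp add: inverse_eq_divide)
    have e_right: "filterlim e (at_right 0) sequentially"
      unfolding filterlim_at using e0 by (auto simp: elim less_imp_neq[THEN not_sym] intro!: always_eventually)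
    define h where "h n t = F (Complex t (e n)) - G (Complex t (- e n))" for n t
    have Cx: "Complex t s = complex_of_real t + \<i> * complex_of_real s" for t s
      by (simp add: complex_eq_iff)
    define pr where "pr n x = P (Complex x (e n)) - R (Complex x (- e n))" for n x
    have int: "(h n has_integral (pr n b - pr n a)) {a..b}" for n
    proof -
      have "((\<lambda>t. F (complex_of_real t + \<i> * e n)) has_integral
           (P (complex_of_real b + \<i> * e n) - P (complex_of_real a + \<i> * e n))) {a..b}"
        by (rule primitive_horizontal[of upper]) (use P F ab e0 in \<open>auto simp: upper_def\<close>)
      moreover have "((\<lambda>t. G (complex_of_real t + \<i> * (- e n))) has_integral
           (R (complex_of_real b + \<i> * (- e n)) - R (complex_of_real a + \<i> * (- e n)))) {a..b}"
        by (rule primitive_horizontal[of lower]) (use R G ab e0 in \<open>auto simp: lower_def\<close>)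
      ultimately have "((\<lambda>t. F (complex_of_real t + \<i> * e n) - G (complex_of_real t + \<i> * (- e n))) has_integral
          ((P (complex_of_real b + \<i> * e n) - P (complex_of_real a + \<i> * e n))
           - (R (complex_of_real b + \<i> * (- e n)) - R (complex_of_real a + \<i> * (- e n))))) {a..b}"
        by (rule has_integral_diff)
      then show ?thesis unfolding h_def pr_def Cx by (simp add: algebra_simps)
    qed
    have cont_h: "continuous_on UNIV (h n)" for n
      unfolding h_def Cx
      by (intro continuous_intros continuous_on_compose2[OF holomorphic_on_imp_continuous_on[OF F(1)]]
          continuous_on_compose2[OF holomorphic_on_imp_continuous_on[OF G(1)]])
         (auto simp: upper_def lower_def e0)
    have hb: "norm (h n t) \<le> 2 * B" for n t
    proof -
      have "norm (h n t) \<le> norm (F (Complex t (e n))) + norm (G (Complex t (- e n)))"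
        unfolding h_def by (rule norm_triangle_ineq4)
      also have "\<dots> \<le> B + B" by (intro add_mono F G) (auto simp: upper_def lower_def e0)
      finally show ?thesis by simp
    qed
    have "(\<lambda>n. (LINT t|lborel. indicator {a..b} t *\<^sub>R h n t)) \<longlonglongrightarrow> (LINT (t::real)|lborel. (0::complex))"
    proof (rule integral_dominated_convergence[where w = "\<lambda>t. indicator {a..b} t *\<^sub>R (2 * B)"])
      show "(\<lambda>t. indicator {a..b} t *\<^sub>R h n t) \<in> borel_measurable lborel" for n
        using borel_measurable_continuous_onI[OF cont_h[of n]] by (intro borel_measurable_scaleR) auto
      show "integrable lborel (\<lambda>t. indicator {a..b} t *\<^sub>R (2 * B))"
      proof -
        have "integrable lborel (indicator {a..b} :: real \<Rightarrow> real)"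
          by (rule integrable_real_indicator) (auto simp: emeasure_lborel_Icc_eq)
        then show ?thesis by simp
      qed
      show "AE t in lborel. norm (indicator {a..b} t *\<^sub>R h n t) \<le> indicator {a..b} t *\<^sub>R (2 * B)" for n
        using hb by (auto simp: indicator_def intro!: AE_I2)
      show "AE t in lborel. (\<lambda>n. indicator {a..b} t *\<^sub>R h n t) \<longlonglongrightarrow> 0"
        using bd
      proof eventually_elim
        case (elim t)
        then have "(\<lambda>n. h n t) \<longlonglongrightarrow> 0"
          unfolding h_def by (rule filterlim_compose[OF _ e_right])
        then have "(\<lambda>n. indicator {a..b} t *\<^sub>R h n t) \<longlonglongrightarrow> indicator {a..b} t *\<^sub>R 0"
          by (intro tendsto_intros)
        then show ?case by simp
      qed
    qed auto
    moreover have "(LINT t|lborel. indicator {a..b} t *\<^sub>R h n t) = pr n b - pr n a" for n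
    proof -
      have "set_integrable lborel {a..b} (h n)"
        using borel_integrable_atLeastAtMost'[of a b "h n"] cont_h continuous_on_subset by blast
      note I = set_borel_integral_eq_integral[OF this]
      have "(h n has_integral (LINT t:{a..b}|lborel. h n t)) {a..b}"
        unfolding I(2) by (rule integrable_integral[OF I(1)])
      from has_integral_unique[OF int this] show ?thesis by (simp add: set_lebesgue_integral_def)
    qed
    ultimately have "(\<lambda>n. pr n b - pr n a) \<longlonglongrightarrow> 0" by simp
    moreover have "(\<lambda>n. pr n x) \<longlonglongrightarrow> D x" for x
    proof -
      have "(\<lambda>n. Complex x (e n)) \<longlonglongrightarrow> complex_of_real x"
        using tendsto_Complex[OF tendsto_const elim] by (simp add: complex_of_real_def)
      then have 1: "(\<lambda>n. P (Complex x (e n))) \<longlonglongrightarrow> P (complex_of_real x)"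
        by (rule continuous_on_tendsto_compose[OF P(1)]) (auto simp: less_imp_le[OF e0])
      have "(\<lambda>n. - e n) \<longlonglongrightarrow> 0" using tendsto_minus[OF elim] by simp
      then have "(\<lambda>n. Complex x (- e n)) \<longlonglongrightarrow> complex_of_real x"
        using tendsto_Complex[OF tendsto_const] by (metis complex_of_real_def)
      then have 2: "(\<lambda>n. R (Complex x (- e n))) \<longlonglongrightarrow> R (complex_of_real x)"
        by (rule continuous_on_tendsto_compose[OF R(1)]) (auto simp: less_imp_le[OF e0])
      show ?thesis unfolding pr_def D_def by (intro tendsto_diff 1 2)
    qed
    then have "(\<lambda>n. pr n b - pr n a) \<longlonglongrightarrow> D b - D a" by (intro tendsto_diff)
    ultimately show "D b = D a" using LIMSEQ_unique by fastforce
  qed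
  define H where "H z = (if Im z \<ge> 0 then P z else R z + D 0)" for z
  have DD: "D x = D 0" for x using D_eq[of 0 x] D_eq[of x 0] by (cases "0 \<le> x") auto
  have contH: "continuous_on UNIV H"
  proof -
    have "continuous_on ({z. Im z \<ge> 0} \<union> {z. Im z \<le> 0}) H"
      unfolding H_def
    proof (rule continuous_on_If)
      show "P z = R z + D 0" if "z \<in> {z. Im z \<le> 0}" "0 \<le> Im z" for z
      proof -
        have "z = complex_of_real (Re z)" using that by (simp add: complex_eq_iff)
        then show ?thesis using DD[of "Re z"] unfolding D_def by (metis add.commute diff_add_cancel)
      qed
    qed (use P(1) R(1) in \<open>auto intro!: continuous_intros closed_halfspace_Im_ge closed_halfspace_Im_le\<close>)
    moreover have "{z. Im z \<ge> 0} \<union> {z. Im z \<le> 0} = UNIV" by auto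
    ultimately show ?thesis by simp
  qed
  have derU: "(H has_field_derivative F z) (at z)" if "z \<in> upper" for z
    by (rule has_field_derivative_transform_within_open[OF P(2)[OF that] open_upper that])
      (auto simp: H_def upper_def)
  have derL: "(H has_field_derivative G z) (at z)" if "z \<in> lower" for z
  proof (rule has_field_derivative_transform_within_open[OF _ open_lower that])
    show "((\<lambda>z. R z + D 0) has_field_derivative G z) (at z)"
      using R(2)[OF that] by (auto intro!: derivative_eq_intros)
  qed (auto simp: H_def lower_def)
  have holH: "H holomorphic_on UNIV"
  proof (rule holomorphic_on_paste_across_line[of UNIV "\<i>" _ 0])
    show "H holomorphic_on UNIV \<inter> {z. \<i> \<bullet> z < 0}"
      using derL by (auto simp: inner_complex_def holomorphic_on_def field_differentiable_def lower_def
          intro: has_field_derivative_at_within)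
    show "H holomorphic_on UNIV \<inter> {z. 0 < \<i> \<bullet> z}"
      using derU by (auto simp: inner_complex_def holomorphic_on_def field_differentiable_def upper_def
          intro: has_field_derivative_at_within)
  qed (use contH in auto)
  have dU: "deriv H z = F z" if "z \<in> upper" for z using derU[OF that] DERIV_imp_deriv by blast
  have dL: "deriv H z = G z" if "z \<in> lower" for z using derL[OF that] DERIV_imp_deriv by blast
  have contd: "continuous_on UNIV (deriv H)"
    using holomorphic_on_imp_continuous_on[OF holomorphic_deriv[OF holH]] by simp
  have "norm (deriv H z) \<le> B" for z
  proof -
    have "continuous_on (closure upper) (deriv H)" "continuous_on (closure lower) (deriv H)"
      using contd continuous_on_subset by blast+
    then have "z \<in> closure upper \<Longrightarrow> ?thesis" "z \<in> closure lower \<Longrightarrow> ?thesis"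
      using continuous_on_closure_norm_le[of upper "deriv H" B z] continuous_on_closure_norm_le[of lower "deriv H" B z]
        F(2) G(2) dU dL by auto
    then show ?thesis by (auto simp: closure_upper closure_lower intro: linorder_le_cases[of "Im z" 0])
  qed
  then have "bounded (range (deriv H))" by (auto simp: bounded_iff)
  then have "deriv H constant_on UNIV"
    using Liouville_theorem holomorphic_deriv[OF holH] by blast
  then obtain c where "deriv H z = c" for z by (auto simp: constant_on_def)
  then show ?thesis using that dU dL by metis
qed

lemma tendsto_vertical_upper:
  assumes "(F \<longlongrightarrow> l) (at (complex_of_real x) within {z \<in> upper. \<bar>Re z - x\<bar> < 1 * \<bar>Im z\<bar>})"
  shows "((\<lambda>e. F (Complex x e)) \<longlongrightarrow> l) (at_right 0)"
proof (rule filterlim_compose[OF assms])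
  have "((\<lambda>e. Complex x e) \<longlongrightarrow> Complex x 0) (at_right 0)" by (intro tendsto_intros tendsto_Complex)
  then show "filterlim (Complex x) (at (complex_of_real x) within {z \<in> upper. \<bar>Re z - x\<bar> < 1 * \<bar>Im z\<bar>}) (at_right 0)"
    unfolding filterlim_at
    by (auto simp: complex_of_real_def eventually_at_filter upper_def intro!: always_eventually)
qed

lemma tendsto_vertical_lower:
  assumes "(F \<longlongrightarrow> l) (at (complex_of_real x) within {z \<in> lower. \<bar>Re z - x\<bar> < 1 * \<bar>Im z\<bar>})"
  shows "((\<lambda>e. F (Complex x (- e))) \<longlongrightarrow> l) (at_right 0)"
proof (rule filterlim_compose[OF assms])
  have "((\<lambda>e. Complex x (- e)) \<longlongrightarrow> Complex x (- 0)) (at_right 0)" by (intro tendsto_intros tendsto_Complex)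
  then show "filterlim (\<lambda>e. Complex x (- e)) (at (complex_of_real x) within {z \<in> lower. \<bar>Re z - x\<bar> < 1 * \<bar>Im z\<bar>}) (at_right 0)"
    unfolding filterlim_at
    by (auto simp: complex_of_real_def eventually_at_filter lower_def intro!: always_eventually)
qed

text \<open>The complement of a null set is dense, also near infinity: the exceptional set can be avoided
  by a sequence that tends to any prescribed point of the extended line.\<close>

lemma hoelder_eq_if_AE:
  assumes "f \<in> C_hoelder \<mu>" "\<mu> > 0" "AE x in lborel. f (Some x) = c"
  shows "f x = c"
proof -
  obtain C where C: "C \<ge> 0" "\<And>x y. norm (f x - f y) \<le> C * dist (lam_ratio x) (lam_ratio y) powr \<mu>"
    using hoelderE[OF assms(1)] by metis
  define N where "N = {x. f (Some x) \<noteq> c}"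
  have "negligible N"
  proof -
    have "AE x in lebesgue. f (Some x) = c" using assms(3) by (rule AE_completion)
    then obtain M where "M \<in> null_sets lebesgue" "N \<subseteq> M"
      unfolding eventually_ae_filter N_def by auto
    then show ?thesis using negligible_iff_null_sets negligible_subset by blast
  qed
  then have dense: "\<exists>y. y \<in> T \<and> y \<notin> N" if "open T" "T \<noteq> {}" for T
    using that open_not_negligible[of T] negligible_subset[OF \<open>negligible N\<close>, of T] by auto
  have lim: "f x = c" if fl: "((\<lambda>y. lam_ratio (Some (g y))) \<longlongrightarrow> lam_ratio x) F" "F \<noteq> bot" "\<forall>\<^sub>F y in F. f (Some (g y)) = c"
    for g :: "nat \<Rightarrow> real" and F x
  proof -
    have "((\<lambda>y. f (Some (g y)) - f x) \<longlongrightarrow> 0) F"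
    proof (rule Lim_null_comparison)
      show "\<forall>\<^sub>F y in F. norm (f (Some (g y)) - f x) \<le> C * dist (lam_ratio (Some (g y))) (lam_ratio x) powr \<mu>"
        using C(2) by auto
      have "((\<lambda>y. C * dist (lam_ratio (Some (g y))) (lam_ratio x) powr \<mu>) \<longlongrightarrow> C * 0 powr \<mu>) F"
        using assms(2) fl(1) by (intro tendsto_intros tendsto_powr') (auto intro!: tendsto_eq_intros)
      then show "((\<lambda>y. C * dist (lam_ratio (Some (g y))) (lam_ratio x) powr \<mu>) \<longlongrightarrow> 0) F" by simp
    qed
    moreover have "((\<lambda>y. f (Some (g y)) - f x) \<longlongrightarrow> c - f x) F"
      by (rule tendsto_eventually) (use fl(3) in eventually_elim, simp)
    ultimately show ?thesis using tendsto_unique[OF fl(2)] by fastforce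
  qed
  show "f x = c"
  proof (cases x)
    case (Some t)
    have "\<exists>y. y \<in> ball t (1 / real (Suc n)) \<and> y \<notin> N" for n by (rule dense) auto
    then obtain g where g: "\<And>n. g n \<in> ball t (1 / real (Suc n))" "\<And>n. g n \<notin> N" by metis
    have "g \<longlonglongrightarrow> t"
    proof (rule LIMSEQ_norm_0[THEN LIM_zero_cancel])
      show "norm (g n - t) < 1 / real (Suc n)" for n using g(1)[of n] by (simp add: dist_norm norm_minus_commute)
    qed
    then have "(\<lambda>n. lam_ratio (Some (g n))) \<longlonglongrightarrow> lam_ratio x"
      unfolding Some lam_ratio_Some cayley_def by (intro tendsto_intros) (auto simp: lam_ratio_denom)
    then show ?thesis by (rule lim) (use g(2) in \<open>auto simp: N_def\<close>)
  next
    case None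
    have "\<exists>y. y \<in> {real n<..} \<and> y \<notin> N" for n by (rule dense) (auto intro: exI[of _ "real n + 1"])
    then obtain g where g: "\<And>n. g n > real n" "\<And>n. g n \<notin> N" by (metis greaterThan_iff)
    have "filterlim g at_top sequentially"
      by (rule filterlim_at_top_mono[OF filterlim_real_sequentially]) (use g(1) in \<open>auto intro!: always_eventually less_imp_le\<close>)
    have "(\<lambda>n. lam_ratio (Some (g n)) - 1) \<longlonglongrightarrow> 0"
    proof (rule Lim_null_comparison)
      have "norm (lam_ratio (Some (g n)) - 1) \<le> 2 / g n" if "n > 0" for n
      proof -
        have gp: "g n > 0" using g(1)[of n] that by linarith
        have "lam_ratio (Some (g n)) - 1 = - 2 * \<i> / (complex_of_real (g n) + \<i>)"
          by (simp add: lam_ratio_def lam_ratio_denom divide_simps)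
        then have "norm (lam_ratio (Some (g n)) - 1) = 2 / norm (complex_of_real (g n) + \<i>)"
          by (simp add: norm_divide norm_mult)
        moreover have "g n \<le> norm (complex_of_real (g n) + \<i>)"
          using complex_Re_le_cmod[of "complex_of_real (g n) + \<i>"] by simp
        ultimately show ?thesis using gp by (simp add: frac_le)
      qed
      then show "\<forall>\<^sub>F n in sequentially. norm (lam_ratio (Some (g n)) - 1) \<le> 2 / g n"
        using eventually_gt_at_top[of 0] by (rule eventually_mono[rotated]) auto
      show "(\<lambda>n. 2 / g n) \<longlonglongrightarrow> 0"
        using \<open>filterlim g at_top sequentially\<close> by (rule real_tendsto_divide_at_top[OF tendsto_const])
    qed
    then have "(\<lambda>n. lam_ratio (Some (g n))) \<longlonglongrightarrow> lam_ratio x"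
      unfolding None using LIM_zero_cancel by (fastforce simp: lam_ratio_def)
    then show ?thesis by (rule lim) (use g(2) in \<open>auto simp: N_def\<close>)
  qed
qed

lemma H_inf_upper_vertical:
  assumes "f \<in> H_inf upper"
  obtains F B where "F holomorphic_on upper" "\<And>z. z \<in> upper \<Longrightarrow> norm (F z) \<le> B"
    "AE x in lborel. ((\<lambda>e. F (Complex x e)) \<longlongrightarrow> f (Some x)) (at_right 0)"
proof -
  from assms obtain F B where F: "F holomorphic_on upper" "\<And>z. z \<in> upper \<Longrightarrow> norm (F z) \<le> B"
    "AE x in lborel. \<forall>c>0. (F \<longlongrightarrow> f (Some x))
          (at (complex_of_real x) within {z \<in> upper. \<bar>Re z - x\<bar> < c * \<bar>Im z\<bar>})" by (rule H_infE) blast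
  have "AE x in lborel. ((\<lambda>e. F (Complex x e)) \<longlongrightarrow> f (Some x)) (at_right 0)"
    using F(3)
  proof eventually_elim
    case (elim x)
    show ?case using elim[rule_format, OF zero_less_one] by (rule tendsto_vertical_upper)
  qed
  with F(1,2) show ?thesis by (rule that)
qed

lemma H_inf_lower_vertical:
  assumes "f \<in> H_inf lower"
  obtains F B where "F holomorphic_on lower" "\<And>z. z \<in> lower \<Longrightarrow> norm (F z) \<le> B"
    "AE x in lborel. ((\<lambda>e. F (Complex x (- e))) \<longlongrightarrow> f (Some x)) (at_right 0)"
proof -
  from assms obtain F B where F: "F holomorphic_on lower" "\<And>z. z \<in> lower \<Longrightarrow> norm (F z) \<le> B"
    "AE x in lborel. \<forall>c>0. (F \<longlongrightarrow> f (Some x))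
          (at (complex_of_real x) within {z \<in> lower. \<bar>Re z - x\<bar> < c * \<bar>Im z\<bar>})" by (rule H_infE) blast
  have "AE x in lborel. ((\<lambda>e. F (Complex x (- e))) \<longlongrightarrow> f (Some x)) (at_right 0)"
    using F(3)
  proof eventually_elim
    case (elim x)
    show ?case using elim[rule_format, OF zero_less_one] by (rule tendsto_vertical_lower)
  qed
  with F(1,2) show ?thesis by (rule that)
qed

lemma hoelder_zero_if_extension_zero:
  assumes "f \<in> C_hoelder \<mu>" "\<mu> > 0" "\<And>z. z \<in> upper \<Longrightarrow> F z = 0"
    and lim: "AE x in lborel. ((\<lambda>e. F (Complex x e)) \<longlongrightarrow> f (Some x)) (at_right 0)"
  shows "f x = 0"
proof (rule hoelder_eq_if_AE[OF assms(1,2)])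
  have "\<forall>\<^sub>F e in at_right (0::real). e > 0" by (simp add: eventually_at_filter)
  then have ev: "\<forall>\<^sub>F e in at_right 0. F (Complex x e) = 0" for x
    by eventually_elim (use assms(3) in \<open>auto simp: upper_def\<close>)
  show "AE x in lborel. f (Some x) = 0"
    using lim by eventually_elim
      (metis tendsto_eventually[OF ev] tendsto_unique trivial_limit_at_right_real)
qed

text \<open>Uniqueness of the bounded extension: \<open>F\<close> is matched with the zero function below the line.\<close>

lemma zero_if_zero_boundary_values:
  assumes "F holomorphic_on upper" "\<And>z. z \<in> upper \<Longrightarrow> norm (F z) \<le> B"
    and lim: "AE x in lborel. ((\<lambda>e. F (Complex x e)) \<longlongrightarrow> 0) (at_right 0)" and z: "z \<in> upper"
  shows "F z = 0"
proof -
  obtain c where c: "\<And>z. z \<in> upper \<Longrightarrow> F z = c" "\<And>z. z \<in> lower \<Longrightarrow> (0::complex) = c"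
  proof (rule Liouville_across_line[of F "max B 0" "\<lambda>_. 0"])
    show "norm (F z) \<le> max B 0" if "z \<in> upper" for z using assms(2)[OF that] by simp
  qed (use assms(1) lim in auto)
  have "- \<i> \<in> lower" by (simp add: lower_def)
  then show ?thesis using c z by metis
qed

text \<open>The factor \<open>r\<close> records a prescribed zero at \<open>z0\<close>: the function \<open>f\<close> and its continuation
  \<open>r h\<close> into the lower half-plane are the same constant, and this constant vanishes at \<open>z0\<close>.\<close>

lemma H_inf_upper_lower:
  assumes "f \<in> H_inf upper" "h \<in> H_inf lower" "f \<in> C_hoelder \<mu>" "\<mu> > 0"
    and r: "r holomorphic_on lower" "\<And>z. z \<in> lower \<Longrightarrow> norm (r z) \<le> C" "\<And>x. isCont r (complex_of_real x)"
    and eq: "\<And>x. f (Some x) = r (complex_of_real x) * h (Some x)"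
    and z0: "r z0 = 0" "z0 \<in> lower"
  shows "f x = 0"
proof -
  obtain F B where F: "F holomorphic_on upper" "\<And>z. z \<in> upper \<Longrightarrow> norm (F z) \<le> B"
    "AE x in lborel. ((\<lambda>e. F (Complex x e)) \<longlongrightarrow> f (Some x)) (at_right 0)"
    by (rule H_inf_upper_vertical[OF assms(1)]) blast
  obtain H D where H: "H holomorphic_on lower" "\<And>z. z \<in> lower \<Longrightarrow> norm (H z) \<le> D"
    "AE x in lborel. ((\<lambda>e. H (Complex x (- e))) \<longlongrightarrow> h (Some x)) (at_right 0)"
    by (rule H_inf_lower_vertical[OF assms(2)]) blast
  have C0: "C \<ge> 0" using r(2)[OF z0(2)] norm_ge_zero order_trans by blast
  obtain c where c: "\<And>z. z \<in> upper \<Longrightarrow> F z = c" "\<And>z. z \<in> lower \<Longrightarrow> r z * H z = c"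
  proof (rule Liouville_across_line[of F "max B (C * D)" "\<lambda>z. r z * H z"])
    show "norm (r z * H z) \<le> max B (C * D)" if "z \<in> lower" for z
    proof -
      have "norm (r z * H z) \<le> C * D" unfolding norm_mult
        using r(2) H(2) C0 that by (intro mult_mono) auto
      then show ?thesis by simp
    qed
    show "norm (F z) \<le> max B (C * D)" if "z \<in> upper" for z using F(2)[OF that] by simp
    show "AE x in lborel. ((\<lambda>e. F (Complex x e) - r (Complex x (- e)) * H (Complex x (- e))) \<longlongrightarrow> 0) (at_right 0)"
      using F(3) H(3)
    proof eventually_elim
      case (elim x)
      have "((\<lambda>e. Complex x (- e)) \<longlongrightarrow> Complex x (- 0)) (at_right 0)" by (intro tendsto_intros tendsto_Complex)
      then have "((\<lambda>e. Complex x (- e)) \<longlongrightarrow> complex_of_real x) (at_right 0)" by (simp add: complex_of_real_def)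
      then have "((\<lambda>e. r (Complex x (- e))) \<longlongrightarrow> r (complex_of_real x)) (at_right 0)"
        by (rule isCont_tendsto_compose[OF r(3)])
      then have "((\<lambda>e. F (Complex x e) - r (Complex x (- e)) * H (Complex x (- e)))
          \<longlongrightarrow> f (Some x) - r (complex_of_real x) * h (Some x)) (at_right 0)"
        using elim by (intro tendsto_intros)
      then show ?case using eq by simp
    qed
  qed (use F H r in \<open>auto intro!: holomorphic_intros\<close>)
  have "c = 0" using c(2)[OF z0(2)] z0(1) by simp
  then show ?thesis using hoelder_zero_if_extension_zero[OF assms(3,4) _ F(3)] c(1) by blast
qed

section \<open>Kernel estimates on the circle\<close>

text \<open>A crude form of Jordan's inequality: the mean value theorem below \<open>\<pi>/3\<close>, monotonicity above.\<close>

lemma half_le_sin: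
  assumes "0 \<le> x" "x \<le> pi / 2"
  shows "x / 2 \<le> sin x"
proof (cases "x \<le> pi / 3")
  case True
  show ?thesis
  proof (cases "x = 0")
    case False
    then have "0 < x" using assms by simp
    then obtain z where z: "0 < z" "z < x" "sin x - sin 0 = (x - 0) * cos z"
      using MVT2[of 0 x sin cos] by (auto intro: DERIV_sin)
    have "cos (pi / 3) \<le> cos z" using z True by (intro cos_monotone_0_pi_le) auto
    then have "1 / 2 \<le> cos z" by (simp add: cos_60)
    then show ?thesis using z \<open>0 < x\<close> mult_left_mono[of "1/2" "cos z" x] by simp
  qed simp
next
  case False
  then have "sin (pi / 3) \<le> sin x" using assms by (intro sin_monotone_2pi_le) auto
  moreover have "pi / 4 \<le> sqrt 3 / 2"
  proof -
    have "(17/10)^2 \<le> (3::real)" by (simp add: power2_eq_square)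
    then have "17/10 \<le> sqrt 3" by (rule real_le_rsqrt)
    then show ?thesis using pi_approx by simp
  qed
  ultimately show ?thesis using assms by (simp add: sin_60)
qed

lemma norm_cis_minus_1: "norm (cis s - 1) = 2 * \<bar>sin (s / 2)\<bar>"
proof -
  have "(norm (cis s - 1))\<^sup>2 = (2 * \<bar>sin (s / 2)\<bar>)\<^sup>2"
  proof -
    have "(norm (cis s - 1))\<^sup>2 = (cos s - 1)\<^sup>2 + (sin s)\<^sup>2" by (simp add: cmod_power2)
    also have "\<dots> = 2 - 2 * cos s"
      using sin_cos_squared_add[of s] by (simp add: power2_eq_square algebra_simps)
    also have "\<dots> = 4 * (sin (s / 2))\<^sup>2" using cos_double_sin[of "s / 2"] by simp
    finally show ?thesis by (simp add: power_mult_distrib)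
  qed
  then show ?thesis by (rule power2_eq_imp_eq) auto
qed

text \<open>The distance of a point of the circle to \<open>\<rho>\<close> dominates both the distance \<open>1 - \<rho>\<close> of \<open>\<rho>\<close> to the
  circle and, up to a constant, the arc length.\<close>

lemma chord_lower_bound:
  assumes "0 \<le> \<rho>" "\<rho> < 1" "\<bar>s\<bar> \<le> pi"
  shows "((1 - \<rho>) + \<bar>s\<bar>) / 6 \<le> norm (cis s - complex_of_real \<rho>)"
proof -
  have "\<bar>s\<bar> / 2 \<le> norm (cis s - 1)"
  proof -
    have "\<bar>s\<bar> / 2 / 2 \<le> sin (\<bar>s\<bar> / 2)" using assms by (intro half_le_sin) auto
    also have "sin (\<bar>s\<bar> / 2) \<le> \<bar>sin (s / 2)\<bar>" by (cases "s \<ge> 0") auto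
    finally show ?thesis by (simp add: norm_cis_minus_1)
  qed
  moreover have "norm (cis s - 1) \<le> norm (cis s - complex_of_real \<rho>) + (1 - \<rho>)"
  proof -
    have "norm (complex_of_real \<rho> - 1) = 1 - \<rho>"
      using norm_of_real[of "\<rho> - 1", where 'a = complex] assms by simp
    then show ?thesis
      using norm_triangle_ineq[of "cis s - complex_of_real \<rho>" "complex_of_real \<rho> - 1"] by simp
  qed
  moreover have "1 - \<rho> \<le> norm (cis s - complex_of_real \<rho>)"
    using norm_triangle_ineq2[of "cis s" "complex_of_real \<rho>"] assms by simp
  ultimately show ?thesis using assms(2)
    by (simp add: divide_simps)
qed

text \<open>The arc between two angles in \<open>[0, 2\<pi>]\<close> is measured after a shift by \<open>0\<close> or \<open>\<plusminus>2\<pi>\<close>.  Adding up the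
  three bounds replaces the case distinction and can be integrated directly.\<close>

lemma chord_powr_bound:
  assumes "0 \<le> \<rho>" "\<rho> < 1" "\<theta> \<in> {0..2 * pi}" "t \<in> {0..2 * pi}" "\<mu> < 2"
  shows "norm (cis t - complex_of_real \<rho> * cis \<theta>) powr (\<mu> - 2) \<le>
    6 powr (2 - \<mu>) * ((1 - \<rho> + \<bar>t - \<theta>\<bar>) powr (\<mu> - 2) +
      (1 - \<rho> + \<bar>t - (\<theta> - 2 * pi)\<bar>) powr (\<mu> - 2) + (1 - \<rho> + \<bar>t - (\<theta> + 2 * pi)\<bar>) powr (\<mu> - 2))"
proof -
  have rot: "norm (cis t - complex_of_real \<rho> * cis \<theta>) = norm (cis (t - a) - complex_of_real \<rho>)"
    if "cis a = cis \<theta>" for a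
  proof -
    have "cis t - complex_of_real \<rho> * cis \<theta> = cis a * (cis (t - a) - complex_of_real \<rho>)"
      by (simp add: right_diff_distrib cis_mult that[symmetric])
    then show ?thesis by (simp add: norm_mult)
  qed
  have one: "norm (cis t - complex_of_real \<rho> * cis \<theta>) powr (\<mu> - 2) \<le>
      6 powr (2 - \<mu>) * (1 - \<rho> + \<bar>t - a\<bar>) powr (\<mu> - 2)"
    if "cis a = cis \<theta>" "\<bar>t - a\<bar> \<le> pi" for a
  proof -
    let ?u = "1 - \<rho> + \<bar>t - a\<bar>"
    have "norm (cis t - complex_of_real \<rho> * cis \<theta>) powr (\<mu> - 2) \<le> (?u / 6) powr (\<mu> - 2)"
      unfolding rot[OF that(1)]
      using chord_lower_bound[OF assms(1,2) that(2)] assms by (intro powr_mono2') auto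
    also have "\<dots> = 6 powr (2 - \<mu>) * ?u powr (\<mu> - 2)"
      using assms powr_minus[of 6 "2 - \<mu>"] by (simp add: powr_divide field_simps)
    finally show ?thesis .
  qed
  have c2: "cis (\<theta> - 2 * pi) = cis \<theta>" "cis (\<theta> + 2 * pi) = cis \<theta>"
    by (simp_all add: complex_eq_iff sin_diff cos_diff)
  consider "\<bar>t - \<theta>\<bar> \<le> pi" | "\<bar>t - (\<theta> - 2 * pi)\<bar> \<le> pi" | "\<bar>t - (\<theta> + 2 * pi)\<bar> \<le> pi"
  proof -
    have "\<bar>t - \<theta>\<bar> \<le> pi \<or> \<bar>t - (\<theta> - 2 * pi)\<bar> \<le> pi \<or> \<bar>t - (\<theta> + 2 * pi)\<bar> \<le> pi"
      using assms(3,4) unfolding atLeastAtMost_iff by linarith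
    then show ?thesis using that by blast
  qed
  then obtain a where a: "cis a = cis \<theta>" "\<bar>t - a\<bar> \<le> pi" "a \<in> {\<theta>, \<theta> - 2 * pi, \<theta> + 2 * pi}"
    using c2 by cases auto
  have "(1 - \<rho> + \<bar>t - a\<bar>) powr (\<mu> - 2) \<le> (1 - \<rho> + \<bar>t - \<theta>\<bar>) powr (\<mu> - 2) +
      (1 - \<rho> + \<bar>t - (\<theta> - 2 * pi)\<bar>) powr (\<mu> - 2) + (1 - \<rho> + \<bar>t - (\<theta> + 2 * pi)\<bar>) powr (\<mu> - 2)"
    using a(3) by (elim insertE emptyE) simp_all
  then show ?thesis
    using one[OF a(1,2)] by (meson mult_left_mono order_trans powr_ge_zero)
qed

lemma powr_ray_integral:
  fixes p q a :: real
  assumes "0 < \<delta>" "0 < \<mu>" "\<mu> < 1" "p \<le> q" "a \<le> p \<or> q \<le> a"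
  shows "integral {p..q} (\<lambda>t. (\<delta> + \<bar>t - a\<bar>) powr (\<mu> - 2)) \<le> \<delta> powr (\<mu> - 1) / (1 - \<mu>)"
proof (cases "a \<le> p")
  case True
  have "((\<lambda>t. (\<delta> + \<bar>t - a\<bar>) powr (\<mu> - 2)) has_integral
      (- ((\<delta> + q - a) powr (\<mu> - 1) / (1 - \<mu>)) - - ((\<delta> + p - a) powr (\<mu> - 1) / (1 - \<mu>)))) {p..q}"
  proof (rule fundamental_theorem_of_calculus[OF assms(4)])
    fix t assume t: "t \<in> {p..q}"
    have "((\<lambda>t. - ((\<delta> + t - a) powr (\<mu> - 1) / (1 - \<mu>))) has_real_derivative
        - (((\<mu> - 1) * (\<delta> + t - a) powr (\<mu> - 1 - 1)) / (1 - \<mu>))) (at t within {p..q})"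
      using t True assms by (auto intro!: derivative_eq_intros)
    moreover have "- (((\<mu> - 1) * (\<delta> + t - a) powr (\<mu> - 1 - 1)) / (1 - \<mu>)) = (\<delta> + \<bar>t - a\<bar>) powr (\<mu> - 2)"
      using t True assms by (simp add: field_simps)
    ultimately show "((\<lambda>t. - ((\<delta> + t - a) powr (\<mu> - 1) / (1 - \<mu>))) has_vector_derivative
        (\<delta> + \<bar>t - a\<bar>) powr (\<mu> - 2)) (at t within {p..q})"
      by (simp add: has_real_derivative_iff_has_vector_derivative)
  qed
  then have "integral {p..q} (\<lambda>t. (\<delta> + \<bar>t - a\<bar>) powr (\<mu> - 2)) =
      (\<delta> + p - a) powr (\<mu> - 1) / (1 - \<mu>) - (\<delta> + q - a) powr (\<mu> - 1) / (1 - \<mu>)"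
    by (simp add: integral_unique)
  also have "\<dots> \<le> (\<delta> + p - a) powr (\<mu> - 1) / (1 - \<mu>)" using assms by simp
  also have "\<dots> \<le> \<delta> powr (\<mu> - 1) / (1 - \<mu>)"
    using assms True by (intro divide_right_mono powr_mono2') auto
  finally show ?thesis .
next
  case False
  then have qa: "q \<le> a" using assms by auto
  have "((\<lambda>t. (\<delta> + \<bar>t - a\<bar>) powr (\<mu> - 2)) has_integral
      ((\<delta> + a - q) powr (\<mu> - 1) / (1 - \<mu>) - (\<delta> + a - p) powr (\<mu> - 1) / (1 - \<mu>))) {p..q}"
  proof (rule fundamental_theorem_of_calculus[OF assms(4)])
    fix t assume t: "t \<in> {p..q}"
    have "((\<lambda>t. (\<delta> + a - t) powr (\<mu> - 1) / (1 - \<mu>)) has_real_derivative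
        (((\<mu> - 1) * (\<delta> + a - t) powr (\<mu> - 1 - 1) * (- 1)) / (1 - \<mu>))) (at t within {p..q})"
      using t qa assms by (auto intro!: derivative_eq_intros)
    moreover have "((\<mu> - 1) * (\<delta> + a - t) powr (\<mu> - 1 - 1) * (- 1)) / (1 - \<mu>) = (\<delta> + \<bar>t - a\<bar>) powr (\<mu> - 2)"
      using t qa assms by (simp add: field_simps)
    ultimately show "((\<lambda>t. (\<delta> + a - t) powr (\<mu> - 1) / (1 - \<mu>)) has_vector_derivative
        (\<delta> + \<bar>t - a\<bar>) powr (\<mu> - 2)) (at t within {p..q})"
      by (simp add: has_real_derivative_iff_has_vector_derivative)
  qed
  then have "integral {p..q} (\<lambda>t. (\<delta> + \<bar>t - a\<bar>) powr (\<mu> - 2)) =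
      (\<delta> + a - q) powr (\<mu> - 1) / (1 - \<mu>) - (\<delta> + a - p) powr (\<mu> - 1) / (1 - \<mu>)"
    by (simp add: integral_unique)
  also have "\<dots> \<le> (\<delta> + a - q) powr (\<mu> - 1) / (1 - \<mu>)" using assms by simp
  also have "\<dots> \<le> \<delta> powr (\<mu> - 1) / (1 - \<mu>)"
    using assms qa by (intro divide_right_mono powr_mono2') auto
  finally show ?thesis .
qed

lemma powr_line_integral:
  fixes p q a :: real
  assumes "0 < \<delta>" "0 < \<mu>" "\<mu> < 1" "p \<le> q"
  shows "integral {p..q} (\<lambda>t. (\<delta> + \<bar>t - a\<bar>) powr (\<mu> - 2)) \<le> 2 * \<delta> powr (\<mu> - 1) / (1 - \<mu>)"
proof (cases "a \<le> p \<or> q \<le> a")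
  case True
  have "0 \<le> \<delta> powr (\<mu> - 1) / (1 - \<mu>)" using assms by simp
  then show ?thesis using powr_ray_integral[OF assms True] by linarith
next
  case False
  let ?f = "\<lambda>t. (\<delta> + \<bar>t - a\<bar>) powr (\<mu> - 2)"
  have "?f integrable_on {p..q}"
    using assms by (intro integrable_continuous_real continuous_intros) auto
  then have "integral {p..q} ?f = integral {p..a} ?f + integral {a..q} ?f"
    using False Henstock_Kurzweil_Integration.integral_combine[of p a q ?f] by simp
  then show ?thesis
    using powr_ray_integral[OF assms(1-3), of p a a] powr_ray_integral[OF assms(1-3), of a q a] False by simp
qed

text \<open>Three shifted integrals, each at most \<open>2 \<delta>\<^sup>\<mu>\<^sup>-\<^sup>1 / (1 - \<mu>)\<close>, and the constant of the chord bound.\<close>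

definition kernel_const :: "real \<Rightarrow> real" where
  "kernel_const \<mu> = 6 powr (2 - \<mu>) * (6 / (1 - \<mu>))"

text \<open>Both the derivative of a Cauchy integral and the deviation of a Poisson integral from its boundary
  value are integrals of a kernel of order \<open>-2\<close> against an increment of order \<open>\<mu>\<close>; this is the
  estimate that they share.\<close>

lemma kernel_integral_bound:
  fixes h :: "real \<Rightarrow> complex"
  assumes "0 < \<mu>" "\<mu> < 1" "norm w < 1" "C \<ge> 0"
    and h: "h integrable_on {0..2 * pi}"
      "\<And>t. t \<in> {0..2 * pi} \<Longrightarrow> norm (h t) \<le> C * norm (cis t - w) powr (\<mu> - 2)"
  shows "norm (integral {0..2 * pi} h) \<le> C * kernel_const \<mu> * (1 - norm w) powr (\<mu> - 1)"
proof -
  define \<theta> where "\<theta> = Arg2pi w"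
  have w: "w = complex_of_real (norm w) * cis \<theta>"
    using Arg2pi_eq[of w] by (simp add: \<theta>_def cis_conv_exp)
  have \<theta>: "\<theta> \<in> {0..2 * pi}" unfolding \<theta>_def using Arg2pi_ge_0[of w] Arg2pi_lt_2pi[of w] by simp
  define \<delta> where "\<delta> = 1 - norm w"
  have \<delta>: "\<delta> > 0" using assms by (simp add: \<delta>_def)
  define g where "g a t = (\<delta> + \<bar>t - a\<bar>) powr (\<mu> - 2)" for a t
  have gint: "g a integrable_on {0..2 * pi}" for a
    unfolding g_def using \<delta> by (intro integrable_continuous_real continuous_intros) auto
  define G where "G t = C * (6 powr (2 - \<mu>) * (g \<theta> t + g (\<theta> - 2 * pi) t + g (\<theta> + 2 * pi) t))" for t
  have "norm (integral {0..2 * pi} h) \<le> integral {0..2 * pi} G"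
  proof (rule Henstock_Kurzweil_Integration.integral_norm_bound_integral[OF h(1)])
    show "G integrable_on {0..2 * pi}" unfolding G_def
      by (intro integrable_on_mult_right integrable_add gint)
    fix t assume t: "t \<in> {0..2 * pi}"
    have "norm (cis t - w) powr (\<mu> - 2) \<le> 6 powr (2 - \<mu>) * (g \<theta> t + g (\<theta> - 2 * pi) t + g (\<theta> + 2 * pi) t)"
      using chord_powr_bound[of "norm w" \<theta> t \<mu>] \<theta> t assms unfolding g_def \<delta>_def w[symmetric] by simp
    then show "norm (h t) \<le> G t" unfolding G_def
      using h(2)[OF t] assms(4) by (meson mult_left_mono order_trans)
  qed
  also have "integral {0..2 * pi} G = C * (6 powr (2 - \<mu>) *
      (integral {0..2 * pi} (g \<theta>) + integral {0..2 * pi} (g (\<theta> - 2 * pi)) + integral {0..2 * pi} (g (\<theta> + 2 * pi))))"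
    unfolding G_def by (simp add: integral_mult_right Henstock_Kurzweil_Integration.integral_add integrable_add gint)
  also have "\<dots> \<le> C * (6 powr (2 - \<mu>) * (2 * \<delta> powr (\<mu> - 1) / (1 - \<mu>) + 2 * \<delta> powr (\<mu> - 1) / (1 - \<mu>) + 2 * \<delta> powr (\<mu> - 1) / (1 - \<mu>)))"
    unfolding g_def by (intro mult_left_mono add_mono powr_line_integral assms \<delta>) auto
  also have "\<dots> = C * kernel_const \<mu> * \<delta> powr (\<mu> - 1)" by (simp add: kernel_const_def)
  finally show ?thesis unfolding \<delta>_def .
qed

section \<open>Hoelder continuity up to the boundary\<close>

text \<open>Points at distance \<open>h\<close> are compared after both are pulled inside by the factor \<open>1 - h\<close>.  The radial
  moves cost \<open>\<integral> C (1 - t)\<^sup>\<mu>\<^sup>-\<^sup>1 dt = C h\<^sup>\<mu> / \<mu>\<close>, and on the smaller disc the derivative is at most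
  \<open>C h\<^sup>\<mu>\<^sup>-\<^sup>1\<close>.  Distances above 1 are handled through the origin.\<close>

lemma Hardy_Littlewood_hoelder:
  assumes "0 < \<mu>" "\<mu> < 1" and holo: "\<Phi> holomorphic_on ball 0 1"
    and C: "\<And>z. norm z < 1 \<Longrightarrow> norm (deriv \<Phi> z) \<le> C * (1 - norm z) powr (\<mu> - 1)"
  obtains L where "L \<ge> 0" "\<And>z w. norm z < 1 \<Longrightarrow> norm w < 1 \<Longrightarrow> norm (\<Phi> z - \<Phi> w) \<le> L * dist z w powr \<mu>"
proof -
  have C0: "C \<ge> 0" using order_trans[OF norm_ge_zero C[of 0]] by simp
  have der: "(\<Phi> has_field_derivative deriv \<Phi> z) (at z)" if "norm z < 1" for z
    using holomorphic_derivI[OF holo open_ball] that by simp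
  have radial: "norm (\<Phi> z - \<Phi> (complex_of_real (1 - h) * z)) \<le> C / \<mu> * h powr \<mu>"
    if z: "norm z < 1" and h: "0 < h" "h \<le> 1" for z h
  proof -
    have "norm (\<Phi> (complex_of_real 1 * z) - \<Phi> (complex_of_real (1 - h) * z)) \<le>
        (- (C / \<mu> * (1 - 1) powr \<mu>)) - (- (C / \<mu> * (1 - (1 - h)) powr \<mu>))"
    proof (rule differentiable_bound_general[where f' = "\<lambda>t. z * deriv \<Phi> (complex_of_real t * z)"
          and \<phi>' = "\<lambda>t. C * (1 - t) powr (\<mu> - 1)" and f = "\<lambda>t. \<Phi> (complex_of_real t * z)" and \<phi> = "\<lambda>t. - (C / \<mu> * (1 - t) powr \<mu>)"])
      have in_disc: "norm (complex_of_real t * z) < 1" if "0 \<le> t" "t \<le> 1" for t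
        using that z by (simp add: norm_mult) (meson le_less_trans mult_left_le_one_le norm_ge_zero)
      show "1 - h < 1" using h by simp
      show "continuous_on {1 - h..1} (\<lambda>t. \<Phi> (complex_of_real t * z))"
        by (rule continuous_on_compose2[OF holomorphic_on_imp_continuous_on[OF holo]])
          (use in_disc h in \<open>auto intro!: continuous_intros\<close>)
      show "continuous_on {1 - h..1} (\<lambda>t. - (C / \<mu> * (1 - t) powr \<mu>))"
        using assms(1) by (intro continuous_intros continuous_on_powr') auto
      fix t assume t: "1 - h < t" "t < 1"
      then have t': "0 \<le> t" "t \<le> 1" using h by auto
      have "((\<lambda>t. complex_of_real t * z) has_vector_derivative z) (at t)"
        by (auto intro!: derivative_eq_intros simp: scaleR_conv_of_real)
      from field_vector_diff_chain_at[OF this der[OF in_disc[OF t']]]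
      show "((\<lambda>t. \<Phi> (complex_of_real t * z)) has_vector_derivative z * deriv \<Phi> (complex_of_real t * z)) (at t)"
        by (simp add: o_def)
      have "((\<lambda>t. - (C / \<mu> * (1 - t) powr \<mu>)) has_real_derivative C * (1 - t) powr (\<mu> - 1)) (at t)"
        using t assms(1) by (auto intro!: derivative_eq_intros)
      then show "((\<lambda>t. - (C / \<mu> * (1 - t) powr \<mu>)) has_vector_derivative C * (1 - t) powr (\<mu> - 1)) (at t)"
        by (simp add: has_real_derivative_iff_has_vector_derivative)
      have "norm (z * deriv \<Phi> (complex_of_real t * z)) \<le> 1 * (C * (1 - norm (complex_of_real t * z)) powr (\<mu> - 1))"
        unfolding norm_mult[of z] using z C[OF in_disc[OF t']] by (intro mult_mono) auto
      also have "\<dots> \<le> C * (1 - t) powr (\<mu> - 1)"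
        using C0 t t' z assms by (auto intro!: mult_left_mono powr_mono2' simp: norm_mult mult_left_le)
      finally show "norm (z * deriv \<Phi> (complex_of_real t * z)) \<le> C * (1 - t) powr (\<mu> - 1)" .
    qed
    then show ?thesis using assms(1) by simp
  qed
  \<comment> \<open>two radial moves and one move inside the smaller disc\<close>
  define L where "L = 2 * (C / \<mu>) + C"
  have "norm (\<Phi> z - \<Phi> w) \<le> L * dist z w powr \<mu>" if z: "norm z < 1" and w: "norm w < 1" for z w
  proof -
    consider "z = w" | "0 < dist z w" "dist z w < 1" | "1 \<le> dist z w" by fastforce
    then show ?thesis
    proof cases
      case 2
      define h where "h = dist z w"
      have h: "0 < h" "h < 1" using 2 by (auto simp: h_def)
      let ?z = "complex_of_real (1 - h) * z" and ?w = "complex_of_real (1 - h) * w"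
      have sm: "norm ?z \<le> 1 - h" "norm ?w \<le> 1 - h"
        using h z w by (auto simp del: of_real_diff simp: norm_mult intro!: mult_left_le)
      have "norm (\<Phi> ?z - \<Phi> ?w) \<le> (C * h powr (\<mu> - 1)) * norm (?z - ?w)"
      proof (rule field_differentiable_bound[of "cball 0 (1 - h)" \<Phi> "deriv \<Phi>"])
        show "(\<Phi> has_field_derivative deriv \<Phi> u) (at u within cball 0 (1 - h))" if "u \<in> cball 0 (1 - h)" for u
          using der[of u] that h by (auto intro: has_field_derivative_at_within)
        show "norm (deriv \<Phi> u) \<le> C * h powr (\<mu> - 1)" if "u \<in> cball 0 (1 - h)" for u
        proof -
          have "norm (deriv \<Phi> u) \<le> C * (1 - norm u) powr (\<mu> - 1)" using that h by (intro C) auto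
          also have "\<dots> \<le> C * h powr (\<mu> - 1)"
            using that h C0 assms by (intro mult_left_mono powr_mono2') auto
          finally show ?thesis .
        qed
      qed (use sm in auto)
      also have "\<dots> \<le> (C * h powr (\<mu> - 1)) * h"
      proof -
        have "?z - ?w = complex_of_real (1 - h) * (z - w)" by (simp only: right_diff_distrib)
        then have "norm (?z - ?w) = (1 - h) * h" using h
          by (simp del: of_real_diff add: norm_mult h_def[unfolded dist_norm])
        also have "\<dots> \<le> h" using h by (simp add: algebra_simps)
        finally show ?thesis using C0 by (intro mult_left_mono) auto
      qed
      also have "\<dots> = C * h powr \<mu>" using h by (simp add: powr_diff)
      finally have "norm (\<Phi> ?z - \<Phi> ?w) \<le> C * h powr \<mu>" .
      moreover have "norm (\<Phi> z - \<Phi> ?z) \<le> C / \<mu> * h powr \<mu>" "norm (\<Phi> w - \<Phi> ?w) \<le> C / \<mu> * h powr \<mu>"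
        using radial z w h by auto
      moreover have "norm (\<Phi> z - \<Phi> w) \<le> norm (\<Phi> z - \<Phi> ?z) + norm (\<Phi> ?z - \<Phi> ?w) + norm (\<Phi> w - \<Phi> ?w)"
      proof -
        have eq: "\<Phi> z - \<Phi> w = (\<Phi> z - \<Phi> ?z) + (\<Phi> ?z - \<Phi> ?w) - (\<Phi> w - \<Phi> ?w)" by simp
        show ?thesis unfolding eq
          by (rule order_trans[OF norm_triangle_ineq4 add_right_mono[OF norm_triangle_ineq]])
      qed
      ultimately have "norm (\<Phi> z - \<Phi> w) \<le> 2 * (C / \<mu> * h powr \<mu>) + C * h powr \<mu>" by linarith
      then show ?thesis unfolding L_def h_def[symmetric] by (simp add: distrib_right)
    next
      case 3
      have "norm (\<Phi> z - \<Phi> 0) \<le> C / \<mu>" "norm (\<Phi> w - \<Phi> 0) \<le> C / \<mu>"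
        using radial[OF z, of 1] radial[OF w, of 1] by auto
      moreover have "norm (\<Phi> z - \<Phi> w) \<le> norm (\<Phi> z - \<Phi> 0) + norm (\<Phi> w - \<Phi> 0)"
        using norm_triangle_ineq4[of "\<Phi> z - \<Phi> 0" "\<Phi> w - \<Phi> 0"] by simp
      ultimately have "norm (\<Phi> z - \<Phi> w) \<le> L" unfolding L_def using C0 by simp
      also have "L \<le> L * dist z w powr \<mu>"
      proof -
        have "1 \<le> dist z w powr \<mu>" using 3 assms by (simp add: ge_one_powr_ge_zero)
        moreover have "0 \<le> L" using C0 assms by (simp add: L_def)
        ultimately show ?thesis using mult_left_mono[of 1 "dist z w powr \<mu>" L] by simp
      qed
      finally show ?thesis .
    qed simp
  qed
  moreover have "L \<ge> 0" using C0 assms by (simp add: L_def)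
  ultimately show ?thesis using that by blast
qed

lemma hoelder_disc_extension:
  assumes "0 < \<mu>" and holo: "\<Phi> holomorphic_on ball 0 1" and L: "L \<ge> 0"
    "\<And>z w. norm z < 1 \<Longrightarrow> norm w < 1 \<Longrightarrow> norm (\<Phi> z - \<Phi> w) \<le> L * dist z w powr \<mu>"
  obtains E where "E \<in> disc_algebra" "\<And>z. norm z < 1 \<Longrightarrow> E z = \<Phi> z"
    "(\<lambda>x. E (lam_ratio x)) \<in> C_hoelder \<mu>" "(\<lambda>x. E (inverse (lam_ratio x))) \<in> C_hoelder \<mu>"
proof -
  have "uniformly_continuous_on (ball 0 1) \<Phi>"
    unfolding uniformly_continuous_on_def
  proof (intro allI impI)
    fix e :: real assume e: "e > 0"
    \<comment> \<open>\<open>L + 1\<close> instead of \<open>L\<close> avoids a division by zero\<close>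
    define d where "d = (e / (L + 1)) powr (1 / \<mu>)"
    have "d > 0" using e L by (simp add: d_def)
    moreover have "dist (\<Phi> z') (\<Phi> z) < e" if "z \<in> ball 0 1" "z' \<in> ball 0 1" "dist z' z < d" for z z'
    proof -
      have "dist z' z powr \<mu> \<le> d powr \<mu>" using that assms by (intro powr_mono2) auto
      also have "d powr \<mu> = e / (L + 1)" using e L assms by (simp add: d_def powr_powr)
      finally have "L * dist z' z powr \<mu> \<le> L * (e / (L + 1))" using L by (intro mult_left_mono)
      also have "\<dots> < e" using e L by (simp add: field_simps)
      finally show ?thesis using L(2)[of z' z] that by (simp add: dist_norm)
    qed
    ultimately show "\<exists>d>0. \<forall>x\<in>ball 0 1. \<forall>x'\<in>ball 0 1. dist x' x < d \<longrightarrow> dist (\<Phi> x') (\<Phi> x) < e" by blast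
  qed
  then obtain E where E: "uniformly_continuous_on (closure (ball 0 1)) E" "\<And>x. x \<in> ball 0 1 \<Longrightarrow> \<Phi> x = E x"
    by (rule uniformly_continuous_on_extension_on_closure) blast
  have contE: "continuous_on (cball 0 1) E"
    using uniformly_continuous_imp_continuous[OF E(1)] by simp
  have hE: "norm (E z - E w) \<le> L * dist z w powr \<mu>" if z: "norm z \<le> 1" "norm w \<le> 1" for z w
  proof (rule tendsto_le[of "at_left (1::real)"])
    have f1: "((\<lambda>r. complex_of_real r * u) \<longlongrightarrow> u) (at_left 1)" for u
      by (auto intro!: tendsto_eq_intros)
    have ev: "\<forall>\<^sub>F r in at_left (1::real). 0 < r \<and> r < 1"
      by (rule eventually_mono[OF eventually_at_left_real[of 0 1]]) auto
    have f2: "((\<lambda>r. E (complex_of_real r * u)) \<longlongrightarrow> E u) (at_left 1)" if "norm u \<le> 1" for u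
    proof (rule continuous_on_tendsto_compose[OF contE f1])
      show "\<forall>\<^sub>F r in at_left 1. complex_of_real r * u \<in> cball 0 1"
        using ev by eventually_elim (use that in \<open>auto simp: norm_mult intro: mult_le_one\<close>)
    qed (use that in auto)
    show "((\<lambda>r. norm (E (complex_of_real r * z) - E (complex_of_real r * w))) \<longlongrightarrow> norm (E z - E w)) (at_left 1)"
      by (intro tendsto_intros f2 z)
    show "((\<lambda>r. L * dist (complex_of_real r * z) (complex_of_real r * w) powr \<mu>) \<longlongrightarrow> L * dist z w powr \<mu>) (at_left 1)"
      using assms(1) by (intro tendsto_intros tendsto_powr' f1) auto
    show "\<forall>\<^sub>F r in at_left 1. norm (E (complex_of_real r * z) - E (complex_of_real r * w)) \<le> L * dist (complex_of_real r * z) (complex_of_real r * w) powr \<mu>"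
      using ev
    proof eventually_elim
      case (elim r)
      have n: "norm (complex_of_real r * u) < 1" if "norm u \<le> 1" for u
        using elim that by (simp add: norm_mult) (meson le_less_trans mult_left_le less_imp_le)
      show ?case using L(2)[OF n[OF z(1)] n[OF z(2)]] E(2) n[OF z(1)] n[OF z(2)] by simp
    qed
  qed simp
  show ?thesis
  proof (rule that[of E])
    have "E holomorphic_on ball 0 1"
      using holo by (rule holomorphic_transform) (use E in auto)
    then show "E \<in> disc_algebra" using contE by (simp add: disc_algebra_def)
    show "(\<lambda>x. E (lam_ratio x)) \<in> C_hoelder \<mu>"
      by (rule hoelderI[of _ L]) (use hE in auto)
    show "(\<lambda>x. E (inverse (lam_ratio x))) \<in> C_hoelder \<mu>"
    proof (rule hoelderI[of _ L])
      fix x y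
      have "dist (inverse (lam_ratio x)) (inverse (lam_ratio y)) = dist (lam_ratio x) (lam_ratio y)"
        by (simp add: dist_norm inverse_diff_inverse norm_mult norm_inverse norm_minus_commute)
      then show "norm (E (inverse (lam_ratio x)) - E (inverse (lam_ratio y))) \<le> L * dist (lam_ratio x) (lam_ratio y) powr \<mu>"
        using hE[of "inverse (lam_ratio x)" "inverse (lam_ratio y)"] by (simp add: norm_inverse)
    qed
  qed (use E in auto)
qed

section \<open>Cauchy integrals and Privalov's theorem\<close>

text \<open>With \<open>t = cis \<theta>\<close> this is the Cauchy integral \<open>1/(2\<pi>i) \<integral> f(t) / (t - w) dt\<close>, where
  \<open>dt / (t - w) = i d\<theta> / (1 - w / t)\<close>.\<close>

definition cauchy_int :: "(rdot \<Rightarrow> complex) \<Rightarrow> complex \<Rightarrow> complex" where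
  "cauchy_int f w = integral {0..2 * pi} (\<lambda>t. f (circle_pt (cis t)) / (1 - w * cis (- t))) / (2 * pi)"

lemma circle_kernel_nonzero:
  assumes "norm w < 1" shows "1 - w * cis (- t) \<noteq> 0"
proof
  assume "1 - w * cis (- t) = 0"
  then have "norm (w * cis (- t)) = 1" by (metis eq_iff_diff_eq_0 norm_one)
  then show False using assms by (simp add: norm_mult)
qed

lemma norm_circle_kernel: "norm (1 - w * cis (- t)) = norm (cis t - w)"
proof -
  have "cis t - w = cis t * (1 - w * cis (- t))" by (simp add: algebra_simps cis_mult)
  then show ?thesis by (simp add: norm_mult)
qed

lemma continuous_circle_trace:
  assumes "f \<in> C_hoelder \<mu>" "\<mu> > 0"
  shows "continuous_on S (\<lambda>t. f (circle_pt (cis t)))"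
  by (rule continuous_on_compose2[OF hoelder_continuous[OF assms]]) (auto intro!: continuous_intros)

lemma cauchy_int_entire:
  assumes "\<Phi> holomorphic_on UNIV" "norm w < 1"
  shows "cauchy_int (\<lambda>x. \<Phi> (lam_ratio x)) w = \<Phi> w"
proof -
  have "((\<lambda>u. \<Phi> u / (u - w)) has_contour_integral (2 * of_real pi * \<i> * \<Phi> w)) (circlepath 0 1)"
    by (rule Cauchy_integral_circlepath_simple) (use assms in \<open>auto intro: holomorphic_on_subset\<close>)
  then have "((\<lambda>t. \<Phi> (cis t) / (cis t - w) * (\<i> * cis t)) has_integral (2 * of_real pi * \<i> * \<Phi> w)) {0..2 * pi}"
    unfolding circlepath_def by (subst (asm) has_contour_integral_part_circlepath_iff) (auto simp: mult_ac)
  then have "((\<lambda>t. inverse \<i> * (\<Phi> (cis t) / (cis t - w) * (\<i> * cis t))) has_integral inverse \<i> * (2 * of_real pi * \<i> * \<Phi> w)) {0..2 * pi}"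
    by (rule has_integral_mult_right)
  moreover have "inverse \<i> * (2 * of_real pi * \<i> * \<Phi> w) = 2 * of_real pi * \<Phi> w" by simp
  moreover have "inverse \<i> * (c / (cis t - w) * (\<i> * cis t)) = c / (1 - w * cis (- t))" for c t
  proof -
    have "cis t - w = cis t * (1 - w * cis (- t))" by (simp add: algebra_simps cis_mult)
    moreover have "inverse \<i> * (c / (u * D) * (\<i> * u)) = c / D" if "u \<noteq> 0" for u D
    proof -
      have "inverse \<i> * (c / (u * D) * (\<i> * u)) = (inverse \<i> * \<i>) * (c * (u * inverse u) * inverse D)"
        by (simp only: divide_inverse inverse_mult_distrib mult_ac)
      then show ?thesis using that by (simp add: divide_inverse)
    qed
    ultimately show ?thesis by (simp only: cis_neq_zero not_False_eq_True)
  qed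
  ultimately have "((\<lambda>t. \<Phi> (cis t) / (1 - w * cis (- t))) has_integral (2 * of_real pi * \<Phi> w)) {0..2 * pi}"
    by (simp only:)
  then show ?thesis unfolding cauchy_int_def by (simp add: integral_unique)
qed

lemma cauchy_int_const:
  assumes "norm w < 1"
  shows "cauchy_int (\<lambda>_. c) w = c"
  using cauchy_int_entire[of "\<lambda>_. c"] assms by simp

lemma cauchy_int_integrable:
  assumes "f \<in> C_hoelder \<mu>" "\<mu> > 0" "norm w < 1"
  shows "(\<lambda>t. f (circle_pt (cis t)) / (1 - w * cis (- t))) integrable_on {0..2 * pi}"
  using circle_kernel_nonzero[OF assms(3)]
  by (intro integrable_continuous_real continuous_intros continuous_circle_trace[OF assms(1,2)]) auto

lemma cauchy_int_add:
  assumes "f \<in> C_hoelder \<mu>" "g \<in> C_hoelder \<mu>" "\<mu> > 0" "norm w < 1"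
  shows "cauchy_int (\<lambda>x. f x + g x) w = cauchy_int f w + cauchy_int g w"
  unfolding cauchy_int_def add_divide_distrib
  using cauchy_int_integrable[OF assms(1,3,4)] cauchy_int_integrable[OF assms(2,3,4)]
  by (simp add: Henstock_Kurzweil_Integration.integral_add add_divide_distrib)

lemma cauchy_int_scale: "cauchy_int (\<lambda>x. c * f x) w = c * cauchy_int f w"
  unfolding cauchy_int_def by (simp flip: times_divide_eq_right)

lemma cauchy_int_diff_const:
  assumes "f \<in> C_hoelder \<mu>" "\<mu> > 0" "norm w < 1"
  shows "cauchy_int f w - c = cauchy_int (\<lambda>x. f x - c) w"
  using cauchy_int_add[OF assms(1) fun_algebra.const[OF fun_algebra_hoelder[OF assms(2)], of "- c"] assms(2,3)]
    cauchy_int_const[OF assms(3)] by simp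

lemma cauchy_int_derivative:
  assumes "f \<in> C_hoelder \<mu>" "\<mu> > 0" "norm w < 1"
  shows "(cauchy_int f has_field_derivative
      integral {0..2 * pi} (\<lambda>t. f (circle_pt (cis t)) * cis (- t) / (1 - w * cis (- t))\<^sup>2) / (2 * pi)) (at w)"
proof -
  let ?F = "\<lambda>w t. f (circle_pt (cis t)) / (1 - w * cis (- t))"
  let ?D = "\<lambda>w t. f (circle_pt (cis t)) * cis (- t) / (1 - w * cis (- t))\<^sup>2"
  have nz: "1 - w * cis (- t) \<noteq> 0" if "w \<in> ball 0 1" for w t
    using circle_kernel_nonzero[of w t] that by simp
  have "((\<lambda>w. integral (cbox 0 (2 * pi)) (?F w)) has_field_derivative integral (cbox 0 (2 * pi)) (?D w)) (at w within ball 0 1)"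
  proof (rule leibniz_rule_field_derivative)
    show "((\<lambda>w. ?F w t) has_field_derivative ?D w t) (at w within ball 0 1)" if "w \<in> ball 0 1" for w t
      using nz[OF that, of t] by (auto intro!: derivative_eq_intros simp: power2_eq_square)
    show "?F w integrable_on cbox 0 (2 * pi)" if "w \<in> ball 0 1" for w
      using cauchy_int_integrable[OF assms(1,2), of w] that by simp
    have "continuous_on UNIV (\<lambda>t. f (circle_pt (cis t)))" by (rule continuous_circle_trace[OF assms(1,2)])
    then have "continuous_on (ball 0 1 \<times> cbox 0 (2 * pi)) (\<lambda>p. f (circle_pt (cis (snd p))))"
      by (rule continuous_on_compose2) (auto intro!: continuous_intros)
    then show "continuous_on (ball 0 1 \<times> cbox 0 (2 * pi)) (\<lambda>(w, t). ?D w t)"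
      unfolding split_beta using nz by (intro continuous_intros) auto
  qed (use assms in auto)
  then have "((\<lambda>w. integral {0..2 * pi} (?F w)) has_field_derivative integral {0..2 * pi} (?D w)) (at w)"
    using at_within_open[of w "ball 0 1"] assms(3) by simp
  then show ?thesis unfolding cauchy_int_def by (rule DERIV_cdivide)
qed

text \<open>The point \<open>z\<close> of the circle nearest to \<open>w\<close> satisfies \<open>|t - z| \<le> |t - w| + |w - z| \<le> 2 |t - w|\<close> for
  every \<open>t\<close> on the circle.\<close>

lemma circle_hoelder_near:
  assumes C: "C \<ge> 0" "\<And>x y. norm (f x - f y) \<le> C * dist (lam_ratio x) (lam_ratio y) powr \<mu>"
    and "\<mu> > 0" "norm w < 1" and z: "norm z = 1" "w = complex_of_real (norm w) * z"
  shows "norm (f (circle_pt (cis t)) - f (circle_pt z)) \<le> C * 2 powr \<mu> * norm (cis t - w) powr \<mu>"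
proof -
  have "norm (z - w) = 1 - norm w"
  proof -
    have "z - w = complex_of_real (1 - norm w) * z" using z(2) by (simp add: algebra_simps)
    then have "norm (z - w) = \<bar>1 - norm w\<bar> * norm z" by (metis norm_mult norm_of_real)
    then show ?thesis using z(1) assms(4) by simp
  qed
  also have "\<dots> \<le> norm (cis t - w)" using norm_triangle_ineq2[of "cis t" w] by simp
  finally have "norm (cis t - z) \<le> 2 * norm (cis t - w)"
    using norm_triangle_ineq4[of "cis t - w" "z - w"] by simp
  then have "norm (cis t - z) powr \<mu> \<le> (2 * norm (cis t - w)) powr \<mu>"
    using assms by (intro powr_mono2) auto
  then have "C * norm (cis t - z) powr \<mu> \<le> C * (2 powr \<mu> * norm (cis t - w) powr \<mu>)"
    using C(1) by (intro mult_left_mono) (auto simp: powr_mult)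
  then show ?thesis using C(2)[of "circle_pt (cis t)" "circle_pt z"] z(1) by (simp add: dist_norm mult.assoc)
qed

lemma ex_unimodular_factor: "\<exists>z::complex. norm z = 1 \<and> w = complex_of_real (norm w) * z"
proof (cases "w = 0")
  case True then show ?thesis by (intro exI[of _ 1]) simp
next
  case False then show ?thesis by (intro exI[of _ "w / complex_of_real (norm w)"]) (simp add: norm_divide)
qed

text \<open>Subtracting from \<open>f\<close> its value at the boundary point nearest to \<open>w\<close> changes the Cauchy integral by a
  constant and leaves its derivative alone, while the integrand gains the factor
  \<open>|t - w|\<^sup>\<mu>\<close>.\<close>

lemma cauchy_int_deriv_bound:
  assumes "f \<in> C_hoelder \<mu>" "0 < \<mu>" "\<mu> < 1"
  obtains B where "\<And>w. norm w < 1 \<Longrightarrow> norm (deriv (cauchy_int f) w) \<le> B * (1 - norm w) powr (\<mu> - 1)"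
proof -
  obtain C where C: "C \<ge> 0" "\<And>x y. norm (f x - f y) \<le> C * dist (lam_ratio x) (lam_ratio y) powr \<mu>"
    using hoelderE[OF assms(1)] by metis
  let ?B = "C * 2 powr \<mu> * kernel_const \<mu> / (2 * pi)"
  have "norm (deriv (cauchy_int f) w) \<le> ?B * (1 - norm w) powr (\<mu> - 1)" if w: "norm w < 1" for w
  proof -
    obtain z where z: "norm z = 1" "w = complex_of_real (norm w) * z" using ex_unimodular_factor by blast
    define c where "c = f (circle_pt z)"
    define g where "g = (\<lambda>x. f x - c)"
    have g: "g \<in> C_hoelder \<mu>" unfolding g_def
      by (intro fun_algebra.diff fun_algebra.const fun_algebra_hoelder assms)
    let ?D = "\<lambda>t. g (circle_pt (cis t)) * cis (- t) / (1 - w * cis (- t))\<^sup>2"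
    have "(cauchy_int f has_field_derivative integral {0..2 * pi} ?D / (2 * pi)) (at w)"
    proof (rule has_field_derivative_transform_within_open)
      show "((\<lambda>w. cauchy_int g w + c) has_field_derivative integral {0..2 * pi} ?D / (2 * pi)) (at w)"
        using cauchy_int_derivative[OF g assms(2) w] by (auto intro!: derivative_eq_intros)
      show "cauchy_int g v + c = cauchy_int f v" if "v \<in> ball 0 1" for v
        using cauchy_int_diff_const[OF assms(1,2), of v c] that by (simp add: g_def algebra_simps)
    qed (use w in auto)
    then have "norm (deriv (cauchy_int f) w) = norm (integral {0..2 * pi} ?D) / (2 * pi)"
      by (simp add: DERIV_imp_deriv norm_divide)
    also have "norm (integral {0..2 * pi} ?D) \<le> (C * 2 powr \<mu>) * kernel_const \<mu> * (1 - norm w) powr (\<mu> - 1)"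
    proof (rule kernel_integral_bound[OF assms(2,3) w])
      show "?D integrable_on {0..2 * pi}"
        using circle_kernel_nonzero[OF w]
        by (intro integrable_continuous_real continuous_intros continuous_circle_trace[OF g assms(2)]) auto
      fix t
      have nz: "norm (cis t - w) > 0" using circle_kernel_nonzero[OF w, of t] norm_circle_kernel[of w t]
        by (metis zero_less_norm_iff)
      have "norm (?D t) = norm (g (circle_pt (cis t))) / norm (cis t - w) ^ 2"
        by (simp only: norm_mult norm_divide norm_power norm_circle_kernel norm_cis mult_1_right)
      also have "\<dots> \<le> (C * 2 powr \<mu> * norm (cis t - w) powr \<mu>) / norm (cis t - w) ^ 2"
        unfolding g_def c_def using circle_hoelder_near[OF C assms(2) w z] by (intro divide_right_mono) auto
      also have "\<dots> = C * 2 powr \<mu> * norm (cis t - w) powr (\<mu> - 2)"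
        using nz by (simp add: powr_diff)
      finally show "norm (?D t) \<le> C * 2 powr \<mu> * norm (cis t - w) powr (\<mu> - 2)" .
    qed (use C in simp)
    finally show ?thesis by (simp add: divide_right_mono)
  qed
  then show ?thesis using that by blast
qed

lemma cauchy_int_holomorphic:
  assumes "f \<in> C_hoelder \<mu>" "\<mu> > 0"
  shows "cauchy_int f holomorphic_on ball 0 1"
proof (rule holomorphic_onI)
  fix w :: complex assume "w \<in> ball 0 1"
  then have w: "norm w < 1" by simp
  show "cauchy_int f field_differentiable (at w within ball 0 1)"
    unfolding field_differentiable_def
    by (rule exI, rule has_field_derivative_at_within, rule cauchy_int_derivative[OF assms w])
qed

lemma cauchy_int_extension:
  assumes "f \<in> C_hoelder \<mu>" "0 < \<mu>" "\<mu> < 1"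
  obtains E where "E \<in> disc_algebra" "\<And>z. norm z < 1 \<Longrightarrow> E z = cauchy_int f z"
    "(\<lambda>x. E (lam_ratio x)) \<in> C_hoelder \<mu>" "(\<lambda>x. E (inverse (lam_ratio x))) \<in> C_hoelder \<mu>"
proof -
  obtain B where "\<And>w. norm w < 1 \<Longrightarrow> norm (deriv (cauchy_int f) w) \<le> B * (1 - norm w) powr (\<mu> - 1)"
    using cauchy_int_deriv_bound[OF assms] by blast
  then obtain L where "L \<ge> 0" "\<And>z w. norm z < 1 \<Longrightarrow> norm w < 1 \<Longrightarrow> norm (cauchy_int f z - cauchy_int f w) \<le> L * dist z w powr \<mu>"
    using Hardy_Littlewood_hoelder[OF assms(2,3) cauchy_int_holomorphic[OF assms(1,2)]] by metis
  then show ?thesis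
    using hoelder_disc_extension[OF assms(2) cauchy_int_holomorphic[OF assms(1,2)]] that by metis
qed

text \<open>Reflection \<open>t \<mapsto> 1/t\<close> of the circle.  It turns the part of \<open>f\<close> that is analytic outside
  the disc into a Cauchy integral over the disc.\<close>

definition reflect_fun :: "(rdot \<Rightarrow> complex) \<Rightarrow> rdot \<Rightarrow> complex" where
  "reflect_fun f x = f (circle_pt (inverse (lam_ratio x)))"

lemma reflect_fun_hoelder:
  assumes "f \<in> C_hoelder \<mu>"
  shows "reflect_fun f \<in> C_hoelder \<mu>"
proof -
  obtain C where C: "C \<ge> 0" "\<And>x y. norm (f x - f y) \<le> C * dist (lam_ratio x) (lam_ratio y) powr \<mu>"
    using hoelderE[OF assms(1)] by metis
  show ?thesis
  proof (rule hoelderI)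
    fix x y
    have "dist (inverse (lam_ratio x)) (inverse (lam_ratio y)) = dist (lam_ratio x) (lam_ratio y)"
      by (simp add: dist_norm inverse_diff_inverse norm_mult norm_inverse norm_minus_commute)
    then show "norm (reflect_fun f x - reflect_fun f y) \<le> C * dist (lam_ratio x) (lam_ratio y) powr \<mu>"
      using C(2)[of "circle_pt (inverse (lam_ratio x))" "circle_pt (inverse (lam_ratio y))"]
      by (simp add: reflect_fun_def norm_inverse)
  qed
qed

lemma cauchy_int_reflect_fun:
  "cauchy_int (reflect_fun f) w = integral {0..2 * pi} (\<lambda>t. f (circle_pt (cis t)) / (1 - w * cis t)) / (2 * pi)"
proof -
  let ?h = "\<lambda>t. f (circle_pt (cis t)) / (1 - w * cis t)"
  have "integral {0..2 * pi} (\<lambda>t. ?h (- t)) = integral {- (2 * pi)..-0} ?h"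
    using Henstock_Kurzweil_Integration.integral_reflect_real[of "2 * pi" 0 "\<lambda>t. ?h (- t)"] by simp
  also have "\<dots> = integral {0..2 * pi} (\<lambda>t. ?h (t - 2 * pi))"
    using integral_shift_real_ivl[of 0 "2 * pi" "2 * pi" "\<lambda>t. ?h (t - 2 * pi)"] by simp
  also have "\<dots> = integral {0..2 * pi} ?h"
    by (simp add: cis_divide[symmetric])
  finally show ?thesis
    unfolding cauchy_int_def reflect_fun_def by (simp add: cis_inverse)
qed

text \<open>The two Cauchy integrals of \<open>f\<close> and of its reflection extend to Hoelder functions by the
  Hardy-Littlewood lemma.  Their sum at \<open>r z\<close> and \<open>r / z\<close>, corrected by the doubly counted mean value,
  is the Poisson integral of \<open>f\<close>, so it tends to \<open>f\<close> as \<open>r\<close> tends to 1.\<close>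

theorem Privalov_decomposition:
  assumes f: "f \<in> C_hoelder \<mu>" and \<mu>: "0 < \<mu>" "\<mu> < 1"
  obtains \<Phi> \<Psi> where "\<Phi> \<in> disc_algebra" "\<Psi> \<in> disc_algebra"
    "(\<lambda>x. \<Phi> (lam_ratio x)) \<in> C_hoelder \<mu>" "(\<lambda>x. \<Psi> (inverse (lam_ratio x))) \<in> C_hoelder \<mu>"
    "\<And>x. f x = \<Phi> (lam_ratio x) + \<Psi> (inverse (lam_ratio x))"
    "\<And>w. norm w < 1 \<Longrightarrow> \<Phi> w = cauchy_int f w"
proof -
  obtain \<Phi> where P: "\<Phi> \<in> disc_algebra" "\<And>z. norm z < 1 \<Longrightarrow> \<Phi> z = cauchy_int f z"
    "(\<lambda>x. \<Phi> (lam_ratio x)) \<in> C_hoelder \<mu>"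
    using cauchy_int_extension[OF f \<mu>] by metis
  obtain R where R: "R \<in> disc_algebra" "\<And>z. norm z < 1 \<Longrightarrow> R z = cauchy_int (reflect_fun f) z"
    "(\<lambda>x. R (inverse (lam_ratio x))) \<in> C_hoelder \<mu>"
    using cauchy_int_extension[OF reflect_fun_hoelder[OF f] \<mu>] by metis
  define \<Psi> where "\<Psi> z = R z - R 0" for z
  obtain C where C: "C \<ge> 0" "\<And>x y. norm (f x - f y) \<le> C * dist (lam_ratio x) (lam_ratio y) powr \<mu>"
    using hoelderE[OF f] by metis
  have eq: "f x = \<Phi> (lam_ratio x) + \<Psi> (inverse (lam_ratio x))" for x
  proof -
    define z where "z = lam_ratio x"
    have z: "norm z = 1" "circle_pt z = x" by (simp_all add: z_def)
    define K where "K = C * 2 powr \<mu> * kernel_const \<mu> / pi"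
    \<comment> \<open>the Poisson integral of \<open>f\<close> at \<open>r z\<close> differs from \<open>f x\<close> by at most a multiple of \<open>(1 - r)\<^sup>\<mu>\<close>\<close>
    have est: "norm (\<Phi> (complex_of_real r * z) + \<Psi> (complex_of_real r * inverse z) - f x) \<le> K * (1 - r) powr \<mu>"
      if r: "0 < r" "r < 1" for r
    proof -
      define w where "w = complex_of_real r * z"
      have w: "norm w < 1" "norm w = r" using r z by (auto simp: w_def norm_mult)
      have cw: "complex_of_real r * inverse z = cnj w"
      proof -
        have "z * cnj z = 1" using complex_norm_square[of z] z(1) by simp
        then have "inverse z = cnj z" by (rule inverse_unique)
        then show ?thesis by (simp add: w_def)
      qed
      have wc: "norm (cnj w) < 1" using w by simp
      define g where "g = (\<lambda>y. f y - f x)"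
      have g: "g \<in> C_hoelder \<mu>" unfolding g_def
        by (intro fun_algebra.diff fun_algebra.const fun_algebra_hoelder f \<mu>)
      let ?a = "\<lambda>t. g (circle_pt (cis t)) / (1 - w * cis (- t))"
      let ?b = "\<lambda>t. g (circle_pt (cis t)) / (1 - cnj w * cis t)"
      let ?c = "\<lambda>t. g (circle_pt (cis t))"
      have nz: "1 - w * cis (- t) \<noteq> 0" "1 - cnj w * cis t \<noteq> 0" for t
        using circle_kernel_nonzero[OF w(1), of t] circle_kernel_nonzero[OF wc, of "- t"] by auto
      have ints: "?a integrable_on {0..2 * pi}" "?b integrable_on {0..2 * pi}" "?c integrable_on {0..2 * pi}"
        using nz by (intro integrable_continuous_real continuous_intros continuous_circle_trace[OF g \<mu>(1)]; simp)+
      have cg: "reflect_fun g = (\<lambda>y. reflect_fun f y - f x)" by (auto simp: reflect_fun_def g_def)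
      have "\<Phi> w + \<Psi> (cnj w) - f x = (cauchy_int f w - f x) + (cauchy_int (reflect_fun f) (cnj w) - f x)
          - (cauchy_int (reflect_fun f) 0 - f x)"
        using P(2)[OF w(1)] R(2)[OF wc] R(2)[of 0] by (simp add: \<Psi>_def)
      also have "\<dots> = cauchy_int g w + cauchy_int (reflect_fun g) (cnj w) - cauchy_int (reflect_fun g) 0"
        using cauchy_int_diff_const[OF f \<mu>(1) w(1), of "f x"]
          cauchy_int_diff_const[OF reflect_fun_hoelder[OF f] \<mu>(1) wc, of "f x"]
          cauchy_int_diff_const[OF reflect_fun_hoelder[OF f] \<mu>(1), of 0 "f x"]
        unfolding cg g_def[symmetric] by simp
      also have "\<dots> = (integral {0..2 * pi} ?a + integral {0..2 * pi} ?b - integral {0..2 * pi} ?c) / (2 * pi)"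
        unfolding cauchy_int_reflect_fun unfolding cauchy_int_def by (simp add: add_divide_distrib diff_divide_distrib)
      also have "integral {0..2 * pi} ?a + integral {0..2 * pi} ?b - integral {0..2 * pi} ?c
          = integral {0..2 * pi} (\<lambda>t. ?a t + ?b t - ?c t)"
        using ints by (simp add: Henstock_Kurzweil_Integration.integral_add Henstock_Kurzweil_Integration.integral_diff integrable_add)
      finally have id: "\<Phi> w + \<Psi> (cnj w) - f x = integral {0..2 * pi} (\<lambda>t. ?a t + ?b t - ?c t) / (2 * pi)" .
      have "norm (integral {0..2 * pi} (\<lambda>t. ?a t + ?b t - ?c t)) \<le>
          (C * 2 powr \<mu> * (2 * (1 - r))) * kernel_const \<mu> * (1 - norm w) powr (\<mu> - 1)"
      proof (rule kernel_integral_bound[OF \<mu> w(1)])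
        show "(\<lambda>t. ?a t + ?b t - ?c t) integrable_on {0..2 * pi}"
          using ints by (intro integrable_add integrable_diff)
        fix t
        have pos: "norm (cis t - w) > 0" using nz(1)[of t] norm_circle_kernel[of w t]
          by (metis zero_less_norm_iff)
        have cn: "1 - cnj w * cis t = cnj (1 - w * cis (- t))" by (simp add: cis_cnj)
        have prod: "(1 - w * cis (- t)) * (1 - cnj w * cis t) = complex_of_real ((norm (cis t - w))\<^sup>2)"
          unfolding cn norm_circle_kernel[symmetric] by (rule complex_norm_square[symmetric])
        have ww: "w * cnj w = complex_of_real (r\<^sup>2)" using complex_norm_square[of w] w(2) by simp
        have cc: "cis (- t) * cis t = 1" by (simp add: cis_mult)
        have "?a t + ?b t - ?c t = ?c t * (((1 - cnj w * cis t) + (1 - w * cis (- t)) - (1 - w * cis (- t)) * (1 - cnj w * cis t))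
            / ((1 - w * cis (- t)) * (1 - cnj w * cis t)))"
          using nz[of t] by (simp add: divide_simps) (simp add: algebra_simps)
        also have "(1 - cnj w * cis t) + (1 - w * cis (- t)) - (1 - w * cis (- t)) * (1 - cnj w * cis t) = 1 - (w * cnj w) * (cis (- t) * cis t)"
          by (simp add: algebra_simps)
        also have "\<dots> = complex_of_real (1 - r\<^sup>2)" unfolding ww cc by simp
        finally have "norm (?a t + ?b t - ?c t) = norm (?c t) * (\<bar>1 - r\<^sup>2\<bar> / (norm (cis t - w))\<^sup>2)"
          unfolding prod by (simp only: norm_mult norm_divide norm_of_real abs_power2)
        also have "\<dots> \<le> (C * 2 powr \<mu> * norm (cis t - w) powr \<mu>) * ((2 * (1 - r)) / (norm (cis t - w))\<^sup>2)"
        proof (intro mult_mono divide_right_mono)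
          show "norm (?c t) \<le> C * 2 powr \<mu> * norm (cis t - w) powr \<mu>"
            unfolding g_def using circle_hoelder_near[OF C \<mu>(1) w(1) z(1), of t] w(2) z(2) by (simp add: w_def)
          have "1 - r\<^sup>2 = (1 + r) * (1 - r)" by (simp add: power2_eq_square algebra_simps)
          also have "\<dots> \<le> 2 * (1 - r)" using r by (intro mult_right_mono) auto
          finally have "1 - r\<^sup>2 \<le> 2 * (1 - r)" .
          moreover have "0 \<le> 1 - r\<^sup>2" using r by (simp add: power_le_one)
          ultimately show "\<bar>1 - r\<^sup>2\<bar> \<le> 2 * (1 - r)" by (simp only: abs_of_nonneg)
        qed (use C in auto)
        also have "\<dots> = (C * 2 powr \<mu> * (2 * (1 - r))) * norm (cis t - w) powr (\<mu> - 2)"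
          using pos by (simp add: powr_diff)
        finally show "norm (?a t + ?b t - ?c t) \<le> (C * 2 powr \<mu> * (2 * (1 - r))) * norm (cis t - w) powr (\<mu> - 2)" .
      qed (use C r in simp)
      then have "norm (\<Phi> w + \<Psi> (cnj w) - f x) \<le> (C * 2 powr \<mu> * (2 * (1 - r))) * kernel_const \<mu> * (1 - r) powr (\<mu> - 1) / (2 * pi)"
        unfolding id w(2) by (simp add: norm_divide divide_right_mono)
      also have "\<dots> = K * ((1 - r) * (1 - r) powr (\<mu> - 1))" by (simp only: K_def) (simp add: field_simps)
      also have "(1 - r) * (1 - r) powr (\<mu> - 1) = (1 - r) powr \<mu>"
        using r by (simp add: powr_diff)
      finally show ?thesis unfolding cw w_def .
    qed
    have ev: "\<forall>\<^sub>F r in at_left (1::real). 0 < r \<and> r < 1"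
      by (rule eventually_mono[OF eventually_at_left_real[of 0 1]]) auto
    have lim: "((\<lambda>r. E (complex_of_real r * u)) \<longlongrightarrow> E u) (at_left 1)" if "E \<in> disc_algebra" "norm u = 1" for E u
    proof (rule continuous_on_tendsto_compose[of "cball 0 1" E])
      show "((\<lambda>r. complex_of_real r * u) \<longlongrightarrow> u) (at_left 1)" by (auto intro!: tendsto_eq_intros)
      show "\<forall>\<^sub>F r in at_left 1. complex_of_real r * u \<in> cball 0 1"
        using ev by eventually_elim (use that in \<open>auto simp: norm_mult\<close>)
    qed (use that in \<open>auto simp: disc_algebra_def\<close>)
    have "((\<lambda>r. \<Phi> (complex_of_real r * z) + \<Psi> (complex_of_real r * inverse z) - f x) \<longlongrightarrow>
        \<Phi> z + \<Psi> (inverse z) - f x) (at_left 1)"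
      unfolding \<Psi>_def by (intro tendsto_intros lim P R) (auto simp: z norm_inverse)
    moreover have "((\<lambda>r. \<Phi> (complex_of_real r * z) + \<Psi> (complex_of_real r * inverse z) - f x) \<longlongrightarrow> 0) (at_left 1)"
    proof (rule Lim_null_comparison)
      show "\<forall>\<^sub>F r in at_left 1. norm (\<Phi> (complex_of_real r * z) + \<Psi> (complex_of_real r * inverse z) - f x) \<le> K * (1 - r) powr \<mu>"
        using ev by eventually_elim (use est in auto)
      have "((\<lambda>r. K * (1 - r) powr \<mu>) \<longlongrightarrow> K * (1 - 1) powr \<mu>) (at_left 1)"
        using \<mu>(1) by (intro tendsto_intros tendsto_powr')
          (auto intro!: tendsto_eq_intros eventually_mono[OF ev])
      then show "((\<lambda>r. K * (1 - r) powr \<mu>) \<longlongrightarrow> 0) (at_left 1)" by simp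
    qed
    ultimately have "\<Phi> z + \<Psi> (inverse z) - f x = 0"
      by (rule tendsto_unique[rotated]) simp
    then show ?thesis by (simp add: z_def)
  qed
  have "\<Psi> \<in> disc_algebra" unfolding \<Psi>_def
    by (intro fun_algebra.diff[OF fun_algebra_disc_algebra] R fun_algebra.const[OF fun_algebra_disc_algebra])
  moreover have "(\<lambda>x. \<Psi> (inverse (lam_ratio x))) \<in> C_hoelder \<mu>" unfolding \<Psi>_def
    by (intro fun_algebra.diff[OF fun_algebra_hoelder[OF \<mu>(1)]] R fun_algebra.const[OF fun_algebra_hoelder[OF \<mu>(1)]])
  ultimately show ?thesis using that[of \<Phi> \<Psi>] P eq by blast
qed

section \<open>Logarithms\<close>

text \<open>Where two values of \<open>l\<close> are close, their difference is controlled by that of the exponentials; by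
  uniform continuity this covers all pairs of points at small distance, and boundedness of \<open>l\<close>
  covers the rest.\<close>

lemma hoelder_log:
  assumes l: "continuous_on (sphere 0 1) (\<lambda>z. l (circle_pt z))"
    and e: "(\<lambda>x. exp (l x)) \<in> C_hoelder \<mu>" and "\<mu> > 0"
  shows "l \<in> C_hoelder \<mu>"
proof -
  obtain C where C: "C \<ge> 0" "\<And>x y. norm (exp (l x) - exp (l y)) \<le> C * dist (lam_ratio x) (lam_ratio y) powr \<mu>"
    using hoelderE[OF e] by metis
  have "(\<lambda>x. inverse (exp (l x))) \<in> C_hoelder \<mu>" by (rule hoelder_inverse[OF e assms(3)]) simp
  then obtain B where B: "B > 0" "\<And>x. norm (inverse (exp (l x))) \<le> B" using hoelder_bounded assms(3) by metis
  \<comment> \<open>the logarithm is Lipschitz near 1, so exp is bi-Lipschitz at small scale\<close>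
  have small: "norm u \<le> 2 * norm (exp u - 1)" if "norm u \<le> 1 / 2" for u :: complex
  proof (cases "norm (exp u - 1) < 1 / 2")
    case True
    have "\<bar>Im u\<bar> \<le> 1 / 2" using abs_Im_le_cmod[of u] that by linarith
    then have "- pi < Im u" "Im u \<le> pi" using pi_gt3 by linarith+
    then have "Ln (1 + (exp u - 1)) = u" using Ln_exp[of u] by (simp only: add_diff_cancel_left' diff_add_cancel add_diff_eq)
    then show ?thesis using norm_Ln_le[OF True] by (simp only:)
  next
    case False
    then show ?thesis using that by simp
  qed
  have "compact ((\<lambda>z. l (circle_pt z)) ` sphere 0 1)" by (intro compact_continuous_image l) auto
  from compact_imp_bounded[OF this] obtain M where M: "M > 0" "\<And>z. norm z = 1 \<Longrightarrow> norm (l (circle_pt z)) \<le> M"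
    unfolding bounded_pos by auto
  have "uniformly_continuous_on (sphere 0 1) (\<lambda>z. l (circle_pt z))"
    by (intro compact_uniformly_continuous l) auto
  then obtain d where d: "d > 0" "\<And>z w. norm z = 1 \<Longrightarrow> norm w = 1 \<Longrightarrow> dist w z < d \<Longrightarrow> dist (l (circle_pt w)) (l (circle_pt z)) < 1 / 2"
    unfolding uniformly_continuous_on_def by (metis mem_sphere_0 half_gt_zero zero_less_one)
  define K where "K = 2 * B * C + 2 * M / d powr \<mu>"
  show ?thesis
  proof (rule hoelderI)
    fix x y
    let ?D = "dist (lam_ratio x) (lam_ratio y)"
    show "norm (l x - l y) \<le> K * ?D powr \<mu>"
    proof (cases "?D < d")
      case True
      have "norm (l x - l y) \<le> 1 / 2"
        using d(2)[of "lam_ratio y" "lam_ratio x"] True by (simp add: dist_norm)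
      then have "norm (l x - l y) \<le> 2 * norm (exp (l x - l y) - 1)" by (rule small)
      also have "exp (l x - l y) - 1 = inverse (exp (l y)) * (exp (l x) - exp (l y))"
        by (simp add: exp_diff field_simps)
      also have "2 * norm \<dots> \<le> 2 * (B * (C * ?D powr \<mu>))"
        unfolding norm_mult using B C by (intro mult_left_mono mult_mono) auto
      also have "\<dots> \<le> K * ?D powr \<mu>"
        using M d by (simp add: K_def algebra_simps)
      finally show ?thesis .
    next
      case False
      have "norm (l x - l y) \<le> norm (l x) + norm (l y)" by (rule norm_triangle_ineq4)
      also have "\<dots> \<le> 2 * M" using M(2)[of "lam_ratio x"] M(2)[of "lam_ratio y"] by simp
      also have "2 * M \<le> 2 * M / d powr \<mu> * ?D powr \<mu>"
      proof -
        have "d powr \<mu> \<le> ?D powr \<mu>" using False d assms by (intro powr_mono2) auto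
        then have "2 * M * d powr \<mu> \<le> 2 * M * ?D powr \<mu>" using M by (intro mult_left_mono) auto
        then show ?thesis using d by (simp add: field_simps)
      qed
      also have "\<dots> \<le> K * ?D powr \<mu>" using B C by (intro mult_right_mono) (auto simp: K_def)
      finally show ?thesis .
    qed
  qed
qed

lemma hoelder_Ln:
  assumes f: "f \<in> C_hoelder \<mu>" "\<mu> > 0" and nz: "\<And>x. f x \<notin> \<real>\<^sub>\<le>\<^sub>0"
  shows "(\<lambda>x. Ln (f x)) \<in> C_hoelder \<mu>"
proof (rule hoelder_log[OF _ _ f(2)])
  show "continuous_on (sphere 0 1) (\<lambda>z. Ln (f (circle_pt z)))"
    using nz by (intro continuous_intros hoelder_continuous[OF f]) auto
  have "f x \<noteq> 0" for x using nz[of x] by auto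
  then show "(\<lambda>x. exp (Ln (f x))) \<in> C_hoelder \<mu>" using f by simp
qed

text \<open>A continuous logarithm along the angle increases by \<open>2\<pi>in\<close> in one turn, \<open>n\<close> being the winding
  number.  Subtracting \<open>in\<theta>\<close> makes it periodic, so that it descends to the circle.\<close>

theorem hoelder_power_times_exp:
  assumes f: "f \<in> C_hoelder \<mu>" "0 < \<mu>" "\<mu> \<le> 1" and nz: "\<And>x. f x \<noteq> 0"
  obtains n :: int and l where "l \<in> C_hoelder \<mu>" "\<And>x. f x = lam_ratio x powi n * exp (l x)"
proof -
  have cont: "continuous_on UNIV (\<lambda>t. f (circle_pt (cis t)))"
    by (rule continuous_on_compose2[OF hoelder_continuous[OF f(1,2)]]) (auto intro!: continuous_intros)
  obtain g where g: "continuous_on UNIV g" "\<And>t. f (circle_pt (cis t)) = exp (g t)"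
    using continuous_logarithm_on_contractible[OF cont convex_imp_contractible[OF convex_UNIV]] nz by (metis UNIV_I)
  define D where "D t = (g (t + 2 * pi) - g t) / (2 * pi * \<i>)" for t :: real
  have "D constant_on UNIV"
  proof (rule continuous_discrete_range_constant)
    have "continuous_on UNIV (\<lambda>t. g (t + 2 * pi))"
      by (rule continuous_on_compose2[OF g(1)]) (auto intro!: continuous_intros)
    then show "continuous_on UNIV D" unfolding D_def by (intro continuous_intros g) auto
    have int: "D t \<in> \<int>" for t
    proof -
      have "exp (g (t + 2 * pi)) = exp (g t)" using g(2)[of t] g(2)[of "t + 2 * pi"]
        by (simp add: cis_mult[symmetric])
      then obtain k :: int where "g (t + 2 * pi) = g t + (of_int (2 * k) * pi) * \<i>" by (auto simp: exp_eq)
      then have "D t = of_int k" by (simp add: D_def)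
      then show ?thesis by simp
    qed
    show "\<exists>e>0. \<forall>y. y \<in> UNIV \<and> D y \<noteq> D x \<longrightarrow> e \<le> norm (D y - D x)" for x
    proof (intro exI[of _ 1] conjI allI impI)
      fix y assume y: "y \<in> UNIV \<and> D y \<noteq> D x"
      have "D y - D x \<in> \<int>" using int by (intro Ints_diff)
      then obtain k :: int where "D y - D x = of_int k" by (auto elim: Ints_cases)
      moreover have "k \<noteq> 0" using y calculation by auto
      ultimately show "1 \<le> norm (D y - D x)" by simp
    qed simp
  qed simp
  moreover have "\<exists>n::int. D 0 = of_int n"
  proof -
    have "exp (g (0 + 2 * pi)) = exp (g 0)" using g(2)[of 0] g(2)[of "0 + 2 * pi"] by simp
    then obtain k :: int where "g (0 + 2 * pi) = g 0 + (of_int (2 * k) * pi) * \<i>" by (auto simp: exp_eq)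
    then have "D 0 = of_int k" by (simp add: D_def)
    then show ?thesis by blast
  qed
  ultimately obtain n :: int where n: "\<And>t. D t = of_int n" by (metis UNIV_I constant_on_def)
  \<comment> \<open>the periodic logarithm\<close>
  define h where "h t = g t - of_int n * \<i> * complex_of_real t" for t
  have h_per: "h (t + 2 * pi) = h t" for t
    using n[of t] by (simp add: h_def D_def field_simps)
  have h_per': "h a = h b" if "cis a = cis b" for a b
  proof -
    have "exp (\<i> * a) = exp (\<i> * b)" using that by (simp add: cis_conv_exp)
    then obtain k :: int where "\<i> * a = \<i> * b + (of_int (2 * k) * pi) * \<i>" by (auto simp: exp_eq)
    then have "complex_of_real a = complex_of_real (b + 2 * pi * of_int k)"
      by (simp add: complex_eq_iff)
    then have a: "a = b + 2 * pi * of_int k" using of_real_eq_iff by blast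
    have "h (b + 2 * pi * of_int k) = h b"
    proof (induction k rule: int_induct[where k = 0])
      case (step1 i)
      then show ?case using h_per[of "b + 2 * pi * of_int i"] by (simp add: algebra_simps)
    next
      case (step2 i)
      then show ?case using h_per[of "b + 2 * pi * of_int (i - 1)"] by (simp add: algebra_simps)
    qed simp
    then show ?thesis using a by simp
  qed
  have contz: "isCont h t" for t
    using g(1) unfolding h_def by (intro continuous_intros) (auto simp: continuous_on_eq_continuous_at)
  define l where "l x = h (Arg (lam_ratio x))" for x
  have l_eq: "l (circle_pt (cis t)) = h t" for t
    unfolding l_def by (intro h_per') (simp add: cis_Arg)
  have fl: "f x = lam_ratio x powi n * exp (l x)" for x
  proof -
    define t where "t = Arg (lam_ratio x)"
    have lt: "lam_ratio x = cis t" unfolding t_def by (metis cis_Arg lam_ratio_nonzero norm_lam_ratio sgn_eq div_by_1 of_real_1)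
    then have x: "x = circle_pt (cis t)" by (metis circle_pt_lam_ratio)
    have "exp (g t) = exp (of_int n * (\<i> * complex_of_real t)) * exp (h t)"
      unfolding h_def exp_add[symmetric] by (simp add: algebra_simps)
    also have "exp (of_int n * (\<i> * complex_of_real t)) = cis t powi n"
      by (simp add: exp_power_int[symmetric] cis_conv_exp mult.commute)
    finally show ?thesis unfolding lt using g(2)[of t] l_eq[of t] x by simp
  qed
  have contl: "continuous_on (sphere 0 1) (\<lambda>z. l (circle_pt z))"
    unfolding continuous_on_def
  proof
    fix a :: complex assume a: "a \<in> sphere 0 1"
    then have na: "norm a = 1" by simp
    \<comment> \<open>an angle that is continuous near \<open>a\<close>, also where \<open>Arg\<close> jumps\<close>
    define \<theta> where "\<theta> z = Arg a + Im (Ln (z / a))" for z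
    have c: "cis (\<theta> z) = z" if "norm z = 1" for z
    proof -
      have "z / a \<noteq> 0" "norm (z / a) = 1" using that na by (auto simp: norm_divide)
      then have "cis (Im (Ln (z / a))) = z / a"
        by (metis Arg_def cis_Arg div_by_1 of_real_1 sgn_eq)
      moreover have "cis (Arg a) = a" using na by (metis cis_Arg div_by_1 norm_zero of_real_1 sgn_eq zero_neq_one)
      ultimately have "cis (\<theta> z) = a * (z / a)" unfolding \<theta>_def by (simp add: cis_mult[symmetric])
      then show ?thesis using na by auto
    qed
    have "((\<lambda>z. h (\<theta> z)) \<longlongrightarrow> h (\<theta> a)) (at a within sphere 0 1)"
    proof (rule isCont_tendsto_compose[OF contz])
      have "a \<noteq> 0" using na by auto
      then show "(\<theta> \<longlongrightarrow> \<theta> a) (at a within sphere 0 1)" unfolding \<theta>_def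
        by (intro tendsto_intros) auto
    qed
    moreover have "\<forall>\<^sub>F z in at a within sphere 0 1. h (\<theta> z) = l (circle_pt z)"
    proof -
      have "h (\<theta> z) = l (circle_pt z)" if "z \<in> sphere 0 1" for z
        using l_eq[of "\<theta> z"] c[of z] that by simp
      then show ?thesis by (auto simp: eventually_at_filter intro!: always_eventually)
    qed
    moreover have "h (\<theta> a) = l (circle_pt a)" using l_eq[of "\<theta> a"] c[OF na] by simp
    ultimately show "((\<lambda>z. l (circle_pt z)) \<longlongrightarrow> l (circle_pt a)) (at a within sphere 0 1)"
      using Lim_transform_eventually by fastforce
  qed
  have "l \<in> C_hoelder \<mu>"
  proof (rule hoelder_log[OF contl _ f(2)])
    have "(\<lambda>x. lam_ratio x powi n) \<in> C_hoelder \<mu>"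
    proof (cases "n \<ge> 0")
      case True
      then show ?thesis using fun_algebra.power[OF fun_algebra_hoelder[OF f(2)] hoelder_lam_ratio[OF f(2,3)]]
        by (simp add: power_int_def)
    next
      case False
      have "(\<lambda>x. inverse (lam_ratio x)) \<in> C_hoelder \<mu>"
        by (intro hoelder_inverse hoelder_lam_ratio f) auto
      from fun_algebra.power[OF fun_algebra_hoelder[OF f(2)] this] False show ?thesis
        by (simp add: power_int_def)
    qed
    then have "(\<lambda>x. f x / lam_ratio x powi n) \<in> C_hoelder \<mu>"
      by (intro hoelder_divide f) auto
    moreover have "exp (l x) = f x / lam_ratio x powi n" for x using fl[of x] by (simp add: power_int_eq_0_iff)
    ultimately show "(\<lambda>x. exp (l x)) \<in> C_hoelder \<mu>" by simp
  qed
  then show ?thesis using that fl by blast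
qed

section \<open>Hyperbolic functions of a square root\<close>

text \<open>The entire functions \<open>cosh \<surd>x\<close> and \<open>sinh \<surd>x / \<surd>x\<close>.  They express the exponential of a matrix
  whose square is a scalar function, without a choice of the root.\<close>

definition cosh_sqrt :: "complex \<Rightarrow> complex" where
  "cosh_sqrt x = (\<Sum>n. x ^ n / fact (2 * n))"

definition sinhc_sqrt :: "complex \<Rightarrow> complex" where
  "sinhc_sqrt x = (\<Sum>n. x ^ n / fact (2 * n + 1))"

lemma entire_power_series:
  fixes a :: "nat \<Rightarrow> complex"
  assumes "\<And>z. summable (\<lambda>n. a n * z ^ n)"
  shows "(\<lambda>z. \<Sum>n. a n * z ^ n) holomorphic_on UNIV"
proof -
  have "((\<lambda>z. \<Sum>n. a n * z ^ n) has_field_derivative (\<Sum>n. diffs a n * z ^ n)) (at z)" for z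
    by (rule termdiffs_strong'[of "norm z + 1"]) (use assms in auto)
  then show ?thesis by (auto simp: holomorphic_on_def field_differentiable_def)
qed

lemma cosh_sqrt_sums: "(\<lambda>n. (w\<^sup>2) ^ n / fact (2 * n)) sums cosh (w::complex)"
proof -
  have "(\<lambda>n. if even n then w ^ n /\<^sub>R fact n else 0) sums cosh w" using cosh_converges[of w] by (simp add: scaleR_conv_of_real divide_inverse)
  then have "(\<lambda>n. (if even (2 * n) then w ^ (2 * n) /\<^sub>R fact (2 * n) else 0)) sums cosh w"
    by (subst sums_mono_reindex) (auto simp: strict_mono_def image_iff elim!: evenE)
  moreover have "(if even (2 * n) then w ^ (2 * n) /\<^sub>R fact (2 * n) else 0) = (w\<^sup>2) ^ n / fact (2 * n)" for n
    unfolding power_mult scaleR_conv_of_real divide_inverse by simp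
  ultimately show ?thesis by (simp only:)
qed

lemma sinhc_sqrt_sums: "(\<lambda>n. w * ((w\<^sup>2) ^ n / fact (2 * n + 1))) sums sinh (w::complex)"
proof -
  have "(\<lambda>n. if even n then 0 else w ^ n /\<^sub>R fact n) sums sinh w" using sinh_converges[of w] by (simp add: scaleR_conv_of_real divide_inverse)
  then have "(\<lambda>n. (if even (2 * n + 1) then 0 else w ^ (2 * n + 1) /\<^sub>R fact (2 * n + 1))) sums sinh w"
    by (subst sums_mono_reindex) (auto simp: strict_mono_def image_iff elim!: oddE)
  moreover have "(if even (2 * n + 1) then 0 else w ^ (2 * n + 1) /\<^sub>R fact (2 * n + 1)) = w * ((w\<^sup>2) ^ n / fact (2 * n + 1))" for n
  proof -
    have "of_real (inverse (fact (2 * n + 1))) = (inverse (fact (2 * n + 1)) :: complex)" by (simp only: of_real_inverse of_real_fact)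
    then show ?thesis unfolding power_add power_mult scaleR_conv_of_real divide_inverse by (simp del: fact_Suc)
  qed
  ultimately show ?thesis by (simp only:)
qed

lemma cosh_sqrt: "cosh_sqrt (w\<^sup>2) = cosh w"
  using cosh_sqrt_sums[of w] by (simp add: cosh_sqrt_def sums_iff)

lemma summable_sinhc: "summable (\<lambda>n. (x::complex) ^ n / fact (2 * n + 1))"
proof (cases "x = 0")
  case False
  define w where "w = csqrt x"
  have w: "w\<^sup>2 = x" "w \<noteq> 0" using False by (auto simp: w_def)
  from sinhc_sqrt_sums[of w] have "summable (\<lambda>n. w * (x ^ n / fact (2 * n + 1)))"
    unfolding w(1) by (rule sums_summable)
  from summable_mult[OF this, of "inverse w"] show ?thesis using w(2) by (simp flip: mult.assoc del: fact_Suc)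
qed (auto intro: summable_finite[of "{0}"])

lemma sinhc_sqrt: "w * sinhc_sqrt (w\<^sup>2) = sinh w"
  using sinhc_sqrt_sums[of w] suminf_mult[OF summable_sinhc[of "w\<^sup>2"], of w]
  by (simp add: sinhc_sqrt_def sums_iff)

lemma summable_cosh: "summable (\<lambda>n. (x::complex) ^ n / fact (2 * n))"
  using cosh_sqrt_sums[of "csqrt x"] by (simp add: sums_iff)

lemma cosh_sqrt_entire: "cosh_sqrt holomorphic_on UNIV"
  using entire_power_series[of "\<lambda>n. 1 / fact (2 * n)"] summable_cosh unfolding cosh_sqrt_def by simp

lemma sinhc_sqrt_entire: "sinhc_sqrt holomorphic_on UNIV"
  using entire_power_series[of "\<lambda>n. 1 / fact (2 * n + 1)"] summable_sinhc unfolding sinhc_sqrt_def by simp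

section \<open>Two by two matrices\<close>

definition mk2 :: "'a \<Rightarrow> 'a \<Rightarrow> 'a \<Rightarrow> 'a \<Rightarrow> ('a::zero)^2^2" where
  "mk2 a b c d = vector [vector [a, b], vector [c, d]]"

lemma mk2_nth [simp]:
  "mk2 a b c d $ 1 $ 1 = a" "mk2 a b c d $ 1 $ 2 = b"
  "mk2 a b c d $ 2 $ 1 = c" "mk2 a b c d $ 2 $ 2 = d"
  by (simp_all add: mk2_def)

lemma mat2_eq_iff:
  fixes M N :: "'a^2^2"
  shows "M = N \<longleftrightarrow> M $ 1 $ 1 = N $ 1 $ 1 \<and> M $ 1 $ 2 = N $ 1 $ 2 \<and> M $ 2 $ 1 = N $ 2 $ 1 \<and> M $ 2 $ 2 = N $ 2 $ 2"
  by (auto simp: vec_eq_iff forall_2)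

lemma matmul2:
  fixes M N :: "'a::semiring_1^2^2"
  shows "(M ** N) $ i $ j = M $ i $ 1 * N $ 1 $ j + M $ i $ 2 * N $ 2 $ j"
  by (simp add: matrix_matrix_mult_def sum_2)

lemma mat1_mk2: "mat 1 = mk2 1 0 0 1"
  by (simp add: mat2_eq_iff mat_def)

lemma mk2_mult: "mk2 a b c d ** mk2 a' b' c' d' =
  mk2 (a * a' + b * c') (a * b' + b * d') (c * a' + d * c') (c * b' + d * (d'::'a::semiring_1))"
  by (simp add: mat2_eq_iff matmul2)

lemma det_mk2 [simp]: "det (mk2 a b c d) = a * d - b * (c::'a::comm_ring_1)"
  by (simp add: det_2)

lemma mat_over_iff: "M \<in> mat_over A \<longleftrightarrow> (\<lambda>x. M x $ 1 $ 1) \<in> A \<and> (\<lambda>x. M x $ 1 $ 2) \<in> A \<and>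
    (\<lambda>x. M x $ 2 $ 1) \<in> A \<and> (\<lambda>x. M x $ 2 $ 2) \<in> A"
  by (auto simp: mat_over_def forall_2)

lemma units_of_fun_mult:
  assumes "fun_algebra A" "f \<in> units_of_fun A" "g \<in> units_of_fun A"
  shows "(\<lambda>x. f x * g x) \<in> units_of_fun A"
proof -
  interpret fun_algebra A by fact
  obtain f' g' where f: "f' \<in> A" "\<And>x. f x * f' x = 1" and g: "g' \<in> A" "\<And>x. g x * g' x = 1" and fg: "f \<in> A" "g \<in> A"
    using assms(2,3) by (auto simp: units_of_fun_def)
  have "f x * g x * (f' x * g' x) = (f x * f' x) * (g x * g' x)" for x by (simp only: mult_ac)
  then have "f x * g x * (f' x * g' x) = 1" for x using f g by simp
  then show ?thesis unfolding units_of_fun_def using f g fg by (auto intro!: bexI[of _ "\<lambda>x. f' x * g' x"])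
qed

lemma mat_over_mult:
  assumes "fun_algebra A" "M \<in> mat_over A" "N \<in> mat_over A"
  shows "(\<lambda>x. M x ** N x) \<in> mat_over A"
proof -
  interpret fun_algebra A by fact
  show ?thesis using assms(2,3) unfolding mat_over_iff matmul2 by auto
qed

lemma units_of_mat_mult:
  assumes "fun_algebra A" "M \<in> units_of_mat A" "N \<in> units_of_mat A"
  shows "(\<lambda>x. M x ** N x) \<in> units_of_mat A"
proof -
  obtain M' N' where M: "M' \<in> mat_over A" "\<And>x. M x ** M' x = mat 1" "\<And>x. M' x ** M x = mat 1" "M \<in> mat_over A"
    and N: "N' \<in> mat_over A" "\<And>x. N x ** N' x = mat 1" "\<And>x. N' x ** N x = mat 1" "N \<in> mat_over A"
    using assms(2,3) by (auto simp: units_of_mat_def)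
  have "(M x ** N x) ** (N' x ** M' x) = mat 1" for x
  proof -
    have "(M x ** N x) ** (N' x ** M' x) = M x ** ((N x ** N' x) ** M' x)" by (simp only: matrix_mul_assoc)
    then show ?thesis by (simp add: M N)
  qed
  moreover have "(N' x ** M' x) ** (M x ** N x) = mat 1" for x
  proof -
    have "(N' x ** M' x) ** (M x ** N x) = N' x ** ((M' x ** M x) ** N x)" by (simp only: matrix_mul_assoc)
    then show ?thesis by (simp add: M N)
  qed
  ultimately show ?thesis unfolding units_of_mat_def
    using mat_over_mult[OF assms(1)] M N by (auto intro!: bexI[of _ "\<lambda>x. N' x ** M' x"])
qed

text \<open>The inverse is the adjugate divided by the determinant.\<close>

lemma units_of_matI:
  assumes "fun_algebra A" "M \<in> mat_over A" "(\<lambda>x. det (M x)) \<in> units_of_fun A"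
  shows "M \<in> units_of_mat A"
proof -
  interpret fun_algebra A by fact
  obtain e where e: "e \<in> A" "\<And>x. det (M x) * e x = 1" using assms(3) by (auto simp: units_of_fun_def)
  define N where "N x = mk2 (e x * M x $ 2 $ 2) (- (e x * M x $ 1 $ 2)) (- (e x * M x $ 2 $ 1)) (e x * M x $ 1 $ 1)" for x
  have d: "(M x $ 1 $ 1 * M x $ 2 $ 2 - M x $ 1 $ 2 * M x $ 2 $ 1) * e x = 1" for x
    using e(2)[of x] by (simp add: det_2)
  have "N \<in> mat_over A" unfolding mat_over_iff N_def mk2_nth using e assms(2) by (auto simp: mat_over_iff)
  moreover have "M x ** N x = mat 1" for x
    unfolding mat2_eq_iff matmul2 mat1_mk2 N_def mk2_nth by (intro conjI; use d[of x] in \<open>simp add: algebra_simps\<close>)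
  moreover have "N x ** M x = mat 1" for x
    unfolding mat2_eq_iff matmul2 mat1_mk2 N_def mk2_nth by (intro conjI; use d[of x] in \<open>simp add: algebra_simps\<close>)
  ultimately show ?thesis unfolding units_of_mat_def using assms(2) by blast
qed

section \<open>Units coming from the disc algebra\<close>

lemma disc_algebra_inverse:
  assumes "\<Phi> \<in> disc_algebra" "\<And>z. norm z \<le> 1 \<Longrightarrow> \<Phi> z \<noteq> 0"
  shows "(\<lambda>z. inverse (\<Phi> z)) \<in> disc_algebra"
  using assms by (auto simp: disc_algebra_def intro!: continuous_intros holomorphic_intros)

lemma C_plusI:
  assumes "\<Phi> \<in> disc_algebra" "(\<lambda>x. \<Phi> (lam_ratio x)) \<in> C_hoelder \<mu>"
  shows "(\<lambda>x. \<Phi> (lam_ratio x)) \<in> C_plus \<mu>"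
  using H_inf_upper_disc[OF assms(1)] assms(2) by (simp add: C_plus_def)

lemma C_minusI:
  assumes "\<Phi> \<in> disc_algebra" "(\<lambda>x. \<Phi> (inverse (lam_ratio x))) \<in> C_hoelder \<mu>"
  shows "(\<lambda>x. \<Phi> (inverse (lam_ratio x))) \<in> C_minus \<mu>"
  using H_inf_lower_disc[OF assms(1)] assms(2) by (simp add: C_minus_def)

lemma C_plus_unitI:
  assumes "\<mu> > 0" "\<Phi> \<in> disc_algebra" "(\<lambda>x. \<Phi> (lam_ratio x)) \<in> C_hoelder \<mu>" "\<And>z. norm z \<le> 1 \<Longrightarrow> \<Phi> z \<noteq> 0"
  shows "(\<lambda>x. \<Phi> (lam_ratio x)) \<in> units_of_fun (C_plus \<mu>)"
proof -
  have nz: "\<Phi> (lam_ratio x) \<noteq> 0" for x using assms(4) by simp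
  have "(\<lambda>x. inverse (\<Phi> (lam_ratio x))) \<in> C_plus \<mu>"
    by (rule C_plusI[OF disc_algebra_inverse hoelder_inverse]) (use assms nz in auto)
  then show ?thesis unfolding units_of_fun_def using C_plusI[OF assms(2,3)] nz
    by (auto intro!: bexI[of _ "\<lambda>x. inverse (\<Phi> (lam_ratio x))"])
qed

lemma C_minus_unitI:
  assumes "\<mu> > 0" "\<Phi> \<in> disc_algebra" "(\<lambda>x. \<Phi> (inverse (lam_ratio x))) \<in> C_hoelder \<mu>" "\<And>z. norm z \<le> 1 \<Longrightarrow> \<Phi> z \<noteq> 0"
  shows "(\<lambda>x. \<Phi> (inverse (lam_ratio x))) \<in> units_of_fun (C_minus \<mu>)"
proof -
  have nz: "\<Phi> (inverse (lam_ratio x)) \<noteq> 0" for x using assms(4) by (simp add: norm_inverse)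
  have "(\<lambda>x. inverse (\<Phi> (inverse (lam_ratio x)))) \<in> C_minus \<mu>"
    by (rule C_minusI[OF disc_algebra_inverse hoelder_inverse]) (use assms nz in auto)
  then show ?thesis unfolding units_of_fun_def using C_minusI[OF assms(2,3)] nz
    by (auto intro!: bexI[of _ "\<lambda>x. inverse (\<Phi> (inverse (lam_ratio x)))"])
qed

lemma poly_disc_algebra: "poly p \<in> disc_algebra"
  by (auto simp: disc_algebra_def intro!: continuous_intros holomorphic_intros)

lemma poly_lam_hoelder:
  assumes "0 < \<mu>" "\<mu> \<le> 1"
  shows "(\<lambda>x. poly p (lam_ratio x)) \<in> C_hoelder \<mu>" "(\<lambda>x. poly p (inverse (lam_ratio x))) \<in> C_hoelder \<mu>"
  using fun_algebra.poly[OF fun_algebra_hoelder[OF assms(1)] hoelder_lam_ratio[OF assms]]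
    fun_algebra.poly[OF fun_algebra_hoelder[OF assms(1)] hoelder_inverse[OF hoelder_lam_ratio[OF assms] assms(1)]]
  by auto

lemma poly_lam_plus:
  assumes "0 < \<mu>" "\<mu> \<le> 1"
  shows "(\<lambda>x. poly p (lam_ratio x)) \<in> C_plus \<mu>" "(\<lambda>x. poly p (inverse (lam_ratio x))) \<in> C_minus \<mu>"
  using C_plusI[OF poly_disc_algebra poly_lam_hoelder(1)[OF assms]]
    C_minusI[OF poly_disc_algebra poly_lam_hoelder(2)[OF assms]] by auto

section \<open>Polynomial matrices\<close>

definition eval_mat :: "complex poly^2^2 \<Rightarrow> complex \<Rightarrow> complex^2^2" where
  "eval_mat P z = (\<chi> i j. poly (P $ i $ j) z)"

lemma eval_mat_nth [simp]: "eval_mat P z $ i $ j = poly (P $ i $ j) z"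
  by (simp add: eval_mat_def)

lemma eval_mat_mult: "eval_mat (P ** Q) z = eval_mat P z ** eval_mat Q z"
  by (simp add: mat2_eq_iff matmul2)

lemma det_eval_mat: "det (eval_mat P z) = poly (det P) z"
  by (simp add: det_2)

lemma det_matmul2: "det (P ** Q) = det P * det (Q :: 'a::comm_ring_1^2^2)"
  by (simp add: det_mul)

text \<open>Zeros of the determinant outside the disc are moved to the right factor one at a time: a kernel
  vector of \<open>P a\<close> becomes the first column of a constant matrix \<open>V\<close>, and then \<open>z - a\<close> divides the
  first column of \<open>P V\<close>.\<close>

lemma split_outer_zeros:
  fixes P :: "complex poly^2^2"
  assumes "det P \<noteq> 0" "\<And>z. norm z = 1 \<Longrightarrow> poly (det P) z \<noteq> 0"
  shows "\<exists>(P' :: complex poly^2^2) (X :: complex poly^2^2). P = P' ** X \<and> det P' \<noteq> 0 \<and> (\<forall>z. norm z \<ge> 1 \<longrightarrow> poly (det P') z \<noteq> 0) \<and>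
    (\<forall>z. norm z \<le> 1 \<longrightarrow> poly (det X) z \<noteq> 0)"
  using assms
proof (induction "degree (det P)" arbitrary: P rule: less_induct)
  case less
  show ?case
  proof (cases "\<exists>a. norm a > 1 \<and> poly (det P) a = 0")
    case False
    then have "poly (det P) z \<noteq> 0" if "norm z \<ge> 1" for z
      using less.prems(2)[of z] that by (cases "norm z = 1") force+
    then show ?thesis using less.prems(1) by (intro exI[of _ P] exI[of _ "mat 1"]) simp
  next
    case True
    then obtain a where a: "norm a > 1" "poly (det P) a = 0" by blast
    \<comment> \<open>a constant column operation makes the first column of \<open>P\<close> vanish at \<open>a\<close>\<close>
    have "\<exists>v w. (v \<noteq> 0 \<or> w \<noteq> 0) \<and> poly (P $ 1 $ 1) a * v + poly (P $ 1 $ 2) a * w = 0 \<and>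
        poly (P $ 2 $ 1) a * v + poly (P $ 2 $ 2) a * w = 0"
    proof -
      have d: "poly (P $ 1 $ 1) a * poly (P $ 2 $ 2) a - poly (P $ 1 $ 2) a * poly (P $ 2 $ 1) a = 0"
        using a(2) by (simp add: det_2)
      show ?thesis
      proof (cases "poly (P $ 1 $ 1) a = 0 \<and> poly (P $ 1 $ 2) a = 0")
        case True
        show ?thesis
        proof (cases "poly (P $ 2 $ 1) a = 0 \<and> poly (P $ 2 $ 2) a = 0")
          case True with \<open>poly (P $ 1 $ 1) a = 0 \<and> poly (P $ 1 $ 2) a = 0\<close> show ?thesis
            by (intro exI[of _ 1] exI[of _ 0]) simp
        next
          case False with True show ?thesis
            by (intro exI[of _ "poly (P $ 2 $ 2) a"] exI[of _ "- poly (P $ 2 $ 1) a"]) (auto simp: algebra_simps)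
        qed
      next
        case False with d show ?thesis
          by (intro exI[of _ "poly (P $ 1 $ 2) a"] exI[of _ "- poly (P $ 1 $ 1) a"]) (auto simp: algebra_simps)
      qed
    qed
    then obtain v w where vw: "v \<noteq> 0 \<or> w \<noteq> 0" "poly (P $ 1 $ 1) a * v + poly (P $ 1 $ 2) a * w = 0"
      "poly (P $ 2 $ 1) a * v + poly (P $ 2 $ 2) a * w = 0" by blast
    \<comment> \<open>the kernel vector \<open>(v, w)\<close> is completed to a matrix of determinant 1\<close>
    obtain s t where st: "v * t - s * w = 1"
    proof (cases "v = 0")
      case True then show ?thesis using vw(1) that[of "0" "- 1 / w"] that[of "- 1 / w" 0] by simp
    next
      case False then show ?thesis using that[of "1 / v" 0] by simp
    qed
    define V where "V = mk2 [:v:] [:s:] [:w:] [:t:]"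
    define V' where "V' = mk2 [:t:] [:-s:] [:-w:] [:v:]"
    have VV': "V ** V' = mat 1" using st
      by (simp add: V_def V'_def mk2_mult mat1_mk2 mat2_eq_iff algebra_simps pCons_one)
    have "[:- a, 1:] dvd (P ** V) $ i $ 1" for i
      using vw(2,3) exhaust_2[of i] by (auto simp: poly_eq_0_iff_dvd[symmetric] matmul2 V_def algebra_simps)
    then have "\<forall>i. \<exists>r. (P ** V) $ i $ 1 = [:- a, 1:] * r" unfolding dvd_def by blast
    from choice[OF this] obtain r where r: "(P ** V) $ i $ 1 = [:- a, 1:] * r i" for i by blast
    define P1 where "P1 = mk2 (r 1) ((P ** V) $ 1 $ 2) (r 2) ((P ** V) $ 2 $ 2)"
    define T where "T = mk2 [:- a, 1:] 0 0 1"
    have PV: "P ** V = P1 ** T" unfolding mat2_eq_iff matmul2[of P1 T]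
      by (simp add: P1_def T_def r mult.commute)
    have P: "P = P1 ** (T ** V')"
    proof -
      have "P = P ** (V ** V')" by (simp add: VV')
      then show ?thesis using PV by (simp add: matrix_mul_assoc)
    qed
    have dTV: "det (T ** V') = [:- a, 1:]"
      using st by (simp add: det_matmul2 T_def V'_def algebra_simps)
    have dP: "det P = det P1 * [:- a, 1:]" using P dTV det_matmul2 by metis
    have dP1: "det P1 \<noteq> 0" using dP less.prems(1) by auto
    have "degree (det P1) < degree (det P)" unfolding dP using dP1 by (subst degree_mult_eq) auto
    moreover have "poly (det P1) z \<noteq> 0" if "norm z = 1" for z using less.prems(2)[OF that] dP by auto
    ultimately obtain P' X where PX: "P1 = P' ** X" "det P' \<noteq> 0" "\<forall>z. norm z \<ge> 1 \<longrightarrow> poly (det P') z \<noteq> 0"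
      "\<forall>z. norm z \<le> 1 \<longrightarrow> poly (det X) z \<noteq> 0" using less.hyps dP1 by metis
    have "P = P' ** (X ** (T ** V'))" using P PX(1) by (simp only: matrix_mul_assoc)
    moreover have "poly (det (X ** (T ** V'))) z \<noteq> 0" if "norm z \<le> 1" for z
      unfolding det_matmul2[of X] dTV using PX(4) that a(1) by auto
    ultimately show ?thesis using PX(2,3) by blast
  qed
qed

text \<open>The determinant of the matrix of leading column coefficients, for column degrees \<open>k\<close> and \<open>l\<close>.\<close>

definition col_lead :: "complex poly^2^2 \<Rightarrow> nat \<Rightarrow> nat \<Rightarrow> complex" where
  "col_lead P k l = coeff (P $ 1 $ 1) k * coeff (P $ 2 $ 2) l - coeff (P $ 1 $ 2) l * coeff (P $ 2 $ 1) k"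

definition col_bound :: "complex poly^2^2 \<Rightarrow> nat \<Rightarrow> nat \<Rightarrow> bool" where
  "col_bound P k l \<longleftrightarrow> (\<forall>i. degree (P $ i $ 1) \<le> k \<and> degree (P $ i $ 2) \<le> l)"

definition const_det :: "complex poly^2^2 \<Rightarrow> bool" where
  "const_det U \<longleftrightarrow> (\<exists>c. c \<noteq> 0 \<and> det U = [:c:])"

lemma const_det_one: "const_det (mat 1)"
  unfolding const_det_def by (intro exI[of _ 1]) (simp add: pCons_one)

lemma degree_drop:
  assumes "degree p \<le> k" "coeff p k = 0" "p \<noteq> 0"
  shows "0 < k" "degree p \<le> k - 1"
proof -
  have "degree p \<noteq> k" using assms by (metis leading_coeff_0_iff)
  then show "0 < k" "degree p \<le> k - 1" using assms(1) by auto
qed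

lemma degree_drop':
  assumes "degree p \<le> k" "coeff p k = 0"
  shows "degree p \<le> k - 1"
  using degree_drop[OF assms] by (cases "p = 0") auto

text \<open>If the leading columns are dependent, a unimodular column operation lowers a column degree.  It
  acts on the column of larger degree, hence \<open>l \<le> k\<close>.\<close>

lemma column_reduction_step:
  assumes "det P \<noteq> 0" "col_bound P k l" "l \<le> k" "col_lead P k l = 0"
  shows "\<exists>U k' l'. const_det U \<and> col_bound (P ** U) k' l' \<and> k' + l' < k + l"
proof (cases "coeff (P $ 1 $ 2) l = 0 \<and> coeff (P $ 2 $ 2) l = 0")
  case True
  have deg: "degree (P $ i $ 2) \<le> l" for i using assms(2) by (auto simp: col_bound_def)
  have c0: "coeff (P $ i $ 2) l = 0" for i using True exhaust_2[of i] by auto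
  have "P $ 1 $ 2 \<noteq> 0 \<or> P $ 2 $ 2 \<noteq> 0" using assms(1) by (auto simp: det_2)
  then have "0 < l" using degree_drop(1)[OF deg c0] by blast
  moreover have "col_bound (P ** mat 1) k (l - 1)"
    using assms(2) degree_drop'[OF deg c0] by (simp add: col_bound_def)
  ultimately show ?thesis
    by (intro exI[of _ "mat 1"] exI[of _ k] exI[of _ "l - 1"])
      (auto simp: const_det_one)
next
  case False
  \<comment> \<open>the leading first column is a multiple \<open>c\<close> of the leading second column\<close>
  obtain c where c: "coeff (P $ i $ 1) k = c * coeff (P $ i $ 2) l" for i
  proof -
    have e: "coeff (P $ 1 $ 1) k * coeff (P $ 2 $ 2) l = coeff (P $ 1 $ 2) l * coeff (P $ 2 $ 1) k"
      using assms(4) by (simp add: col_lead_def)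
    show ?thesis
    proof (cases "coeff (P $ 1 $ 2) l = 0")
      case True
      then have "coeff (P $ 2 $ 2) l \<noteq> 0" using False by simp
      then have "coeff (P $ i $ 1) k = coeff (P $ 2 $ 1) k / coeff (P $ 2 $ 2) l * coeff (P $ i $ 2) l" for i
        using e True exhaust_2[of i] by auto
      then show ?thesis using that by blast
    next
      case False
      have "coeff (P $ i $ 1) k = coeff (P $ 1 $ 1) k / coeff (P $ 1 $ 2) l * coeff (P $ i $ 2) l" for i
        using e False exhaust_2[of i] by (auto simp: field_simps)
      then show ?thesis using that by blast
    qed
  qed
  \<comment> \<open>subtract \<open>c z\<^sup>k\<^sup>-\<^sup>l\<close> times the second column from the first\<close>
  define U where "U = mk2 1 0 (monom (- c) (k - l)) (1 :: complex poly)"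
  have dU: "det U = 1" by (simp add: U_def)
  have col1: "(P ** U) $ i $ 1 = P $ i $ 1 + monom (- c) (k - l) * P $ i $ 2" for i
    by (simp add: matmul2 U_def mult.commute)
  have col2: "(P ** U) $ i $ 2 = P $ i $ 2" for i by (simp add: matmul2 U_def)
  have deg1: "degree ((P ** U) $ i $ 1) \<le> k" for i
  proof -
    have "degree (monom (- c) (k - l) * P $ i $ 2) \<le> (k - l) + l"
      using assms(2) by (intro order_trans[OF degree_mult_le] add_mono degree_monom_le) (auto simp: col_bound_def)
    then show ?thesis unfolding col1 using assms(2,3) by (intro degree_add_le) (auto simp: col_bound_def)
  qed
  have co1: "coeff ((P ** U) $ i $ 1) k = 0" for i
    unfolding col1 using c[of i] assms(3) by (simp add: coeff_monom_mult)
  have "det (P ** U) \<noteq> 0" using assms(1) dU by (simp add: det_matmul2)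
  then have "(P ** U) $ 1 $ 1 \<noteq> 0 \<or> (P ** U) $ 2 $ 1 \<noteq> 0" by (auto simp: det_2)
  then have "0 < k" using degree_drop(1)[OF deg1 co1] by blast
  moreover have "col_bound (P ** U) (k - 1) l"
    unfolding col_bound_def using degree_drop'[OF deg1 co1] assms(2) by (auto simp: col2 col_bound_def)
  ultimately show ?thesis using dU
    by (intro exI[of _ U] exI[of _ "k - 1"] exI[of _ l]) (auto simp: const_det_def pCons_one intro!: exI[of _ 1])
qed

lemma const_det_mult: "const_det U \<Longrightarrow> const_det V \<Longrightarrow> const_det (U ** V)"
  by (auto simp: const_det_def det_matmul2)

lemma const_det_nonzero: "const_det U \<Longrightarrow> det U \<noteq> 0"
  by (auto simp: const_det_def)

text \<open>A column of degree bound 0 cannot be lowered further, as the determinant is not zero; so the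
  process ends, with independent leading columns.\<close>

lemma column_reduction:
  assumes "det P \<noteq> 0" "col_bound P k l"
  shows "\<exists>U k' l'. const_det U \<and> col_bound (P ** U) k' l' \<and> col_lead (P ** U) k' l' \<noteq> 0"
  using assms
proof (induction "k + l" arbitrary: P k l rule: less_induct)
  case less
  show ?case
  proof (cases "col_lead P k l = 0")
    case False
    then show ?thesis using less.prems
      by (intro exI[of _ "mat 1"] exI[of _ k] exI[of _ l]) (auto simp: const_det_one)
  next
    case True
    define S where "S = mk2 0 1 1 (0 :: complex poly)"
    have S: "const_det S" by (auto simp: const_det_def S_def one_pCons intro!: exI[of _ "-1"])
    have PS: "(P ** S) $ i $ 1 = P $ i $ 2" "(P ** S) $ i $ 2 = P $ i $ 1" for i
      by (simp_all add: matmul2 S_def)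
    obtain U k' l' where U: "const_det U" "col_bound (P ** U) k' l'" "k' + l' < k + l"
    proof (cases "l \<le> k")
      case True
      then show ?thesis using column_reduction_step[OF less.prems _ \<open>col_lead P k l = 0\<close>] that by blast
    next
      case False
      have "det (P ** S) \<noteq> 0" using less.prems(1) const_det_nonzero[OF S] by (simp add: det_matmul2)
      moreover have "col_bound (P ** S) l k" using less.prems(2) by (simp add: col_bound_def PS)
      moreover have "col_lead (P ** S) l k = 0" using True unfolding col_lead_def PS by (simp add: algebra_simps)
      ultimately obtain U k' l' where "const_det U" "col_bound ((P ** S) ** U) k' l'" "k' + l' < l + k"
        using column_reduction_step[of "P ** S" l k] False by (meson nat_le_linear)
      then show ?thesis using that[of "S ** U" k' l'] const_det_mult[OF S] by (simp add: matrix_mul_assoc)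
    qed
    have "det (P ** U) \<noteq> 0" using less.prems(1) const_det_nonzero[OF U(1)] by (simp add: det_matmul2)
    from less.hyps[OF U(3) this U(2)] obtain U2 a b where "const_det U2"
      "col_bound ((P ** U) ** U2) a b" "col_lead ((P ** U) ** U2) a b \<noteq> 0" by blast
    then show ?thesis using const_det_mult[OF U(1)] by (metis matrix_mul_assoc)
  qed
qed

text \<open>The reversed polynomial \<open>w ^ k * p (1 / w)\<close>.\<close>

definition flip_poly :: "nat \<Rightarrow> complex poly \<Rightarrow> complex poly" where
  "flip_poly k p = (\<Sum>j\<le>k. monom (coeff p j) (k - j))"

lemma poly_flip_poly:
  assumes "degree p \<le> k" "w \<noteq> 0"
  shows "poly (flip_poly k p) w = w ^ k * poly p (inverse w)"
proof -
  have "poly (flip_poly k p) w = (\<Sum>j\<le>k. w ^ k * (coeff p j * inverse w ^ j))"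
    unfolding flip_poly_def poly_sum poly_monom
  proof (rule sum.cong)
    fix j assume "j \<in> {..k}"
    then have "w ^ k = w ^ (k - j) * w ^ j" by (simp flip: power_add)
    then show "coeff p j * w ^ (k - j) = w ^ k * (coeff p j * inverse w ^ j)"
      using assms(2) by (simp add: field_simps)
  qed simp
  also have "\<dots> = w ^ k * poly p (inverse w)"
  proof -
    have "poly p (inverse w) = poly (\<Sum>j\<le>k. monom (coeff p j) j) (inverse w)"
      by (simp add: poly_as_sum_of_monoms'[OF assms(1)])
    then show ?thesis by (simp add: poly_sum poly_monom sum_distrib_left)
  qed
  finally show ?thesis .
qed

lemma poly_flip_poly_0: "poly (flip_poly k p) 0 = coeff p k"
proof -
  have "poly (flip_poly k p) 0 = (\<Sum>j\<le>k. if j = k then coeff p k else 0)"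
    unfolding flip_poly_def poly_sum poly_monom by (rule sum.cong) auto
  then show ?thesis by simp
qed

text \<open>Once the determinant of the remaining factor has its zeros in the open disc and its columns are
  reduced with degrees \<open>k\<close> and \<open>l\<close>, division of the columns by \<open>z ^ k\<close> and \<open>z ^ l\<close> leaves a polynomial
  in \<open>1/z\<close>.  Its determinant does not vanish for \<open>|z| \<ge> 1\<close>, and at infinity it is the determinant of
  the leading coefficients.\<close>

theorem polynomial_matrix_factorization:
  assumes \<mu>: "0 < \<mu>" "\<mu> \<le> 1" and P: "\<And>z. norm z = 1 \<Longrightarrow> poly (det P) z \<noteq> 0"
  obtains Gm Gp and k l :: nat where "Gm \<in> units_of_mat (C_minus \<mu>)" "Gp \<in> units_of_mat (C_plus \<mu>)"
    "\<And>x. eval_mat P (lam_ratio x) = Gm x ** mk2 (lam_ratio x ^ k) 0 0 (lam_ratio x ^ l) ** Gp x"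
proof -
  have "det P \<noteq> 0" using P[of 1] by auto
  then obtain P1 X where X: "P = P1 ** X" "det P1 \<noteq> 0" "\<And>z. norm z \<ge> 1 \<Longrightarrow> poly (det P1) z \<noteq> 0"
    "\<And>z. norm z \<le> 1 \<Longrightarrow> poly (det X) z \<noteq> 0" using split_outer_zeros[of P] P by metis
  have "\<exists>n. col_bound P1 n n"
    by (intro exI[of _ "degree (P1 $ 1 $ 1) + degree (P1 $ 1 $ 2) + degree (P1 $ 2 $ 1) + degree (P1 $ 2 $ 2)"])
      (auto simp: col_bound_def forall_2)
  then obtain U k l where U: "const_det U" "col_bound (P1 ** U) k l" "col_lead (P1 ** U) k l \<noteq> 0"
    using column_reduction[OF X(2)] by blast
  define R where "R = P1 ** U"
  obtain c where c: "c \<noteq> 0" "det U = [:c:]" using U(1) by (auto simp: const_det_def)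
  define U' where "U' = mk2 (smult (inverse c) (U $ 2 $ 2)) (- smult (inverse c) (U $ 1 $ 2)) (- smult (inverse c) (U $ 2 $ 1)) (smult (inverse c) (U $ 1 $ 1))"
  have UU': "U ** U' = mat 1"
  proof -
    have "U $ 1 $ 1 * U $ 2 $ 2 - U $ 1 $ 2 * U $ 2 $ 1 = [:c:]" using c(2) by (simp add: det_2)
    then have "smult (inverse c) (U $ 1 $ 1 * U $ 2 $ 2 - U $ 1 $ 2 * U $ 2 $ 1) = 1" using c(1) by (simp add: one_pCons)
    then show ?thesis unfolding mat2_eq_iff matmul2 mat1_mk2 U'_def mk2_nth
      by (simp add: smult_diff_right mult.commute)
  qed
  have dU': "det U * det U' = 1" using UU' by (metis det_I det_matmul2)
  define Y where "Y = U' ** X"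
  have PRY: "P = R ** Y"
  proof -
    have "R ** Y = P1 ** ((U ** U') ** X)" unfolding R_def Y_def by (simp only: matrix_mul_assoc)
    then show ?thesis using X(1) UU' by simp
  qed
  have dY: "poly (det Y) z \<noteq> 0" if "norm z \<le> 1" for z
    using X(4)[OF that] dU' unfolding Y_def det_matmul2 by (metis mult_eq_0_iff poly_1 poly_mult zero_neq_one)
  define Gp where "Gp x = eval_mat Y (lam_ratio x)" for x
  have Gp: "Gp \<in> units_of_mat (C_plus \<mu>)"
  proof (rule units_of_matI[OF fun_algebra_C_plus[OF \<mu>(1)]])
    show "Gp \<in> mat_over (C_plus \<mu>)" using poly_lam_plus(1)[OF \<mu>] by (simp add: Gp_def mat_over_iff)
    show "(\<lambda>x. det (Gp x)) \<in> units_of_fun (C_plus \<mu>)" unfolding Gp_def det_eval_mat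
      by (rule C_plus_unitI[OF \<mu>(1) poly_disc_algebra poly_lam_hoelder(1)[OF \<mu>] dY])
  qed
  define N where "N = mk2 (flip_poly k (R $ 1 $ 1)) (flip_poly l (R $ 1 $ 2)) (flip_poly k (R $ 2 $ 1)) (flip_poly l (R $ 2 $ 2))"
  have deg: "degree (R $ i $ 1) \<le> k" "degree (R $ i $ 2) \<le> l" for i using U(2) by (auto simp: R_def col_bound_def)
  have evN: "eval_mat N w = eval_mat R (inverse w) ** mk2 (w ^ k) 0 0 (w ^ l)" if "w \<noteq> 0" for w
    using that deg by (simp add: mat2_eq_iff matmul2 N_def poly_flip_poly mult.commute)
  define Gm where "Gm x = eval_mat N (inverse (lam_ratio x))" for x
  have dN: "poly (det N) w \<noteq> 0" if "norm w \<le> 1" for w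
  proof (cases "w = 0")
    case True
    have "poly (det N) 0 = col_lead R k l" by (simp add: det_2 N_def poly_flip_poly_0 col_lead_def)
    then show ?thesis using True U(3) by (simp add: R_def)
  next
    case False
    have "norm (inverse w) \<ge> 1" using that False by (simp add: norm_inverse one_le_inverse)
    then have "poly (det R) (inverse w) \<noteq> 0"
      using X(3) c by (simp add: R_def det_matmul2)
    then show ?thesis
      using False unfolding det_eval_mat[symmetric] evN[OF False] det_matmul2 by simp
  qed
  have Gm: "Gm \<in> units_of_mat (C_minus \<mu>)"
  proof (rule units_of_matI[OF fun_algebra_C_minus[OF \<mu>(1)]])
    show "Gm \<in> mat_over (C_minus \<mu>)" using poly_lam_plus(2)[OF \<mu>] by (simp add: Gm_def mat_over_iff)
    show "(\<lambda>x. det (Gm x)) \<in> units_of_fun (C_minus \<mu>)" unfolding Gm_def det_eval_mat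
      by (rule C_minus_unitI[OF \<mu>(1) poly_disc_algebra poly_lam_hoelder(2)[OF \<mu>] dN])
  qed
  have "eval_mat P (lam_ratio x) = Gm x ** mk2 (lam_ratio x ^ k) 0 0 (lam_ratio x ^ l) ** Gp x" for x
  proof -
    let ?z = "lam_ratio x"
    have "mk2 (inverse ?z ^ k) 0 0 (inverse ?z ^ l) ** mk2 (?z ^ k) 0 0 (?z ^ l) = mat 1"
      by (simp add: mk2_mult mat1_mk2 flip: power_mult_distrib)
    then have "Gm x ** mk2 (?z ^ k) 0 0 (?z ^ l) = eval_mat R ?z"
      unfolding Gm_def by (subst evN) (simp_all flip: matrix_mul_assoc)
    then show ?thesis unfolding PRY eval_mat_mult Gp_def by simp
  qed
  then show ?thesis using that Gm Gp by blast
qed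

section \<open>No square root at a simple zero\<close>

text \<open>The order of vanishing at \<open>a\<close> is even on the left and odd on the right.\<close>

lemma no_square_root_at_simple_zero:
  assumes S: "open S" "connected S" "a \<in> S"
    and holo: "F holomorphic_on S" "H holomorphic_on S" "v holomorphic_on S" and "v a \<noteq> 0"
    and eq: "\<And>z. z \<in> S \<Longrightarrow> F z ^ 2 = (z - a) * v z * H z ^ 2" and z: "z \<in> S"
  shows "F z = 0" "H z = 0"
proof -
  have H0: "H w = 0" if w: "w \<in> S" for w
  proof (rule ccontr)
    assume "H w \<noteq> 0"
    have evH: "\<forall>\<^sub>F z in at a. H z \<noteq> 0 \<and> z \<in> S"
      by (rule non_zero_neighbour_alt[OF holo(2) S w \<open>H w \<noteq> 0\<close>])
    have "\<forall>\<^sub>F z in at a. v z \<noteq> 0 \<and> z \<in> S"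
      by (rule non_zero_neighbour_alt[OF holo(3) S S(3) \<open>v a \<noteq> 0\<close>])
    with evH have evW: "\<forall>\<^sub>F z in at a. (z - a) * v z * H z ^ 2 \<noteq> 0 \<and> z \<in> S"
      using eventually_neq_at_within[of a a UNIV] by eventually_elim auto
    then have evF: "\<forall>\<^sub>F z in at a. F z ^ 2 \<noteq> 0" by eventually_elim (use eq in auto)
    have an: "F analytic_on {a}" "H analytic_on {a}" "v analytic_on {a}"
      using holo S analytic_at by blast+
    have "zorder (\<lambda>z. F z ^ 2) a = 2 * zorder F a"
      by (subst zorder_power) (use evF an in \<open>auto intro!: analytic_on_imp_meromorphic_on eventually_frequently elim: eventually_mono\<close>)
    moreover have "zorder (\<lambda>z. F z ^ 2) a = zorder (\<lambda>z. (z - a) * v z * H z ^ 2) a"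
    proof (rule zorder_cong)
      show "\<forall>\<^sub>F z in at a. F z ^ 2 = (z - a) * v z * H z ^ 2"
        using eventually_at_in_open'[OF S(1,3)] by eventually_elim (use eq in auto)
    qed simp
    moreover have "zorder (\<lambda>z. (z - a) * v z * H z ^ 2) a = zorder (\<lambda>z. (z - a) * v z) a + zorder (\<lambda>z. H z ^ 2) a"
      by (rule zorder_times_analytic) (use an evW in \<open>auto intro!: analytic_intros elim: eventually_mono\<close>)
    moreover have "zorder (\<lambda>z. H z ^ 2) a = 2 * zorder H a"
      by (subst zorder_power) (use evH an in \<open>auto intro!: analytic_on_imp_meromorphic_on eventually_frequently elim: eventually_mono\<close>)
    moreover have "zorder (\<lambda>z. (z - a) * v z) a = 1"
      by (rule zorder_eqI[OF S(1,3) holo(3) \<open>v a \<noteq> 0\<close>]) (simp add: mult.commute)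
    ultimately have "2 * zorder F a = 1 + 2 * zorder H a" by simp
    then show False by presburger
  qed
  then show "H z = 0" using z .
  then show "F z = 0" using eq[OF z] by simp
qed

section \<open>The symbol in the disc coordinate\<close>

text \<open>The image of \<open>i k0\<close> under the Cayley map, which sends the other branch point \<open>i\<close> of the upper half
  of the surface to 0.\<close>

definition kap :: "real \<Rightarrow> complex" where
  "kap k0 = complex_of_real ((k0 - 1) / (k0 + 1))"

lemma kap_bounds:
  assumes "k0 > 1" shows "norm (kap k0) < 1" "kap k0 \<noteq> 0"
  using assms by (auto simp: kap_def norm_divide simp del: of_real_divide)

lemma one_minus_kap_nonzero:
  assumes "k0 > 1" "norm z \<le> 1" shows "1 - kap k0 * z \<noteq> 0"
proof
  assume "1 - kap k0 * z = 0"
  then have "norm (kap k0 * z) = 1" by (metis eq_iff_diff_eq_0 norm_one)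
  moreover have "norm (kap k0 * z) \<le> norm (kap k0) * 1" unfolding norm_mult using assms(2) by (intro mult_left_mono) auto
  ultimately show False using kap_bounds(1)[OF assms(1)] by simp
qed

lemma minus_kap_nonzero: "k0 > 1 \<Longrightarrow> norm z = 1 \<Longrightarrow> z - kap k0 \<noteq> 0"
  using kap_bounds[of k0] by auto

lemma cayley_kap:
  assumes "k0 > 1" "\<xi> + \<i> \<noteq> 0"
  shows "1 - kap k0 * cayley \<xi> = 2 / complex_of_real (k0 + 1) * ((\<xi> + \<i> * complex_of_real k0) / (\<xi> + \<i>))"
    "cayley \<xi> - kap k0 = 2 / complex_of_real (k0 + 1) * ((\<xi> - \<i> * complex_of_real k0) / (\<xi> + \<i>))"
proof -
  have nz: "complex_of_real k0 + 1 \<noteq> 0" using assms(1)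
    by (metis add.commute add_pos_pos of_real_1 of_real_add of_real_eq_0_iff less_numeral_extra(3) less_trans zero_less_one)
  show "1 - kap k0 * cayley \<xi> = 2 / complex_of_real (k0 + 1) * ((\<xi> + \<i> * complex_of_real k0) / (\<xi> + \<i>))"
    using nz assms(2) by (simp add: kap_def cayley_def divide_simps) (simp add: algebra_simps)
  show "cayley \<xi> - kap k0 = 2 / complex_of_real (k0 + 1) * ((\<xi> - \<i> * complex_of_real k0) / (\<xi> + \<i>))"
    using nz assms(2) by (simp add: kap_def cayley_def divide_simps) (simp add: algebra_simps)
qed

lemma cayley_q:
  assumes "k0 > 1" "\<xi> + \<i> \<noteq> 0"
  shows "p1 k0 \<xi> / p2 k0 \<xi> = (1 - kap k0 * cayley \<xi>) / (cayley \<xi> * (cayley \<xi> - kap k0))"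
proof -
  have "complex_of_real (k0 + 1) \<noteq> 0" using assms(1) by (simp del: of_real_add)
  then show ?thesis unfolding cayley_kap[OF assms] unfolding p1_def p2_def cayley_def
    using assms(2) by (simp add: divide_simps del: of_real_add) (simp add: algebra_simps)
qed

text \<open>In the disc coordinate \<open>q\<close> has the poles 0 and \<open>kap\<close>, both inside the disc.\<close>

lemma q_lam_ratio:
  assumes "k0 > 1"
  shows "q_fun k0 x = (1 - kap k0 * lam_ratio x) / (lam_ratio x * (lam_ratio x - kap k0))"
proof (cases x)
  case None
  then show ?thesis using minus_kap_nonzero[OF assms, of 1] by (simp add: q_fun_def lam_ratio_def)
next
  case (Some r)
  show ?thesis unfolding Some lam_ratio_Some cayley_q[OF assms lam_ratio_denom(1), symmetric]
    by (simp add: q_fun_def)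
qed

text \<open>The function \<open>1/lam_ratio\<close> continues to the lower half-plane with a zero at \<open>-i\<close>.\<close>

lemma plus_eq_inverse_lam_minus:
  assumes "\<mu> > 0" "f \<in> C_plus \<mu>" "h \<in> C_minus \<mu>" "\<And>x. f x = inverse (lam_ratio x) * h x"
  shows "f x = 0"
proof (rule H_inf_upper_lower[of f h \<mu> "\<lambda>\<xi>. (\<xi> + \<i>) / (\<xi> - \<i>)" 1 "- \<i>"])
  show "f \<in> H_inf upper" "f \<in> C_hoelder \<mu>" using assms(2) by (auto simp: C_plus_def)
  show "h \<in> H_inf lower" using assms(3) by (simp add: C_minus_def)
  show "(\<lambda>\<xi>. (\<xi> + \<i>) / (\<xi> - \<i>)) holomorphic_on lower"
    by (intro holomorphic_intros) (auto simp: lower_def)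
  show "norm ((\<xi> + \<i>) / (\<xi> - \<i>)) \<le> 1" if "\<xi> \<in> lower" for \<xi>
    using norm_inverse_cayley_less[of \<xi>] that by (simp add: cayley_def lower_def)
  show "isCont (\<lambda>\<xi>. (\<xi> + \<i>) / (\<xi> - \<i>)) (complex_of_real x)" for x
    using lam_ratio_denom[of x] by (intro continuous_intros) auto
  show "f (Some x) = (complex_of_real x + \<i>) / (complex_of_real x - \<i>) * h (Some x)" for x
    unfolding assms(4) by (simp add: lam_ratio_def)
qed (use assms in \<open>auto simp: lower_def\<close>)

section \<open>Triviality of the vector problem\<close>

lemma vec2_eq_iff:
  fixes v w :: "'a^2"
  shows "v = w \<longleftrightarrow> v $ 1 = w $ 1 \<and> v $ 2 = w $ 2"
  by (simp add: vec_eq_iff forall_2)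

lemma matvec2:
  fixes M :: "'a::semiring_1^2^2"
  shows "(M *v v) $ i = M $ i $ 1 * v $ 1 + M $ i $ 2 * v $ 2"
  by (simp add: matrix_vector_mult_def sum_2)

text \<open>The discriminant of the form has a simple zero at the branch point \<open>i\<close> of the surface, so it has no
  analytic square root in the upper half-plane: the norm form of the double cover represents zero
  only trivially.\<close>

lemma quadratic_form_anisotropic:
  assumes k0: "k0 > 1" and \<mu>: "0 < \<mu>" and f: "f \<in> C_plus \<mu>" "h \<in> C_plus \<mu>"
    and eq: "\<And>x. (1 - kap k0 * lam_ratio x) * f x ^ 2 = lam_ratio x * (lam_ratio x - kap k0) * h x ^ 2"
  shows "f x = 0" "h x = 0"
proof -
  let ?\<kappa> = "kap k0"
  have Hi: "f \<in> H_inf upper" "h \<in> H_inf upper" "f \<in> C_hoelder \<mu>" "h \<in> C_hoelder \<mu>"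
    using f by (auto simp: C_plus_def)
  obtain F A where F: "F holomorphic_on upper" "\<And>z. z \<in> upper \<Longrightarrow> norm (F z) \<le> A"
    "AE x in lborel. ((\<lambda>e. F (Complex x e)) \<longlongrightarrow> f (Some x)) (at_right 0)"
    by (rule H_inf_upper_vertical[OF Hi(1)]) blast
  obtain H B where H: "H holomorphic_on upper" "\<And>z. z \<in> upper \<Longrightarrow> norm (H z) \<le> B"
    "AE x in lborel. ((\<lambda>e. H (Complex x e)) \<longlongrightarrow> h (Some x)) (at_right 0)"
    by (rule H_inf_upper_vertical[OF Hi(2)]) blast
  define E where "E \<xi> = (1 - ?\<kappa> * cayley \<xi>) * F \<xi> ^ 2 - cayley \<xi> * (cayley \<xi> - ?\<kappa>) * H \<xi> ^ 2" for \<xi>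
  have hc: "cayley holomorphic_on upper" by (rule holomorphic_on_subset[OF holomorphic_cayley]) (auto simp: upper_def)
  have E0: "E \<xi> = 0" if "\<xi> \<in> upper" for \<xi>
  proof (rule zero_if_zero_boundary_values[OF _ _ _ that])
    show "E holomorphic_on upper" unfolding E_def by (intro holomorphic_intros hc F H)
    show "norm (E z) \<le> 2 * A ^ 2 + 2 * B ^ 2" if u: "z \<in> upper" for z
    proof -
      have c1: "norm (cayley z) \<le> 1" using norm_cayley_less[of z] u by (simp add: upper_def)
      have k1: "norm ?\<kappa> \<le> 1" using kap_bounds[OF k0] by simp
      have kc: "norm (?\<kappa> * cayley z) \<le> 1" unfolding norm_mult using k1 c1 by (intro mult_le_one) auto
      have n1: "norm (1 - ?\<kappa> * cayley z) \<le> 2"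
        using norm_triangle_ineq4[of 1 "?\<kappa> * cayley z"] kc by simp
      have n2: "norm (cayley z * (cayley z - ?\<kappa>)) \<le> 1 * 2"
        unfolding norm_mult using norm_triangle_ineq4[of "cayley z" ?\<kappa>] c1 k1 by (intro mult_mono) auto
      have n3: "norm (F z ^ 2) \<le> A ^ 2" "norm (H z ^ 2) \<le> B ^ 2"
        using F(2)[OF u] H(2)[OF u] by (simp_all add: norm_power power_mono)
      have "norm ((1 - ?\<kappa> * cayley z) * F z ^ 2) \<le> 2 * A ^ 2"
        unfolding norm_mult[of "1 - ?\<kappa> * cayley z"] by (rule mult_mono[OF n1 n3(1)]) auto
      moreover have "norm (cayley z * (cayley z - ?\<kappa>) * H z ^ 2) \<le> 2 * B ^ 2"
        unfolding norm_mult[of "cayley z * (cayley z - ?\<kappa>)"] using n2 by (intro mult_mono n3(2)) auto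
      ultimately show ?thesis unfolding E_def
        using norm_triangle_ineq4 order_trans add_mono by meson
    qed
    show "AE x in lborel. ((\<lambda>e. E (Complex x e)) \<longlongrightarrow> 0) (at_right 0)"
      using F(3) H(3)
    proof eventually_elim
      case (elim x)
      have "((\<lambda>e. Complex x e) \<longlongrightarrow> Complex x 0) (at_right 0)" by (intro tendsto_intros tendsto_Complex)
      then have "((\<lambda>e. Complex x e) \<longlongrightarrow> complex_of_real x) (at_right 0)" by (simp add: complex_of_real_def)
      then have "((\<lambda>e. cayley (Complex x e)) \<longlongrightarrow> lam_ratio (Some x)) (at_right 0)"
        unfolding cayley_def lam_ratio_Some by (intro tendsto_intros) (auto simp: lam_ratio_denom)
      then have "((\<lambda>e. E (Complex x e)) \<longlongrightarrow> (1 - ?\<kappa> * lam_ratio (Some x)) * f (Some x) ^ 2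
          - lam_ratio (Some x) * (lam_ratio (Some x) - ?\<kappa>) * h (Some x) ^ 2) (at_right 0)"
        unfolding E_def by (intro tendsto_intros elim)
      then show ?case using eq by simp
    qed
  qed
  have F0: "F \<xi> = 0" "H \<xi> = 0" if u: "\<xi> \<in> upper" for \<xi>
  proof -
    \<comment> \<open>the discriminant \<open>z (z - kap) / (1 - kap z)\<close> divided by \<open>\<xi> - i\<close>\<close>
    define v where "v \<xi> = (cayley \<xi> - ?\<kappa>) / ((\<xi> + \<i>) * (1 - ?\<kappa> * cayley \<xi>))" for \<xi>
    have nz: "1 - ?\<kappa> * cayley z \<noteq> 0" "z + \<i> \<noteq> 0" if "z \<in> upper" for z
      using one_minus_kap_nonzero[OF k0, of "cayley z"] norm_cayley_less[of z] cayley_denom[of z] that by (auto simp: upper_def)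
    have i: "\<i> \<in> upper" by (simp add: upper_def)
    have sq: "F z ^ 2 = (z - \<i>) * v z * H z ^ 2" if "z \<in> upper" for z
    proof -
      have "F z ^ 2 = cayley z * (cayley z - ?\<kappa>) * H z ^ 2 / (1 - ?\<kappa> * cayley z)"
        using nz(1)[OF that] E0[OF that] by (simp add: E_def field_simps)
      also have "\<dots> = (z - \<i>) * v z * H z ^ 2" using nz(2)[OF that] by (simp add: v_def) (simp add: cayley_def)
      finally show ?thesis .
    qed
    have "v holomorphic_on upper" unfolding v_def using nz by (intro holomorphic_intros hc) auto
    moreover have "v \<i> \<noteq> 0" using nz[OF i] kap_bounds[OF k0] by (simp add: v_def cayley_def)
    ultimately show "F \<xi> = 0" "H \<xi> = 0"
      using no_square_root_at_simple_zero[OF open_upper convex_connected[OF convex_upper] i F(1) H(1) _ _ sq u] by blast+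
  qed
  show "f x = 0" by (rule hoelder_zero_if_extension_zero[OF Hi(3) \<mu> F0(1) F(3)])
  show "h x = 0" by (rule hoelder_zero_if_extension_zero[OF Hi(4) \<mu> F0(2) H(3)])
qed

text \<open>The relation \<open>G\<^sup>T Q G = det G Q\<close> turns the vector equation into one scalar equation between the
  values of the quadratic form of \<open>Q\<close> at \<open>\<phi>p\<close> and \<open>\<phi>m\<close>.  After multiplication by \<open>z (z - kap)\<close>, which
  clears the poles of \<open>q\<close>, the form at \<open>\<phi>p\<close> belongs to \<open>C_plus\<close>.  The index of \<open>det G\<close> contributes
  \<open>1/z\<close> and the two zeros of \<open>\<phi>m\<close> at \<open>-i\<close> contribute \<open>1/z\<^sup>2\<close>; two of these three factors compensate
  \<open>z (z - kap)\<close>, and the last one is the zero that forces the form to vanish.\<close>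

theorem vector_problem_trivial:
  assumes k0: "k0 > 1" and \<mu>: "0 < \<mu>" "\<mu> \<le> 1" and G: "G \<in> C_Q k0 \<mu>"
    and fact: "scalar_factorization_index \<mu> (\<lambda>x. det (G x)) 1"
    and p: "\<phi>p \<in> vec_over (C_plus \<mu>)" and m: "\<phi>m \<in> vec_over (C_minus0 \<mu>)"
    and eq: "\<And>x. G x *v \<phi>p x = \<phi>m x"
  shows "\<phi>p x = 0" "\<phi>m x = 0"
proof -
  let ?\<kappa> = "kap k0"
  interpret P: fun_algebra "C_plus \<mu>" by (rule fun_algebra_C_plus[OF \<mu>(1)])
  interpret M: fun_algebra "C_minus \<mu>" by (rule fun_algebra_C_minus[OF \<mu>(1)])
  obtain \<gamma>m \<gamma>p where \<gamma>: "\<gamma>m \<in> units_of_fun (C_minus \<mu>)" "\<gamma>p \<in> units_of_fun (C_plus \<mu>)"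
    "\<And>x. det (G x) = \<gamma>m x * lam_ratio x * \<gamma>p x"
    using fact by (auto simp: scalar_factorization_index_def)
  obtain \<gamma>' where \<gamma>': "\<gamma>' \<in> C_minus \<mu>" "\<And>x. \<gamma>m x * \<gamma>' x = 1" using \<gamma>(1) by (auto simp: units_of_fun_def)
  have \<gamma>p: "\<gamma>p \<in> C_plus \<mu>" "\<And>x. \<gamma>p x \<noteq> 0" using \<gamma>(2) unfolding units_of_fun_def by (auto, metis mult_zero_left zero_neq_one)
  define f where "f i = (\<lambda>x. \<phi>p x $ i)" for i
  have f: "f i \<in> C_plus \<mu>" for i using p by (simp add: f_def vec_over_def)
  have "\<exists>h. h \<in> C_minus \<mu> \<and> (\<lambda>x. \<phi>m x $ i) = (\<lambda>x. inverse (lam_ratio x) * h x)" for i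
    using m by (auto simp: vec_over_def C_minus0_def)
  then obtain h where h: "\<And>i. h i \<in> C_minus \<mu>" "\<And>i. (\<lambda>x. \<phi>m x $ i) = (\<lambda>x. inverse (lam_ratio x) * h i x)"
    by metis
  have h': "\<phi>m x $ i = inverse (lam_ratio x) * h i x" for i x using fun_cong[OF h(2)] .
  have z: "lam_ratio \<in> C_plus \<mu>" "(\<lambda>x. inverse (lam_ratio x)) \<in> C_minus \<mu>"
    using poly_lam_plus[OF \<mu>, of "[:0, 1:]"] by simp_all
  \<comment> \<open>the quadratic form of \<open>Q\<close> at \<open>\<phi>p\<close>, multiplied by \<open>z (z - kap)\<close>\<close>
  define X where "X x = - (1 - ?\<kappa> * lam_ratio x) * f 1 x ^ 2 + lam_ratio x * (lam_ratio x - ?\<kappa>) * f 2 x ^ 2" for x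
  define Y where "Y x = \<gamma>' x * (- (inverse (lam_ratio x) * (inverse (lam_ratio x) - ?\<kappa>)) * h 1 x ^ 2
      + (1 - ?\<kappa> * inverse (lam_ratio x)) * h 2 x ^ 2)" for x
  have X: "X \<in> C_plus \<mu>" unfolding X_def using z(1) f by (intro P.add P.mult P.power P.diff P.uminus P.const) auto
  have Y: "Y \<in> C_minus \<mu>" unfolding Y_def using z(2) h(1) \<gamma>'(1) by (intro M.add M.mult M.power M.diff M.uminus M.const) auto
  have XY: "\<gamma>p x * X x = inverse (lam_ratio x) * Y x" for x
  proof -
    define a d q z where abbr: "a = G x $ 1 $ 1" "d = G x $ 1 $ 2" "q = q_fun k0 x" "z = lam_ratio x"
    have znz: "z \<noteq> 0" "z - ?\<kappa> \<noteq> 0" using minus_kap_nonzero[OF k0, of z] by (auto simp: abbr)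
    have q: "q * (z * (z - ?\<kappa>)) = 1 - ?\<kappa> * z" using znz q_lam_ratio[OF k0, of x] by (simp add: abbr)
    have e1: "a * f 1 x + d * f 2 x = inverse z * h 1 x" "q * d * f 1 x + a * f 2 x = inverse z * h 2 x"
      using arg_cong[OF eq[of x], of "\<lambda>v. v $ 1"] arg_cong[OF eq[of x], of "\<lambda>v. v $ 2"] C_Q_form[OF G, of x]
      unfolding matvec2 h' by (simp_all add: f_def abbr)
    have dG: "a * a - q * d * d = \<gamma>m x * z * \<gamma>p x"
      using \<gamma>(3)[of x] C_Q_form[OF G, of x] by (simp add: det_2 abbr algebra_simps)
    have "\<gamma>m x * z * \<gamma>p x * X x = (a * a - q * d * d) * (z * (z - ?\<kappa>)) * (- q * f 1 x ^ 2 + f 2 x ^ 2)"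
      unfolding dG X_def abbr(4)[symmetric] q[symmetric] by (simp add: algebra_simps)
    also have "\<dots> = z * (z - ?\<kappa>) * (- q * (a * f 1 x + d * f 2 x) ^ 2 + (q * d * f 1 x + a * f 2 x) ^ 2)"
      by (simp add: power2_eq_square algebra_simps)
    also have "\<dots> = inverse z ^ 2 * (- (1 - ?\<kappa> * z) * h 1 x ^ 2 + z * (z - ?\<kappa>) * h 2 x ^ 2)"
      unfolding e1 q[symmetric] by (simp add: power2_eq_square algebra_simps)
    finally have "\<gamma>' x * (\<gamma>m x * z * \<gamma>p x * X x) = \<gamma>' x * (inverse z ^ 2 * (- (1 - ?\<kappa> * z) * h 1 x ^ 2 + z * (z - ?\<kappa>) * h 2 x ^ 2))"
      by (rule arg_cong)
    moreover have "\<gamma>' x * (\<gamma>m x * z * \<gamma>p x * X x) = z * (\<gamma>p x * X x)"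
    proof -
      have "\<gamma>' x * (\<gamma>m x * z * \<gamma>p x * X x) = (\<gamma>m x * \<gamma>' x) * (z * (\<gamma>p x * X x))" by (simp only: mult_ac)
      then show ?thesis by (simp add: \<gamma>'(2))
    qed
    moreover have "\<gamma>' x * (inverse z ^ 2 * (- (1 - ?\<kappa> * z) * h 1 x ^ 2 + z * (z - ?\<kappa>) * h 2 x ^ 2)) = Y x"
    proof -
      have "inverse z ^ 2 * (- (1 - ?\<kappa> * z)) = - (inverse z * (inverse z - ?\<kappa>))"
        "inverse z ^ 2 * (z * (z - ?\<kappa>)) = 1 - ?\<kappa> * inverse z"
        using znz(1) by (simp_all add: power2_eq_square field_simps)
      moreover have "inverse z ^ 2 * (- (1 - ?\<kappa> * z) * h 1 x ^ 2 + z * (z - ?\<kappa>) * h 2 x ^ 2)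
          = inverse z ^ 2 * (- (1 - ?\<kappa> * z)) * h 1 x ^ 2 + inverse z ^ 2 * (z * (z - ?\<kappa>)) * h 2 x ^ 2"
        by (simp only: distrib_left mult.assoc)
      ultimately show ?thesis unfolding Y_def abbr(4)[symmetric] by (simp only:)
    qed
    ultimately have "z * (\<gamma>p x * X x) = Y x" by simp
    then show ?thesis using znz(1) by (simp add: abbr field_simps)
  qed
  have "\<gamma>p x * X x = 0" for x
    using plus_eq_inverse_lam_minus[OF \<mu>(1) P.mult[OF \<gamma>p(1) X] Y XY] .
  then have "X x = 0" for x using \<gamma>p(2) by simp
  then have X0: "(1 - ?\<kappa> * lam_ratio x) * f 1 x ^ 2 = lam_ratio x * (lam_ratio x - ?\<kappa>) * f 2 x ^ 2" for x
    by (simp add: X_def algebra_simps)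
  have p0: "\<phi>p x = 0" for x
    using quadratic_form_anisotropic[OF k0 \<mu>(1) f f X0] by (simp add: f_def vec2_eq_iff)
  show "\<phi>p x = 0" by (rule p0)
  show "\<phi>m x = 0" using eq[of x] p0[of x] by (simp add: matrix_vector_mult_0_right)
qed

section \<open>The square root of q on the line\<close>

text \<open>The function \<open>\<tau> / \<pp>\<^sub>2\<close> on the first component of \<open>\<Gamma>\<close>, a square root of \<open>q\<close> on the line.\<close>

definition root_q :: "real \<Rightarrow> rdot \<Rightarrow> complex" where
  "root_q k0 x = tau_over_p2 k0 (Gam_lift k0 1 x)"

definition tau_real :: "real \<Rightarrow> real \<Rightarrow> real" where
  "tau_real k0 r = sqrt ((1 + r\<^sup>2) * (k0\<^sup>2 + r\<^sup>2))"

lemma Gam_lift_Some: "Gam_lift k0 e (Some r) = Aff (complex_of_real r) (complex_of_real (e * tau_real k0 r))"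
  by (simp add: Gam_lift_def tau_real_def)

lemma p_poly_factor: "p_poly k0 \<xi> = p1 k0 \<xi> * p2 k0 \<xi>"
proof -
  have i: "\<i> * \<i> = (-1 :: complex)" by simp
  show ?thesis unfolding p_poly_def p1_def p2_def power2_eq_square using i by algebra
qed

lemma tau_real_square: "complex_of_real (tau_real k0 r) ^ 2 = p_poly k0 (complex_of_real r)"
proof -
  have "(tau_real k0 r)\<^sup>2 = (1 + r\<^sup>2) * (k0\<^sup>2 + r\<^sup>2)" by (simp add: tau_real_def)
  then show ?thesis
    by (metis (no_types, lifting) p_poly_def of_real_1 of_real_add of_real_mult of_real_power)
qed

lemma tau_real_pos: "k0 > 1 \<Longrightarrow> tau_real k0 r > 0"
  by (simp add: tau_real_def add_pos_nonneg)

lemma p12_real_nonzero: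
  assumes "k0 > 1" shows "p1 k0 (complex_of_real r) \<noteq> 0" "p2 k0 (complex_of_real r) \<noteq> 0"
proof -
  have "complex_of_real r + \<i> * complex_of_real a \<noteq> 0" if "a \<noteq> 0" for a
    using that by (auto simp: complex_eq_iff)
  from this[of 1] this[of "-1"] this[of k0] this[of "- k0"] assms
  show "p1 k0 (complex_of_real r) \<noteq> 0" "p2 k0 (complex_of_real r) \<noteq> 0"
    by (auto simp: p1_def p2_def)
qed

lemma root_q_square:
  assumes "k0 > 1" shows "root_q k0 x ^ 2 = q_fun k0 x"
proof (cases x)
  case None then show ?thesis by (simp add: root_q_def tau_over_p2_def Gam_lift_def q_fun_def)
next
  case (Some r)
  show ?thesis using p12_real_nonzero[OF assms, of r]
    by (simp add: Some root_q_def tau_over_p2_def Gam_lift_Some q_fun_def power_divide tau_real_square p_poly_factor)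
      (simp add: power2_eq_square)
qed

lemma root_q_nonzero:
  assumes "k0 > 1" shows "root_q k0 x \<noteq> 0"
  using p12_real_nonzero[OF assms] tau_real_pos[OF assms]
  by (cases x) (auto simp: root_q_def tau_over_p2_def Gam_lift_Some Gam_lift_def[of _ _ None] less_imp_neq[THEN not_sym])

text \<open>The root \<open>\<tau> / \<pp>\<^sub>2\<close> winds once around the origin, in the negative direction.  Its product with
  \<open>lam_ratio\<close> does not wind and stays in the right half-plane, where roots and logarithms are
  smooth.\<close>

lemma root_q_lam_right_half_plane:
  assumes "k0 > 1" shows "Re (root_q k0 x * lam_ratio x) > 0"
proof (cases x)
  case None then show ?thesis by (simp add: root_q_def tau_over_p2_def Gam_lift_def lam_ratio_def)
next
  case (Some r)
  define w where "w = (complex_of_real r - \<i> * complex_of_real k0) * (complex_of_real r + \<i>)"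
  have nz: "complex_of_real r - \<i> * complex_of_real k0 \<noteq> 0" using assms by (auto simp: complex_eq_iff)
  have "root_q k0 x * lam_ratio x = complex_of_real (tau_real k0 r) / w"
    using nz lam_ratio_denom[of r]
    by (simp add: Some root_q_def tau_over_p2_def Gam_lift_Some lam_ratio_def p2_def w_def)
  also have "Re \<dots> = tau_real k0 r * Re w / (norm w)\<^sup>2"
    by (simp add: Re_divide cmod_power2)
  also have "\<dots> > 0"
  proof (intro divide_pos_pos mult_pos_pos tau_real_pos assms)
    show "0 < Re w" using assms by (simp add: w_def add_nonneg_pos)
    then show "0 < (norm w)\<^sup>2" by (auto simp: complex_eq_iff)
  qed
  finally show ?thesis .
qed

lemma q_fun_hoelder:
  assumes "k0 > 1" "0 < \<mu>" "\<mu> \<le> 1" shows "q_fun k0 \<in> C_hoelder \<mu>"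
proof -
  interpret fun_algebra "C_hoelder \<mu>" by (rule fun_algebra_hoelder[OF assms(2)])
  have "(\<lambda>x. (1 - kap k0 * lam_ratio x) / (lam_ratio x * (lam_ratio x - kap k0))) \<in> C_hoelder \<mu>"
    using minus_kap_nonzero[OF assms(1)] hoelder_lam_ratio[OF assms(2,3)]
    by (intro hoelder_divide assms diff mult const) auto
  then show ?thesis using q_lam_ratio[OF assms(1)] by presburger
qed

text \<open>The square of this function is rational in \<open>lam_ratio\<close> and avoids the negative axis.\<close>

lemma root_q_lam_hoelder:
  assumes "k0 > 1" "0 < \<mu>" "\<mu> \<le> 1" shows "(\<lambda>x. root_q k0 x * lam_ratio x) \<in> C_hoelder \<mu>"
proof -
  interpret fun_algebra "C_hoelder \<mu>" by (rule fun_algebra_hoelder[OF assms(2)])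
  define s where "s x = root_q k0 x * lam_ratio x" for x
  have sq: "s x ^ 2 = q_fun k0 x * lam_ratio x ^ 2" for x
    by (simp add: s_def power_mult_distrib root_q_square[OF assms(1)])
  have re: "Re (s x) > 0" for x unfolding s_def by (rule root_q_lam_right_half_plane[OF assms(1)])
  then have nz: "s x ^ 2 \<notin> \<real>\<^sub>\<le>\<^sub>0" for x
  proof -
    have "csqrt (s x ^ 2) = s x" using re[of x] by (intro csqrt_square) simp
    then have "Re (csqrt (s x ^ 2)) > 0" using re[of x] by simp
    moreover have "Re (csqrt y) = 0" if "y \<in> \<real>\<^sub>\<le>\<^sub>0" for y
      using that by (auto simp: complex_nonpos_Reals_iff cmod_def)
    ultimately show ?thesis by fastforce
  qed
  have "(\<lambda>x. s x ^ 2) \<in> C_hoelder \<mu>" unfolding sq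
    by (intro mult power q_fun_hoelder hoelder_lam_ratio assms)
  then have "(\<lambda>x. Ln (s x ^ 2)) \<in> C_hoelder \<mu>" using nz assms(2) by (intro hoelder_Ln)
  then have "(\<lambda>x. exp (Ln (s x ^ 2) / 2)) \<in> C_hoelder \<mu>"
    by (rule hoelder_entire[OF _ assms(2)]) (auto intro!: holomorphic_intros)
  moreover have "exp (Ln (s x ^ 2) / 2) = s x" for x
  proof -
    have "s x \<noteq> 0" using re[of x] by auto
    then have "exp (Ln (s x ^ 2) / 2) = csqrt (s x ^ 2)" by (simp add: csqrt_exp_Ln)
    also have "\<dots> = s x" using re[of x] by (intro csqrt_square) simp
    finally show ?thesis .
  qed
  ultimately show ?thesis by (simp add: s_def)
qed

lemma root_q_hoelder:
  assumes "k0 > 1" "0 < \<mu>" "\<mu> \<le> 1" shows "root_q k0 \<in> C_hoelder \<mu>"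
proof -
  have "(\<lambda>x. root_q k0 x * lam_ratio x / lam_ratio x) \<in> C_hoelder \<mu>"
    by (intro hoelder_divide root_q_lam_hoelder hoelder_lam_ratio assms) auto
  then show ?thesis by simp
qed

lemma tau_over_p_Gam_lift:
  assumes "k0 > 1"
  shows "tau_over_p2 k0 (Gam_lift k0 1 x) = root_q k0 x" "tau_over_p2 k0 (Gam_lift k0 (-1) x) = - root_q k0 x"
    "tau_over_p1 k0 (Gam_lift k0 1 x) = inverse (root_q k0 x)" "tau_over_p1 k0 (Gam_lift k0 (-1) x) = - inverse (root_q k0 x)"
proof -
  have e: "p2 k0 (complex_of_real r) / complex_of_real (tau_real k0 r) = complex_of_real (tau_real k0 r) / p1 k0 (complex_of_real r)" for r
    using p12_real_nonzero[OF assms, of r] tau_real_pos[OF assms, of r] tau_real_square[of k0 r]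
    by (simp add: frac_eq_eq p_poly_factor power2_eq_square mult.commute)
  show "tau_over_p2 k0 (Gam_lift k0 1 x) = root_q k0 x" by (simp add: root_q_def)
  show "tau_over_p2 k0 (Gam_lift k0 (-1) x) = - root_q k0 x"
    by (cases x) (simp_all add: root_q_def tau_over_p2_def Gam_lift_Some Gam_lift_def[of _ _ None])
  show "tau_over_p1 k0 (Gam_lift k0 1 x) = inverse (root_q k0 x)" "tau_over_p1 k0 (Gam_lift k0 (-1) x) = - inverse (root_q k0 x)"
    using e by (cases x; simp add: root_q_def tau_over_p2_def tau_over_p1_def Gam_lift_Some Gam_lift_def[of _ _ None])+
qed

text \<open>The topology of the surface is defined by its two charts; continuity of a function on a part of the
  surface is pulled back through either of them.\<close>

lemma continuous_on_chart:
  fixes A :: "complex \<times> complex \<Rightarrow> surf"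
  assumes F: "continuous_map (subtopology (surface_top k0) S) euclidean F"
    and chart: "\<And>U. openin (surface_top k0) U \<Longrightarrow> openin (top_of_set X) {z \<in> X. A z \<in> U}"
      "\<And>z. z \<in> X \<Longrightarrow> A z \<in> surface k0"
    and T: "T \<subseteq> X" "A ` T \<subseteq> S"
  shows "continuous_on T (\<lambda>z. F (A z))"
proof -
  have "continuous_map (top_of_set T) (subtopology (surface_top k0) S) A"
  proof (rule continuous_map_into_subtopology)
    show "continuous_map (top_of_set T) (surface_top k0) A"
      unfolding continuous_map_def
    proof (intro conjI allI impI)
      show "A \<in> topspace (top_of_set T) \<rightarrow> topspace (surface_top k0)"
        using chart(2) T(1) by (auto simp: topspace_surface_top)
      fix U assume "openin (surface_top k0) U"
      from chart(1)[OF this] obtain V where V: "open V" "{z \<in> X. A z \<in> U} = X \<inter> V"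
        by (auto simp: openin_open)
      have "z \<in> V \<longleftrightarrow> A z \<in> U" if "z \<in> X" for z
        using V(2) that by blast
      then have "{z \<in> topspace (top_of_set T). A z \<in> U} = T \<inter> V" using T(1) by auto
      then show "openin (top_of_set T) {z \<in> topspace (top_of_set T). A z \<in> U}"
        using V(1) openin_open by blast
    qed
  qed (use T(2) in auto)
  from continuous_map_compose[OF this F] show ?thesis by (simp add: o_def)
qed

section \<open>Even and odd parts on half of the surface\<close>

text \<open>The sign \<open>e\<close> selects the part of the surface over the upper or the lower half-plane, so that both are
  treated at once.  The branch points of this half lie over \<open>e i\<close> and \<open>e i k0\<close>.\<close>

locale half_surface =
  fixes k0 e :: real
  assumes k0: "k0 > 1" and e: "e = 1 \<or> e = -1"
begin

definition H :: "complex set" where "H = {\<xi>. e * Im \<xi> > 0}"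
definition D :: "complex set" where "D = {\<xi>. e * Im \<xi> \<ge> 0}"
definition half :: "surf set" where "half = {P \<in> surface k0. surf_proj P \<in> Some ` H}"
definition pH :: "complex \<Rightarrow> complex" where "pH \<xi> = (\<xi> - e * \<i>) * (\<xi> - e * \<i> * k0)"

lemma open_H: "open H"
  using open_upper open_lower e by (auto simp: H_def upper_def lower_def)

lemma H_D: "H \<subseteq> D" by (auto simp: H_def D_def)

lemma p_poly_pH: "p_poly k0 \<xi> = pH \<xi> * pH (- \<xi>)"
proof -
  have id: "(\<xi> + a) * (\<xi> + b) * ((\<xi> - a) * (\<xi> - b)) = (\<xi> - a) * (\<xi> - b) * ((- \<xi> - a) * (- \<xi> - b))"
    "(\<xi> + a) * (\<xi> + b) * ((\<xi> - a) * (\<xi> - b)) = (\<xi> - (- a)) * (\<xi> - (- b)) * ((- \<xi> - (- a)) * (- \<xi> - (- b)))" for a b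
    by algebra+
  from e show ?thesis
  proof
    assume "e = 1"
    show ?thesis unfolding p_poly_factor pH_def p1_def p2_def unfolding \<open>e = 1\<close> of_real_1 mult_1 by (rule id(1))
  next
    assume "e = -1"
    show ?thesis
      unfolding p_poly_factor pH_def p1_def p2_def unfolding \<open>e = -1\<close> of_real_minus of_real_1 mult_minus_left mult_1 by (rule id(2))
  qed
qed

lemma pH_minus_nonzero:
  assumes "\<xi> \<in> D" shows "pH (- \<xi>) \<noteq> 0"
proof
  assume "pH (- \<xi>) = 0"
  then have "- \<xi> - e * \<i> = 0 \<or> - \<xi> - e * \<i> * k0 = 0" unfolding pH_def by (rule mult_eq_0_iff[THEN iffD1])
  then have "Im (- \<xi> - e * \<i>) = 0 \<or> Im (- \<xi> - e * \<i> * k0) = 0" by (metis zero_complex.sel(2))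
  then have "Im \<xi> = - e \<or> Im \<xi> = - (e * k0)" by auto
  then show False using assms e k0 by (auto simp: D_def)
qed

lemma pH_real_nonzero: "pH (complex_of_real x) \<noteq> 0"
  using pH_minus_nonzero[of "- complex_of_real x"] by (simp add: D_def)

lemma p_poly_zero_iff: "\<xi> \<in> D \<Longrightarrow> p_poly k0 \<xi> = 0 \<longleftrightarrow> \<xi> = e * \<i> \<or> \<xi> = e * \<i> * k0"
  using pH_minus_nonzero[of \<xi>] by (simp add: p_poly_pH pH_def[of \<xi>])

lemma branch_in_H: "e * \<i> \<in> H" "e * \<i> * k0 \<in> H"
  using e k0 by (auto simp: H_def)

text \<open>The principal branch is discontinuous.  This does no harm, since the two expressions built from it
  below are symmetric under a change of sign of the root.\<close>

definition tau_branch :: "complex \<Rightarrow> complex" where "tau_branch \<xi> = csqrt (p_poly k0 \<xi>)"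

lemma tau_branch_square: "tau_branch \<xi> ^ 2 = p_poly k0 \<xi>" by (simp add: tau_branch_def)

lemma isCont_p_poly: "isCont (p_poly k0) \<xi>"
  unfolding p_poly_def by (intro continuous_intros)

text \<open>Away from the branch points there is an analytic root; at a branch point every root is continuous,
  because it tends to zero.\<close>

lemma local_tau_branch:
  obtains t where "\<And>\<xi>. t \<xi> ^ 2 = p_poly k0 \<xi>" "t \<xi>0 = tau_branch \<xi>0" "isCont t \<xi>0"
    "p_poly k0 \<xi>0 \<noteq> 0 \<Longrightarrow> t analytic_on {\<xi>0}"
proof (cases "p_poly k0 \<xi>0 = 0")
  case True
  have "tau_branch \<midarrow>\<xi>0\<rightarrow> 0"
  proof (rule tendsto_norm_zero_cancel)
    have "(\<lambda>\<xi>. sqrt (norm (p_poly k0 \<xi>))) \<midarrow>\<xi>0\<rightarrow> sqrt (norm (p_poly k0 \<xi>0))"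
      by (intro tendsto_intros isContD isCont_p_poly)
    moreover have "sqrt (norm (p_poly k0 \<xi>)) = norm (tau_branch \<xi>)" for \<xi>
    proof -
      have "norm (tau_branch \<xi>) ^ 2 = norm (p_poly k0 \<xi>)" by (metis norm_power tau_branch_square)
      then show ?thesis by (metis norm_ge_zero real_sqrt_unique)
    qed
    ultimately show "(\<lambda>\<xi>. norm (tau_branch \<xi>)) \<midarrow>\<xi>0\<rightarrow> 0" using True by simp
  qed
  moreover have "tau_branch \<xi>0 = 0" using True by (simp add: tau_branch_def)
  ultimately have "isCont tau_branch \<xi>0" by (simp add: isCont_def)
  then show ?thesis using that[of tau_branch] tau_branch_square True by simp
next
  case False
  define t where "t \<xi> = tau_branch \<xi>0 * csqrt (p_poly k0 \<xi> / p_poly k0 \<xi>0)" for \<xi>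
  have "t analytic_on {\<xi>0}"
    unfolding t_def p_poly_def[of k0 _] using False[unfolded p_poly_def]
    by (intro analytic_intros) auto
  moreover then have "isCont t \<xi>0" using analytic_at_imp_isCont by blast
  ultimately show ?thesis using that[of t] False tau_branch_square by (simp add: t_def power_mult_distrib)
qed

text \<open>The odd part is multiplied by \<open>\<tau>\<close>, which makes it a function of \<open>\<xi>\<close>.\<close>

definition even_part :: "(surf \<Rightarrow> complex) \<Rightarrow> complex \<Rightarrow> complex" where
  "even_part F \<xi> = (F (Aff \<xi> (tau_branch \<xi>)) + F (Aff \<xi> (- tau_branch \<xi>))) / 2"

definition odd_part :: "(surf \<Rightarrow> complex) \<Rightarrow> complex \<Rightarrow> complex" where
  "odd_part F \<xi> = tau_branch \<xi> * (F (Aff \<xi> (tau_branch \<xi>)) - F (Aff \<xi> (- tau_branch \<xi>))) / 2"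

lemma parts_any_root:
  assumes "t ^ 2 = p_poly k0 \<xi>"
  shows "even_part F \<xi> = (F (Aff \<xi> t) + F (Aff \<xi> (- t))) / 2"
    "odd_part F \<xi> = t * (F (Aff \<xi> t) - F (Aff \<xi> (- t))) / 2"
proof -
  have "t = tau_branch \<xi> \<or> t = - tau_branch \<xi>" using assms tau_branch_square[of \<xi>] by (metis power2_eq_iff)
  then have "even_part F \<xi> = (F (Aff \<xi> t) + F (Aff \<xi> (- t))) / 2 \<and>
    odd_part F \<xi> = t * (F (Aff \<xi> t) - F (Aff \<xi> (- t))) / 2"
  proof (elim disjE)
    assume t: "t = - tau_branch \<xi>"
    have "- r * (a - b) = r * (b - a)" for r a b :: complex by (simp add: algebra_simps)
    then show ?thesis
      unfolding t by (simp_all only: even_part_def odd_part_def minus_minus add.commute)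
  qed (simp add: even_part_def odd_part_def)
  then show "even_part F \<xi> = (F (Aff \<xi> t) + F (Aff \<xi> (- t))) / 2"
    "odd_part F \<xi> = t * (F (Aff \<xi> t) - F (Aff \<xi> (- t))) / 2" by auto
qed

lemma Aff_half: "\<xi> \<in> D \<Longrightarrow> (\<xi>, \<tau>) \<in> curve k0 \<Longrightarrow> Aff \<xi> \<tau> \<in> half \<union> Gam k0"
proof -
  assume a: "\<xi> \<in> D" "(\<xi>, \<tau>) \<in> curve k0"
  have s: "Aff \<xi> \<tau> \<in> surface k0" using a(2) by (force simp: surface_def)
  show ?thesis
  proof (cases "\<xi> \<in> H")
    case True then show ?thesis using s by (simp add: half_def surf_proj_def)
  next
    case False
    then have "Im \<xi> = 0" using a(1) e by (auto simp: H_def D_def)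
    then have xi: "\<xi> = complex_of_real (Re \<xi>)" by (simp add: complex_eq_iff)
    have "Some \<xi> \<in> range (map_option complex_of_real)"
      by (rule range_eqI[of _ _ "Some (Re \<xi>)"]) (simp add: xi[symmetric])
    then show ?thesis using s by (simp add: Gam_def surf_proj_def)
  qed
qed

lemma Aff_inf_half:
  assumes a: "e * Im s \<le> 0" "(s, t) \<in> curve_inf k0"
  shows "Aff_inf s t \<in> half \<union> Gam k0"
proof (cases "s = 0")
  case True
  have "None \<in> range (map_option complex_of_real)" by (rule range_eqI[of _ _ None]) simp
  then show ?thesis using True Aff_inf_in_surface[OF a(2)] by (simp add: Aff_inf_def Gam_def surf_proj_def)
next
  case False
  then have "(1 / s, t / s\<^sup>2) \<in> curve k0"
    using a(2) by (simp add: curve_inf_def curve_def p_poly_def field_simps power2_eq_square)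
  moreover have "1 / s \<in> D"
  proof -
    have "e * Im (1 / s) = - (e * Im s) / (norm s)\<^sup>2" by (simp add: Im_divide cmod_power2)
    then show ?thesis using a(1) by (simp add: D_def divide_nonpos_nonneg)
  qed
  ultimately show ?thesis using Aff_half False by (simp add: Aff_inf_def)
qed

context
  fixes F :: "surf \<Rightarrow> complex"
  assumes cont: "continuous_map (subtopology (surface_top k0) (half \<union> Gam k0)) euclidean F"
    and ana: "surf_analytic_on k0 F half"
begin

lemma continuous_affine_chart:
  "continuous_on {z \<in> curve k0. fst z \<in> D} (\<lambda>z. F (case_prod Aff z))"
proof (rule continuous_on_chart[OF cont, of "curve k0"])
  show "case_prod Aff ` {z \<in> curve k0. fst z \<in> D} \<subseteq> half \<union> Gam k0" using Aff_half by fastforce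
qed (auto simp: openin_surface_top surface_open_def surface_def)

lemma continuous_infinite_chart:
  "continuous_on {z \<in> curve_inf k0. e * Im (fst z) \<le> 0} (\<lambda>z. F (case_prod Aff_inf z))"
proof (rule continuous_on_chart[OF cont, of "curve_inf k0"])
  show "case_prod Aff_inf ` {z \<in> curve_inf k0. e * Im (fst z) \<le> 0} \<subseteq> half \<union> Gam k0"
    using Aff_inf_half by fastforce
qed (auto simp: openin_surface_top surface_open_def Aff_inf_in_surface)

text \<open>The closed half of the surface is covered by two compact pieces, one in each chart.\<close>

lemma F_bounded:
  obtains M where "M > 0" "\<And>\<xi> \<tau>. \<xi> \<in> D \<Longrightarrow> \<tau> ^ 2 = p_poly k0 \<xi> \<Longrightarrow> norm (F (Aff \<xi> \<tau>)) \<le> M"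
proof -
  define R where "R = 2 * (k0\<^sup>2 + 1)"
  have R1: "R \<ge> 1" by (simp add: R_def)
  have small: "norm t \<le> R" if "norm (t ^ 2) \<le> R" for t :: complex
  proof -
    have "(norm t)\<^sup>2 \<le> R" using that by (simp add: norm_power)
    also have "R \<le> R\<^sup>2" using R1 self_le_power[of R 2] by simp
    finally show ?thesis by (rule power2_le_imp_le) (use R1 in simp)
  qed
  let ?A = "{z \<in> cball 0 1 \<times> cball 0 R. (snd z)\<^sup>2 = p_poly k0 (fst z) \<and> e * Im (fst z) \<ge> 0}"
  let ?B = "{z \<in> cball 0 1 \<times> cball 0 R. (snd z)\<^sup>2 = ((fst z)\<^sup>2 + 1) * ((complex_of_real k0)\<^sup>2 * (fst z)\<^sup>2 + 1) \<and> e * Im (fst z) \<le> 0}"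
  have cK: "compact (cball (0::complex) 1 \<times> cball (0::complex) R)" by (intro compact_Times) auto
  have "closed {z::complex \<times> complex. (snd z)\<^sup>2 = p_poly k0 (fst z) \<and> e * Im (fst z) \<ge> 0}"
    unfolding p_poly_def by (intro closed_Collect_conj closed_Collect_eq closed_Collect_le continuous_intros)
  from compact_Int_closed[OF cK this]
  have cA: "compact ?A" by (rule back_subst[of compact]) auto
  have "closed {z::complex \<times> complex. (snd z)\<^sup>2 = ((fst z)\<^sup>2 + 1) * ((complex_of_real k0)\<^sup>2 * (fst z)\<^sup>2 + 1) \<and> e * Im (fst z) \<le> 0}"
    by (intro closed_Collect_conj closed_Collect_eq closed_Collect_le continuous_intros)
  from compact_Int_closed[OF cK this]
  have cB: "compact ?B" by (rule back_subst[of compact]) auto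
  have "compact ((\<lambda>z. F (case_prod Aff z)) ` ?A)"
    by (intro compact_continuous_image[OF _ cA] continuous_on_subset[OF continuous_affine_chart])
      (auto simp: curve_def D_def)
  from compact_imp_bounded[OF this] obtain M1 where M1: "M1 > 0" "\<And>z. z \<in> ?A \<Longrightarrow> norm (F (case_prod Aff z)) \<le> M1"
    unfolding bounded_pos ball_simps by blast
  have "compact ((\<lambda>z. F (case_prod Aff_inf z)) ` ?B)"
    by (intro compact_continuous_image[OF _ cB] continuous_on_subset[OF continuous_infinite_chart])
      (auto simp: curve_inf_def)
  from compact_imp_bounded[OF this] obtain M2 where M2: "M2 > 0" "\<And>z. z \<in> ?B \<Longrightarrow> norm (F (case_prod Aff_inf z)) \<le> M2"
    unfolding bounded_pos ball_simps by blast
  have "norm (F (Aff \<xi> \<tau>)) \<le> max M1 M2" if a: "\<xi> \<in> D" "\<tau> ^ 2 = p_poly k0 \<xi>" for \<xi> \<tau>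
  proof (cases "norm \<xi> \<le> 1")
    case True
    have k: "norm ((complex_of_real k0)\<^sup>2) = k0\<^sup>2" by (simp add: norm_power)
    have x2: "norm (\<xi>\<^sup>2) \<le> 1" using True by (simp add: norm_power power_le_one)
    have "norm (\<tau> ^ 2) = norm (1 + \<xi>\<^sup>2) * norm ((complex_of_real k0)\<^sup>2 + \<xi>\<^sup>2)"
      unfolding a(2) p_poly_def by (rule norm_mult)
    also have "\<dots> \<le> 2 * (k0\<^sup>2 + 1)"
      using norm_triangle_ineq[of 1 "\<xi>\<^sup>2"] norm_triangle_ineq[of "(complex_of_real k0)\<^sup>2" "\<xi>\<^sup>2"] x2 k
      by (intro mult_mono) auto
    finally have "norm \<tau> \<le> R" using small by (simp add: R_def)
    then have "(\<xi>, \<tau>) \<in> ?A" using a True by (auto simp: D_def)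
    from M1(2)[OF this] show ?thesis by simp
  next
    case False
    define s where "s = 1 / \<xi>"
    define t where "t = \<tau> / \<xi>\<^sup>2"
    have \<xi>0: "\<xi> \<noteq> 0" using False by auto
    have s1: "norm s \<le> 1" using False by (simp add: s_def norm_divide divide_simps)
    have tc: "t\<^sup>2 = (s\<^sup>2 + 1) * ((complex_of_real k0)\<^sup>2 * s\<^sup>2 + 1)"
    proof -
      have "(1 + w) * (k + w) / w\<^sup>2 = (1 / w + 1) * (k * (1 / w) + 1)" if "w \<noteq> 0" for w k :: complex
        using that by (simp add: field_simps power2_eq_square)
      from this[of "\<xi>\<^sup>2" "(complex_of_real k0)\<^sup>2"] show ?thesis
        using \<xi>0 a(2) by (simp only: s_def t_def p_poly_def power_divide) simp
    qed
    have k: "norm ((complex_of_real k0)\<^sup>2 * s\<^sup>2) \<le> k0\<^sup>2 * 1"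
      unfolding norm_mult norm_power using s1 by (intro mult_mono) (auto simp: power_le_one)
    have x2: "norm (s\<^sup>2) \<le> 1" using s1 by (simp add: norm_power power_le_one)
    have "norm (t ^ 2) = norm (s\<^sup>2 + 1) * norm ((complex_of_real k0)\<^sup>2 * s\<^sup>2 + 1)"
      unfolding tc by (rule norm_mult)
    also have "\<dots> \<le> 2 * (k0\<^sup>2 + 1)"
      using norm_triangle_ineq[of "s\<^sup>2" 1] norm_triangle_ineq[of "(complex_of_real k0)\<^sup>2 * s\<^sup>2" 1] x2 k
      by (intro mult_mono) auto
    finally have "norm t \<le> R" using small by (simp add: R_def)
    moreover have "e * Im s \<le> 0"
    proof -
      have "e * Im s = - (e * Im \<xi>) / (norm \<xi>)\<^sup>2" by (simp add: s_def Im_divide cmod_power2)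
      then show ?thesis using a(1) by (simp add: D_def)
    qed
    ultimately have "(s, t) \<in> ?B" using s1 tc by auto
    from M2(2)[OF this] have "norm (F (Aff_inf s t)) \<le> M2" by simp
    moreover have "Aff_inf s t = Aff \<xi> \<tau>" using \<xi>0 by (simp add: Aff_inf_def s_def t_def power_divide)
    ultimately show ?thesis by simp
  qed
  moreover have "max M1 M2 > 0" using M1(1) by simp
  ultimately show ?thesis using that by blast
qed

lemma parts_tendsto:
  assumes "\<xi>0 \<in> D"
  shows "(even_part F \<longlongrightarrow> even_part F \<xi>0) (at \<xi>0 within D)" "(odd_part F \<longlongrightarrow> odd_part F \<xi>0) (at \<xi>0 within D)"
proof -
  obtain t where t: "\<And>\<xi>. t \<xi> ^ 2 = p_poly k0 \<xi>" "t \<xi>0 = tau_branch \<xi>0" "isCont t \<xi>0" using local_tau_branch by metis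
  have tt: "(t \<longlongrightarrow> t \<xi>0) (at \<xi>0 within D)"
    using t(3) by (meson continuous_at_imp_continuous_at_within continuous_within)
  have lim: "((\<lambda>\<xi>. F (Aff \<xi> (c * t \<xi>))) \<longlongrightarrow> F (Aff \<xi>0 (c * t \<xi>0))) (at \<xi>0 within D)" if "c = 1 \<or> c = -1" for c
  proof -
    have "((\<lambda>\<xi>. F (case_prod Aff (\<xi>, c * t \<xi>))) \<longlongrightarrow> F (case_prod Aff (\<xi>0, c * t \<xi>0))) (at \<xi>0 within D)"
    proof (rule continuous_on_tendsto_compose[OF continuous_affine_chart])
      show "((\<lambda>\<xi>. (\<xi>, c * t \<xi>)) \<longlongrightarrow> (\<xi>0, c * t \<xi>0)) (at \<xi>0 within D)" by (intro tendsto_intros tt)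
      show "(\<xi>0, c * t \<xi>0) \<in> {z \<in> curve k0. fst z \<in> D}"
        using assms that t(1) by (auto simp: curve_def power_mult_distrib)
      show "\<forall>\<^sub>F \<xi> in at \<xi>0 within D. (\<xi>, c * t \<xi>) \<in> {z \<in> curve k0. fst z \<in> D}"
        using that t(1) by (auto simp: curve_def power_mult_distrib eventually_at_filter intro!: always_eventually)
    qed
    then show ?thesis by simp
  qed
  have e: "even_part F = (\<lambda>\<xi>. (F (Aff \<xi> (1 * t \<xi>)) + F (Aff \<xi> (-1 * t \<xi>))) / 2)"
    using parts_any_root(1)[OF t(1)] by (simp add: fun_eq_iff)
  have o: "odd_part F = (\<lambda>\<xi>. t \<xi> * (F (Aff \<xi> (1 * t \<xi>)) - F (Aff \<xi> (-1 * t \<xi>))) / 2)"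
    using parts_any_root(2)[OF t(1)] by (simp add: fun_eq_iff)
  show "(even_part F \<longlongrightarrow> even_part F \<xi>0) (at \<xi>0 within D)" unfolding e by (intro tendsto_intros lim) auto
  show "(odd_part F \<longlongrightarrow> odd_part F \<xi>0) (at \<xi>0 within D)" unfolding o by (intro tendsto_intros lim tt) auto
qed

lemma parts_analytic:
  assumes "\<xi>0 \<in> H" "p_poly k0 \<xi>0 \<noteq> 0"
  shows "even_part F analytic_on {\<xi>0}" "odd_part F analytic_on {\<xi>0}"
proof -
  obtain t where t: "\<And>\<xi>. t \<xi> ^ 2 = p_poly k0 \<xi>" "t \<xi>0 = tau_branch \<xi>0" "isCont t \<xi>0" "t analytic_on {\<xi>0}"
    using local_tau_branch assms(2) by metis
  have "\<exists>h. h analytic_on {\<xi>0} \<and> (\<forall>\<^sub>F \<xi> in nhds \<xi>0. F (Aff \<xi> (c * t \<xi>)) = h \<xi>)" if c: "c = 1 \<or> c = -1" for c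
  proof -
    have cu: "(\<xi>, c * t \<xi>) \<in> curve k0" for \<xi> using c t(1) by (auto simp: curve_def power_mult_distrib)
    have "Aff \<xi>0 (c * t \<xi>0) \<in> half"
      using cu[of \<xi>0] assms(1) by (force simp: half_def surface_def surf_proj_def)
    moreover have "c * t \<xi>0 \<noteq> 0" using t(1)[of \<xi>0] assms(2) c by auto
    ultimately obtain h where h: "h analytic_on {\<xi>0}"
      "\<forall>\<^sub>F (\<xi>, \<tau>) in nhds (\<xi>0, c * t \<xi>0). (\<xi>, \<tau>) \<in> curve k0 \<longrightarrow> F (Aff \<xi> \<tau>) = h \<xi>"
      using ana unfolding surf_analytic_on_def by blast
    have "filterlim (\<lambda>\<xi>. (\<xi>, c * t \<xi>)) (nhds (\<xi>0, c * t \<xi>0)) (nhds \<xi>0)"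
    proof -
      have "isCont (\<lambda>\<xi>. (\<xi>, c * t \<xi>)) \<xi>0" using t(3) by (intro continuous_intros)
      then show ?thesis by (rule isCont_tendsto_compose) (rule filterlim_ident)
    qed
    from eventually_compose_filterlim[OF h(2) this]
    have "\<forall>\<^sub>F \<xi> in nhds \<xi>0. F (Aff \<xi> (c * t \<xi>)) = h \<xi>" using cu by simp
    then show ?thesis using h(1) by blast
  qed
  from this[of 1] this[of "-1"] obtain h1 h2 where h: "h1 analytic_on {\<xi>0}" "h2 analytic_on {\<xi>0}"
    "\<forall>\<^sub>F \<xi> in nhds \<xi>0. F (Aff \<xi> (t \<xi>)) = h1 \<xi>" "\<forall>\<^sub>F \<xi> in nhds \<xi>0. F (Aff \<xi> (- t \<xi>)) = h2 \<xi>" by auto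
  have "\<forall>\<^sub>F \<xi> in nhds \<xi>0. even_part F \<xi> = (h1 \<xi> + h2 \<xi>) / 2"
    using h(3,4) by eventually_elim (simp add: parts_any_root(1)[OF t(1)])
  moreover have "(\<lambda>\<xi>. (h1 \<xi> + h2 \<xi>) / 2) analytic_on {\<xi>0}" by (intro analytic_intros h) auto
  ultimately show "even_part F analytic_on {\<xi>0}" by (simp only: analytic_at_cong[OF _ refl])
  have "\<forall>\<^sub>F \<xi> in nhds \<xi>0. odd_part F \<xi> = t \<xi> * (h1 \<xi> - h2 \<xi>) / 2"
    using h(3,4) by eventually_elim (simp add: parts_any_root(2)[OF t(1)])
  moreover have "(\<lambda>\<xi>. t \<xi> * (h1 \<xi> - h2 \<xi>) / 2) analytic_on {\<xi>0}" by (intro analytic_intros h t) auto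
  ultimately show "odd_part F analytic_on {\<xi>0}" by (simp only: analytic_at_cong[OF _ refl])
qed

text \<open>At a branch point the functions are continuous, so the singularity is removable.\<close>

lemma parts_holomorphic: "even_part F holomorphic_on H" "odd_part F holomorphic_on H"
proof -
  let ?K = "{e * \<i>, e * \<i> * k0}"
  have c: "continuous_on H (even_part F)" "continuous_on H (odd_part F)"
    using parts_tendsto H_D unfolding continuous_on_def by (meson subsetD tendsto_within_subset)+
  have "p_poly k0 \<xi> \<noteq> 0" if "\<xi> \<in> H - ?K" for \<xi> using that p_poly_zero_iff[of \<xi>] H_D by auto
  then have "even_part F analytic_on (H - ?K)" "odd_part F analytic_on (H - ?K)"
    using parts_analytic analytic_on_analytic_at by blast+
  then have "even_part F holomorphic_on (H - ?K)" "odd_part F holomorphic_on (H - ?K)"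
    using analytic_imp_holomorphic by blast+
  then show "even_part F holomorphic_on H" "odd_part F holomorphic_on H"
    using no_isolated_singularity[OF c(1) _ open_H, of ?K] no_isolated_singularity[OF c(2) _ open_H, of ?K] by auto
qed

text \<open>The factor \<open>\<tau>\<close> vanishes at the two branch points.\<close>

lemma odd_part_quotient:
  obtains V where "V holomorphic_on H" "\<And>\<xi>. \<xi> \<in> H \<Longrightarrow> odd_part F \<xi> = pH \<xi> * V \<xi>"
proof -
  define a b where "a = e * \<i>" and "b = e * \<i> * k0"
  have ab: "a \<noteq> b" "a \<in> H" "b \<in> H"
    using branch_in_H k0 e by (auto simp: a_def b_def)
  have p0: "p_poly k0 a = 0" "p_poly k0 b = 0"
    using ab H_D p_poly_zero_iff by (auto simp: a_def b_def)
  then have U0: "odd_part F a = 0" "odd_part F b = 0" by (simp_all add: odd_part_def tau_branch_def)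
  define W where "W z = (if z = a then deriv (odd_part F) a else (odd_part F z - odd_part F a) / (z - a))" for z
  have W: "W holomorphic_on H" unfolding W_def using pole_lemma[OF parts_holomorphic(2)] ab(2) open_H by (simp add: interior_open)
  have WU: "odd_part F z = (z - a) * W z" for z using U0 by (simp add: W_def)
  have Wb: "W b = 0" using WU[of b] U0 ab by simp
  define V where "V z = (if z = b then deriv W b else (W z - W b) / (z - b))" for z
  have V: "V holomorphic_on H" unfolding V_def using pole_lemma[OF W] ab(3) open_H by (simp add: interior_open)
  have "W z = (z - b) * V z" for z using Wb by (simp add: V_def)
  then have "odd_part F z = pH z * V z" for z using WU by (simp add: pH_def a_def b_def)
  then show ?thesis using that V by blast
qed

end

lemma cayley_e:
  fixes \<xi> :: complex
  assumes "\<xi> \<in> H" shows "norm (cayley (e * \<xi>)) < 1"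
  using assms by (intro norm_cayley_less) (simp add: H_def)

lemma pH_ratio:
  fixes \<xi> :: complex
  assumes "\<xi> \<in> H"
  shows "pH (- \<xi>) / pH \<xi> = (1 - kap k0 * cayley (e * \<xi>)) / (cayley (e * \<xi>) * (cayley (e * \<xi>) - kap k0))"
proof -
  have "e * \<xi> + \<i> \<noteq> 0" using assms by (intro cayley_denom) (simp add: H_def)
  moreover have "pH (- \<xi>) / pH \<xi> = p1 k0 (e * \<xi>) / p2 k0 (e * \<xi>)"
    using e by (auto simp: pH_def p1_def p2_def) (simp_all add: algebra_simps)
  ultimately show ?thesis using cayley_q[OF k0] by simp
qed

definition inv_cayley :: "complex \<Rightarrow> complex" where
  "inv_cayley z = e * \<i> * (1 + z) / (1 - z)"

lemma inv_cayley:
  fixes \<xi> :: complex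
  assumes "\<xi> \<in> H" shows "inv_cayley (cayley (e * \<xi>)) = \<xi>"
proof -
  have nz: "e * \<xi> + \<i> \<noteq> 0" using assms by (intro cayley_denom) (simp add: H_def)
  have "1 + cayley (e * \<xi>) = 2 * e * \<xi> / (e * \<xi> + \<i>)" "1 - cayley (e * \<xi>) = 2 * \<i> / (e * \<xi> + \<i>)"
    using nz by (simp_all add: cayley_def divide_simps)
  then have "inv_cayley (cayley (e * \<xi>)) = - (\<i> * (e * (\<i> * (e * \<xi>))))"
    using nz by (simp add: inv_cayley_def)
  also have "\<dots> = - (\<i> * \<i>) * ((e * e) * \<xi>)" by (simp only: mult_ac minus_mult_left of_real_mult)
  finally have "inv_cayley (cayley (e * \<xi>)) = (e * e) * \<xi>" by simp
  moreover have "e * e = 1" using e by auto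
  ultimately show ?thesis by (metis mult_1 of_real_1 of_real_mult)
qed

lemma inv_cayley_H:
  assumes "norm z < 1" shows "inv_cayley z \<in> H"
proof -
  have z1: "1 - z \<noteq> 0" using assms by auto
  have "Im (\<i> * (1 + z) / (1 - z)) = (1 - (norm z)\<^sup>2) / (norm (1 - z))\<^sup>2"
  proof -
    have "\<i> * (1 + z) / (1 - z) = \<i> * (1 + z) * cnj (1 - z) / ((1 - z) * cnj (1 - z))" using z1 by simp
    also have "(1 - z) * cnj (1 - z) = complex_of_real ((norm (1 - z))\<^sup>2)" by (rule complex_norm_square[symmetric])
    also have "Im (\<i> * (1 + z) * cnj (1 - z) / complex_of_real ((norm (1 - z))\<^sup>2)) = Im (\<i> * (1 + z) * cnj (1 - z)) / (norm (1 - z))\<^sup>2"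
      by (rule Im_divide_of_real)
    also have "Im (\<i> * (1 + z) * cnj (1 - z)) = 1 - (norm z)\<^sup>2"
      by (simp add: cmod_power2) (simp add: power2_eq_square algebra_simps)
    finally show ?thesis .
  qed
  also have "\<dots> > 0" using assms z1 by (intro divide_pos_pos) (auto simp: abs_square_less_1)
  finally have pos: "Im (\<i> * (1 + z) / (1 - z)) > 0" .
  define w where "w = \<i> * (1 + z) / (1 - z)"
  have "inv_cayley z = e * w" by (simp add: inv_cayley_def w_def)
  then have "e * Im (inv_cayley z) = (e * e) * Im w" by simp
  moreover have "e * e = 1" using e by auto
  ultimately show ?thesis using pos by (simp add: H_def w_def)
qed

text \<open>The quotient of the odd part by \<open>pH\<close> is bounded near the branch points because it is holomorphic, and
  elsewhere because \<open>\<tau> / pH\<close> is: its square is \<open>(1 - kap z) / (z (z - kap))\<close> in the disc coordinate,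
  bounded for \<open>|z| \<ge> r\<close> as soon as \<open>r > |kap|\<close>.\<close>

theorem even_odd_boundary_functions:
  fixes F :: "surf \<Rightarrow> complex"
  assumes cont: "continuous_map (subtopology (surface_top k0) (half \<union> Gam k0)) euclidean F"
    and ana: "surf_analytic_on k0 F half"
    and a: "\<And>x. a (Some x) = (F (Gam_lift k0 1 (Some x)) + F (Gam_lift k0 (-1) (Some x))) / 2"
    and c: "\<And>x. c (Some x) = tau_real k0 x / pH x * ((F (Gam_lift k0 1 (Some x)) - F (Gam_lift k0 (-1) (Some x))) / 2)"
  shows "a \<in> H_inf H" "c \<in> H_inf H"
proof -
  obtain M where M: "M > 0" "\<And>\<xi> \<tau>. \<xi> \<in> D \<Longrightarrow> \<tau> ^ 2 = p_poly k0 \<xi> \<Longrightarrow> norm (F (Aff \<xi> \<tau>)) \<le> M"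
    using F_bounded[OF cont ana] by blast
  have M': "norm (F (Aff \<xi> (tau_branch \<xi>))) \<le> M" "norm (F (Aff \<xi> (- tau_branch \<xi>))) \<le> M" if "\<xi> \<in> H" for \<xi>
    using M(2)[of \<xi> "tau_branch \<xi>"] M(2)[of \<xi> "- tau_branch \<xi>"] tau_branch_square[of \<xi>] that H_D by auto
  have real_parts: "even_part F (complex_of_real x) = a (Some x)" "odd_part F (complex_of_real x) = pH x * c (Some x)" for x
    using pH_real_nonzero[of x]
    by (simp_all add: parts_any_root[OF tau_real_square] a c Gam_lift_Some)
  have xD: "complex_of_real x \<in> D" for x by (simp add: D_def)
  have cone: "((f \<longlongrightarrow> l) (at (complex_of_real x) within {z \<in> H. \<bar>Re z - x\<bar> < d * \<bar>Im z\<bar>}))"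
    if "(f \<longlongrightarrow> l) (at (complex_of_real x) within D)" for f :: "complex \<Rightarrow> complex" and l x d
    by (rule tendsto_within_subset[OF that]) (use H_D in auto)
  show "a \<in> H_inf H"
  proof (rule H_infI)
    show "even_part F holomorphic_on H" by (rule parts_holomorphic[OF cont ana])
    show "norm (even_part F \<xi>) \<le> M" if "\<xi> \<in> H" for \<xi>
      using M'[OF that] norm_triangle_ineq[of "F (Aff \<xi> (tau_branch \<xi>))" "F (Aff \<xi> (- tau_branch \<xi>))"]
      by (simp add: even_part_def norm_divide)
    have "(even_part F \<longlongrightarrow> a (Some x)) (at (complex_of_real x) within D)" for x
      using parts_tendsto(1)[OF cont ana xD] unfolding real_parts .
    then show "AE x in lborel. \<forall>d>0. (even_part F \<longlongrightarrow> a (Some x))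
        (at (complex_of_real x) within {z \<in> H. \<bar>Re z - x\<bar> < d * \<bar>Im z\<bar>})" using cone by simp
  qed
  obtain V where V: "V holomorphic_on H" "\<And>\<xi>. \<xi> \<in> H \<Longrightarrow> odd_part F \<xi> = pH \<xi> * V \<xi>"
    using odd_part_quotient[OF cont ana] by blast
  \<comment> \<open>the disc of radius \<open>r\<close> contains both branch points in its interior\<close>
  define r where "r = (1 + norm (kap k0)) / 2"
  have r: "norm (kap k0) < r" "0 < r" "r < 1" using kap_bounds[OF k0] by (auto simp: r_def add_pos_nonneg)
  have "compact ((\<lambda>z. V (inv_cayley z)) ` cball 0 r)"
  proof (intro compact_continuous_image)
    have "inv_cayley holomorphic_on ball 0 1" unfolding inv_cayley_def by (intro holomorphic_intros) auto
    then have "continuous_on (cball 0 r) inv_cayley"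
      by (rule continuous_on_subset[OF holomorphic_on_imp_continuous_on]) (use r in auto)
    then show "continuous_on (cball 0 r) (\<lambda>z. V (inv_cayley z))"
      by (rule continuous_on_compose2[OF holomorphic_on_imp_continuous_on[OF V(1)]]) (use inv_cayley_H r in auto)
  qed auto
  from compact_imp_bounded[OF this] obtain B where B: "\<And>z. z \<in> cball 0 r \<Longrightarrow> norm (V (inv_cayley z)) \<le> B"
    unfolding bounded_pos ball_simps by blast
  define N where "N = sqrt (2 / (r * (r - norm (kap k0)))) * M"
  have bound: "norm (V \<xi>) \<le> max B N" if h: "\<xi> \<in> H" for \<xi>
  proof (cases "norm (cayley (e * \<xi>)) \<le> r")
    case True
    then show ?thesis using B[of "cayley (e * \<xi>)"] inv_cayley[OF h] by simp
  next
    case False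
    define z where "z = cayley (e * \<xi>)"
    have z: "norm z > r" "norm z < 1" using False cayley_e[OF h] by (auto simp: z_def)
    have zk: "norm (z - kap k0) \<ge> r - norm (kap k0)" using norm_triangle_ineq2[of z "kap k0"] z by simp
    have nz: "pH \<xi> \<noteq> 0"
    proof
      assume "pH \<xi> = 0"
      then have "z * (z - kap k0) = 0 \<or> 1 - kap k0 * z = 0" using pH_ratio[OF h] by (auto simp: z_def)
      moreover have "1 - kap k0 * z \<noteq> 0" using one_minus_kap_nonzero[OF k0, of z] z by simp
      ultimately show False using zk z r by auto
    qed
    have "norm (tau_branch \<xi> / pH \<xi>) ^ 2 = norm (tau_branch \<xi> ^ 2 / pH \<xi> ^ 2)" by (simp add: norm_divide norm_power power_divide)
    also have "tau_branch \<xi> ^ 2 / pH \<xi> ^ 2 = pH (- \<xi>) / pH \<xi>"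
      unfolding tau_branch_square p_poly_pH using nz by (simp add: power2_eq_square)
    also have "norm \<dots> = norm (1 - kap k0 * z) / (norm z * norm (z - kap k0))"
      unfolding pH_ratio[OF h] z_def[symmetric] by (simp only: norm_divide norm_mult)
    also have "\<dots> \<le> 2 / (r * (r - norm (kap k0)))"
    proof (intro frac_le mult_mono)
      have "norm (kap k0 * z) \<le> 1" unfolding norm_mult using kap_bounds[OF k0] z by (intro mult_le_one) auto
      then show "norm (1 - kap k0 * z) \<le> 2" using norm_triangle_ineq4[of 1 "kap k0 * z"] by simp
    qed (use r z zk in auto)
    finally have "norm (tau_branch \<xi> / pH \<xi>) \<le> sqrt (2 / (r * (r - norm (kap k0))))" by (rule real_le_rsqrt)
    moreover have "V \<xi> = tau_branch \<xi> / pH \<xi> * ((F (Aff \<xi> (tau_branch \<xi>)) - F (Aff \<xi> (- tau_branch \<xi>))) / 2)"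
      using V(2)[OF h] nz by (simp add: odd_part_def field_simps)
    moreover have "norm ((F (Aff \<xi> (tau_branch \<xi>)) - F (Aff \<xi> (- tau_branch \<xi>))) / 2) \<le> M"
      using M'[OF h] norm_triangle_ineq4[of "F (Aff \<xi> (tau_branch \<xi>))" "F (Aff \<xi> (- tau_branch \<xi>))"] by (simp add: norm_divide)
    ultimately have "norm (V \<xi>) \<le> N" unfolding N_def using r by (simp only: norm_mult) (intro mult_mono, auto)
    then show ?thesis by simp
  qed
  show "c \<in> H_inf H"
  proof (rule H_infI[OF V(1) bound])
    have "(V \<longlongrightarrow> c (Some x)) (at (complex_of_real x) within {z \<in> H. \<bar>Re z - x\<bar> < d * \<bar>Im z\<bar>})" for x d
    proof -
      let ?L = "at (complex_of_real x) within {z \<in> H. \<bar>Re z - x\<bar> < d * \<bar>Im z\<bar>}"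
      have "(odd_part F \<longlongrightarrow> pH x * c (Some x)) ?L"
        using cone[OF parts_tendsto(2)[OF cont ana xD]] unfolding real_parts .
      moreover have lp: "(pH \<longlongrightarrow> pH x) ?L" unfolding pH_def by (intro tendsto_intros)
      ultimately have "((\<lambda>\<xi>. odd_part F \<xi> / pH \<xi>) \<longlongrightarrow> pH x * c (Some x) / pH x) ?L"
        using pH_real_nonzero by (intro tendsto_divide)
      then have "((\<lambda>\<xi>. odd_part F \<xi> / pH \<xi>) \<longlongrightarrow> c (Some x)) ?L" using pH_real_nonzero by simp
      moreover have "\<forall>\<^sub>F \<xi> in ?L. odd_part F \<xi> / pH \<xi> = V \<xi>"
      proof -
        have "\<forall>\<^sub>F \<xi> in ?L. pH \<xi> \<noteq> 0" by (rule tendsto_imp_eventually_ne[OF lp pH_real_nonzero])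
        moreover have "\<forall>\<^sub>F \<xi> in ?L. \<xi> \<in> H" by (simp add: eventually_at_filter)
        ultimately show ?thesis by eventually_elim (simp add: V(2))
      qed
      ultimately show ?thesis by (rule Lim_transform_eventually)
    qed
    then show "AE x in lborel. \<forall>d>0. (V \<longlongrightarrow> c (Some x))
        (at (complex_of_real x) within {z \<in> H. \<bar>Re z - x\<bar> < d * \<bar>Im z\<bar>})" by simp
  qed
qed

end

section \<open>Triviality of the problem on the surface\<close>

lemma Gam_cases:
  assumes "P \<in> Gam k0"
  obtains x where "P = Gam_lift k0 1 x" | x where "P = Gam_lift k0 (-1) x"
  using assms unfolding Gam_eq_range by blast

lemma Gam_lift_in_Gam: "Gam_lift k0 1 x \<in> Gam k0" "Gam_lift k0 (-1) x \<in> Gam k0"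
  unfolding Gam_eq_range by auto

lemma even_odd_plus:
  assumes k0: "k0 > 1" and \<mu>: "0 < \<mu>" "\<mu> \<le> 1" and \<psi>: "\<psi> \<in> CG_plus k0 \<mu>"
  shows "(\<lambda>x. (\<psi> (Gam_lift k0 1 x) + \<psi> (Gam_lift k0 (-1) x)) / 2) \<in> C_plus \<mu>"
    "(\<lambda>x. root_q k0 x * ((\<psi> (Gam_lift k0 1 x) - \<psi> (Gam_lift k0 (-1) x)) / 2)) \<in> C_plus \<mu>"
proof -
  interpret S: half_surface k0 1 by standard (use k0 in auto)
  interpret A: fun_algebra "C_hoelder \<mu>" by (rule fun_algebra_hoelder[OF \<mu>(1)])
  have H: "S.H = upper" "S.half = surf_plus k0" "S.pH = p2 k0"
    by (auto simp: S.H_def upper_def S.half_def surf_plus_def S.pH_def p2_def fun_eq_iff)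
  obtain F where F: "continuous_map (subtopology (surface_top k0) (S.half \<union> Gam k0)) euclidean F"
    "surf_analytic_on k0 F S.half" "\<And>P. P \<in> Gam k0 \<Longrightarrow> F P = \<psi> P"
    using \<psi> unfolding CG_plus_def extends_analytically_to_def H by auto
  have h: "(\<lambda>x. \<psi> (Gam_lift k0 1 x)) \<in> C_hoelder \<mu>" "(\<lambda>x. \<psi> (Gam_lift k0 (-1) x)) \<in> C_hoelder \<mu>"
    using \<psi> by (auto simp: CG_plus_def CG_hoelder_def)
  let ?a = "\<lambda>x. (\<psi> (Gam_lift k0 1 x) + \<psi> (Gam_lift k0 (-1) x)) / 2"
  let ?c = "\<lambda>x. root_q k0 x * ((\<psi> (Gam_lift k0 1 x) - \<psi> (Gam_lift k0 (-1) x)) / 2)"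
  have a: "?a (Some x) = (F (Gam_lift k0 1 (Some x)) + F (Gam_lift k0 (-1) (Some x))) / 2" for x
    by (simp add: F(3) Gam_lift_in_Gam)
  have c: "?c (Some x) = tau_real k0 x / S.pH x * ((F (Gam_lift k0 1 (Some x)) - F (Gam_lift k0 (-1) (Some x))) / 2)" for x
    by (simp add: F(3) Gam_lift_in_Gam H root_q_def tau_over_p2_def) (simp add: Gam_lift_Some)
  have "?a \<in> H_inf S.H" "?c \<in> H_inf S.H"
    by (rule S.even_odd_boundary_functions[OF F(1,2) a c])+
  moreover have "?a \<in> C_hoelder \<mu>" "?c \<in> C_hoelder \<mu>"
    unfolding divide_inverse by (intro A.mult A.add A.diff A.const h root_q_hoelder k0 \<mu>)+
  ultimately show "?a \<in> C_plus \<mu>" "?c \<in> C_plus \<mu>" by (simp_all add: C_plus_def H)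
qed

lemma even_odd_minus:
  assumes k0: "k0 > 1" and \<mu>: "0 < \<mu>" "\<mu> \<le> 1" and \<psi>: "\<psi> \<in> CG_minus k0 \<mu>"
  shows "(\<lambda>x. (\<psi> (Gam_lift k0 1 x) + \<psi> (Gam_lift k0 (-1) x)) / 2) \<in> C_minus \<mu>"
    "(\<lambda>x. inverse (root_q k0 x) * ((\<psi> (Gam_lift k0 1 x) - \<psi> (Gam_lift k0 (-1) x)) / 2)) \<in> C_minus \<mu>"
proof -
  interpret S: half_surface k0 "-1" by standard (use k0 in auto)
  interpret A: fun_algebra "C_hoelder \<mu>" by (rule fun_algebra_hoelder[OF \<mu>(1)])
  have H: "S.H = lower" "S.half = surf_minus k0" "S.pH = p1 k0"
    by (auto simp: S.H_def lower_def S.half_def surf_minus_def S.pH_def p1_def fun_eq_iff)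
  obtain F where F: "continuous_map (subtopology (surface_top k0) (S.half \<union> Gam k0)) euclidean F"
    "surf_analytic_on k0 F S.half" "\<And>P. P \<in> Gam k0 \<Longrightarrow> F P = \<psi> P"
    using \<psi> unfolding CG_minus_def extends_analytically_to_def H by auto
  have h: "(\<lambda>x. \<psi> (Gam_lift k0 1 x)) \<in> C_hoelder \<mu>" "(\<lambda>x. \<psi> (Gam_lift k0 (-1) x)) \<in> C_hoelder \<mu>"
    using \<psi> by (auto simp: CG_minus_def CG_hoelder_def)
  let ?a = "\<lambda>x. (\<psi> (Gam_lift k0 1 x) + \<psi> (Gam_lift k0 (-1) x)) / 2"
  let ?c = "\<lambda>x. inverse (root_q k0 x) * ((\<psi> (Gam_lift k0 1 x) - \<psi> (Gam_lift k0 (-1) x)) / 2)"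
  have a: "?a (Some x) = (F (Gam_lift k0 1 (Some x)) + F (Gam_lift k0 (-1) (Some x))) / 2" for x
    by (simp add: F(3) Gam_lift_in_Gam)
  have c: "?c (Some x) = tau_real k0 x / S.pH x * ((F (Gam_lift k0 1 (Some x)) - F (Gam_lift k0 (-1) (Some x))) / 2)" for x
    by (simp add: F(3) Gam_lift_in_Gam H tau_over_p_Gam_lift(3)[OF k0, symmetric] tau_over_p1_def) (simp add: Gam_lift_Some)
  have "?a \<in> H_inf S.H" "?c \<in> H_inf S.H"
    by (rule S.even_odd_boundary_functions[OF F(1,2) a c])+
  moreover have "?a \<in> C_hoelder \<mu>" "?c \<in> C_hoelder \<mu>"
    unfolding divide_inverse
    by (intro A.mult A.add A.diff A.const h hoelder_inverse root_q_hoelder root_q_nonzero k0 \<mu>)+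
  ultimately show "?a \<in> C_minus \<mu>" "?c \<in> C_minus \<mu>" by (simp_all add: C_minus_def H)
qed

text \<open>On \<open>\<Gamma>\<close> write \<open>\<psi>p = a + (\<tau>/\<pp>\<^sub>1) c\<close> and \<open>\<psi>m = (am + (\<tau>/\<pp>\<^sub>2) cm) / lam_ratio\<close>.  Since \<open>\<tau>\<^sup>2 = \<pp>\<^sub>1 \<pp>\<^sub>2\<close>, comparing
  even and odd parts in the equation on \<open>\<Gamma>\<close> gives the vector equation for \<open>(a, c)\<close> and \<open>(cm, am)\<close>.\<close>

theorem surface_problem_trivial:
  assumes k0: "k0 > 1" and \<mu>: "0 < \<mu>" "\<mu> \<le> 1" and G: "G \<in> C_Q k0 \<mu>"
    and fact: "scalar_factorization_index \<mu> (\<lambda>x. det (G x)) 1"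
    and p: "\<psi>p \<in> CG_plus k0 \<mu>" and m: "\<psi>m \<in> CG_minus0 k0 \<mu>"
    and eq: "\<And>P. P \<in> Gam k0 \<Longrightarrow> Sigma_symbol k0 G P * \<psi>p P = tau_over_p1 k0 P * \<psi>m P"
    and P: "P \<in> Gam k0"
  shows "\<psi>p P = 0" "\<psi>m P = 0"
proof -
  obtain f where f: "f \<in> CG_minus k0 \<mu>"
    "\<And>P. P \<in> Gam k0 \<Longrightarrow> \<psi>m P = pull (\<lambda>x. inverse (lam_ratio x)) P * f P"
    using m by (auto simp: CG_minus0_def)
  let ?L1 = "Gam_lift k0 1" and ?L2 = "Gam_lift k0 (-1)"
  define a where "a = (\<lambda>x. (\<psi>p (?L1 x) + \<psi>p (?L2 x)) / 2)"
  define c where "c = (\<lambda>x. root_q k0 x * ((\<psi>p (?L1 x) - \<psi>p (?L2 x)) / 2))"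
  define am where "am = (\<lambda>x. (f (?L1 x) + f (?L2 x)) / 2)"
  define cm where "cm = (\<lambda>x. inverse (root_q k0 x) * ((f (?L1 x) - f (?L2 x)) / 2))"
  have ac: "a \<in> C_plus \<mu>" "c \<in> C_plus \<mu>" unfolding a_def c_def by (rule even_odd_plus[OF k0 \<mu> p])+
  have acm: "am \<in> C_minus \<mu>" "cm \<in> C_minus \<mu>" unfolding am_def cm_def by (rule even_odd_minus[OF k0 \<mu> f(1)])+
  define \<phi>p :: "rdot \<Rightarrow> complex^2" where "\<phi>p x = vector [a x, c x]" for x
  define \<phi>m :: "rdot \<Rightarrow> complex^2" where "\<phi>m x = vector [inverse (lam_ratio x) * cm x, inverse (lam_ratio x) * am x]" for x
  have "\<phi>p \<in> vec_over (C_plus \<mu>)" using ac by (simp add: vec_over_def \<phi>p_def forall_2)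
  moreover have "\<phi>m \<in> vec_over (C_minus0 \<mu>)" using acm by (auto simp: vec_over_def \<phi>m_def forall_2 C_minus0_def)
  moreover have "G x *v \<phi>p x = \<phi>m x" for x
  proof -
    define \<alpha> \<delta> s u1 u2 v1 v2 w where abbr: "\<alpha> = G x $ 1 $ 1" "\<delta> = G x $ 1 $ 2" "s = root_q k0 x"
      "u1 = \<psi>p (?L1 x)" "u2 = \<psi>p (?L2 x)" "v1 = f (?L1 x)" "v2 = f (?L2 x)" "w = inverse (lam_ratio x)"
    have s0: "s \<noteq> 0" unfolding abbr by (rule root_q_nonzero[OF k0])
    have s2: "s * s = q_fun k0 x" using root_q_square[OF k0, of x] by (simp add: abbr power2_eq_square)
    have e1: "(\<alpha> + s * \<delta>) * u1 = inverse s * (w * v1)"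
      using eq[OF Gam_lift_in_Gam(1)[of k0 x]] f(2)[OF Gam_lift_in_Gam(1)[of k0 x]]
      by (simp add: Sigma_symbol_def pull_Gam_lift tau_over_p_Gam_lift[OF k0] abbr)
    have e2: "(\<alpha> - s * \<delta>) * u2 = - (inverse s * (w * v2))"
      using eq[OF Gam_lift_in_Gam(2)[of k0 x]] f(2)[OF Gam_lift_in_Gam(2)[of k0 x]]
      by (simp add: Sigma_symbol_def pull_Gam_lift tau_over_p_Gam_lift[OF k0] abbr)
    have "\<alpha> * ((u1 + u2) / 2) + \<delta> * (s * ((u1 - u2) / 2)) = ((\<alpha> + s * \<delta>) * u1 + (\<alpha> - s * \<delta>) * u2) / 2"
      by (simp add: field_simps)
    also have "\<dots> = w * (inverse s * ((v1 - v2) / 2))" unfolding e1 e2 by (simp add: algebra_simps diff_divide_distrib)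
    finally have r1: "\<alpha> * ((u1 + u2) / 2) + \<delta> * (s * ((u1 - u2) / 2)) = w * (inverse s * ((v1 - v2) / 2))" .
    have "s * s * \<delta> * ((u1 + u2) / 2) + \<alpha> * (s * ((u1 - u2) / 2)) = s * ((\<alpha> + s * \<delta>) * u1 - (\<alpha> - s * \<delta>) * u2) / 2"
      by (simp add: field_simps)
    also have "\<dots> = w * ((v1 + v2) / 2)" unfolding e1 e2 using s0 by (simp add: field_simps)
    finally have r2: "s * s * \<delta> * ((u1 + u2) / 2) + \<alpha> * (s * ((u1 - u2) / 2)) = w * ((v1 + v2) / 2)" .
    show ?thesis unfolding vec2_eq_iff matvec2 using C_Q_form[OF G, of x] r1 r2
      by (simp add: \<phi>p_def \<phi>m_def a_def c_def am_def cm_def abbr[symmetric] s2[symmetric])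
  qed
  ultimately have "\<phi>p x = 0" for x by (rule vector_problem_trivial(1)[OF k0 \<mu> G fact])
  then have z: "a x = 0" "c x = 0" for x by (auto simp: \<phi>p_def vec2_eq_iff)
  have "\<psi>p (?L1 x) = 0 \<and> \<psi>p (?L2 x) = 0" for x
    using z[of x] root_q_nonzero[OF k0, of x] by (auto simp: a_def c_def)
  then have p0: "\<psi>p P = 0" if "P \<in> Gam k0" for P using that by (elim Gam_cases) auto
  show "\<psi>p P = 0" using p0 P .
  have "tau_over_p1 k0 P \<noteq> 0" using P root_q_nonzero[OF k0]
    by (elim Gam_cases) (auto simp: tau_over_p_Gam_lift[OF k0])
  then show "\<psi>m P = 0" using eq[OF P] p0[OF P] by simp
qed

section \<open>The scalar obstruction\<close>

text \<open>Under the Cayley map the branch points of the upper half of the surface become 0 and \<open>kap\<close>.  The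
  difference of the two values of the plus part is the only obstruction to the splitting below.  On the
  surface it is, up to a constant factor, the integral over \<open>\<Gamma>\<close> of \<open>\<tau>/\<pp>\<^sub>2 \<cdot> f\<close> against the holomorphic
  differential \<open>d\<xi>/\<tau>\<close>.\<close>

definition obstruction :: "real \<Rightarrow> (rdot \<Rightarrow> complex) \<Rightarrow> complex" where
  "obstruction k0 f = cauchy_int f 0 - cauchy_int f (kap k0)"

lemma disc_algebra_divide:
  assumes \<Phi>: "\<Phi> \<in> disc_algebra" "\<Phi> a = 0" "norm a < 1"
  obtains C where "C \<in> disc_algebra" "\<And>z. \<Phi> z = (z - a) * C z"
proof -
  have cont: "continuous_on (cball 0 1) \<Phi>" and holo: "\<Phi> holomorphic_on ball 0 1"
    using \<Phi> by (auto simp: disc_algebra_def)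
  define C where "C z = (if z = a then deriv \<Phi> a else (\<Phi> z - \<Phi> a) / (z - a))" for z
  have hC: "C holomorphic_on ball 0 1"
    unfolding C_def using pole_lemma[OF holo, of a] \<Phi>(3) by simp
  have "continuous_on (cball 0 1) C"
    unfolding continuous_on_def
  proof
    fix x :: complex assume x: "x \<in> cball 0 1"
    show "(C \<longlongrightarrow> C x) (at x within cball 0 1)"
    proof (cases "x = a")
      case True
      then have "isCont C x" using hC \<Phi>(3) by (intro holomorphic_on_imp_continuous_on[THEN continuous_on_interior]) auto
      then show ?thesis by (meson continuous_at_imp_continuous_at_within continuous_within)
    next
      case False
      have "((\<lambda>z. (\<Phi> z - \<Phi> a) / (z - a)) \<longlongrightarrow> C x) (at x within cball 0 1)"
        using cont x False by (auto simp: C_def continuous_on_def intro!: tendsto_intros)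
      moreover have "\<forall>\<^sub>F z in at x within cball 0 1. (\<Phi> z - \<Phi> a) / (z - a) = C z"
        using eventually_neq_at_within[of a x "cball 0 1"] by eventually_elim (simp add: C_def)
      ultimately show ?thesis by (rule Lim_transform_eventually)
    qed
  qed
  then have "C \<in> disc_algebra" using hC by (simp add: disc_algebra_def)
  moreover have "\<Phi> z = (z - a) * C z" for z using \<Phi>(2) by (simp add: C_def)
  ultimately show ?thesis using that by blast
qed

lemma q_fun_minus:
  assumes "k0 > 1" "0 < \<mu>" "\<mu> \<le> 1" shows "q_fun k0 \<in> C_minus \<mu>"
proof -
  interpret D: fun_algebra disc_algebra by (rule fun_algebra_disc_algebra)
  have lin: "(\<lambda>w. a + b * w) \<in> disc_algebra" for a b
  proof -
    have "poly [:a, b:] = (\<lambda>w. a + b * w)" by (simp add: fun_eq_iff mult.commute)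
    then show ?thesis using poly_disc_algebra[of "[:a, b:]"] by simp
  qed
  define \<Phi> where "\<Phi> w = (0 + 1 * w) * (- kap k0 + 1 * w) * inverse (1 + (- kap k0) * w)" for w
  have "(\<lambda>w. inverse (1 + (- kap k0) * w)) \<in> disc_algebra"
    by (rule disc_algebra_inverse[OF lin]) (use one_minus_kap_nonzero[OF assms(1)] in simp)
  then have d: "\<Phi> \<in> disc_algebra" unfolding \<Phi>_def by (intro D.mult lin)
  have "\<Phi> (inverse (lam_ratio x)) = q_fun k0 x" for x
  proof -
    have nz: "lam_ratio x - kap k0 \<noteq> 0" by (rule minus_kap_nonzero[OF assms(1)]) simp
    then have "1 - kap k0 * inverse (lam_ratio x) \<noteq> 0" by (simp add: field_simps)
    with nz show ?thesis unfolding q_lam_ratio[OF assms(1)] \<Phi>_def by (simp add: divide_simps)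
  qed
  then show ?thesis using C_minusI[OF d, of \<mu>] q_fun_hoelder[OF assms] by simp
qed

text \<open>The constant in the plus part can be moved to the minus part.  If the obstruction vanishes, one
  constant removes the values at both 0 and \<open>kap\<close>, and then multiplication by \<open>q\<close> creates no pole.\<close>

lemma unobstructed_splitting:
  assumes k0: "k0 > 1" and \<mu>: "0 < \<mu>" "\<mu> < 1" and f: "f \<in> C_hoelder \<mu>" and obs: "obstruction k0 f = 0"
  obtains fm fp where "fm \<in> C_minus \<mu>" "fp \<in> C_plus \<mu>" "(\<lambda>x. q_fun k0 x * fm x) \<in> C_minus \<mu>"
    "(\<lambda>x. q_fun k0 x * fp x) \<in> C_plus \<mu>" "\<And>x. f x = fm x + fp x"
proof -
  interpret D: fun_algebra disc_algebra by (rule fun_algebra_disc_algebra)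
  interpret A: fun_algebra "C_hoelder \<mu>" by (rule fun_algebra_hoelder[OF \<mu>(1)])
  interpret M: fun_algebra "C_minus \<mu>" by (rule fun_algebra_C_minus[OF \<mu>(1)])
  obtain \<Phi> \<Psi> where PP: "\<Phi> \<in> disc_algebra" "\<Psi> \<in> disc_algebra"
    "(\<lambda>x. \<Phi> (lam_ratio x)) \<in> C_hoelder \<mu>" "(\<lambda>x. \<Psi> (inverse (lam_ratio x))) \<in> C_hoelder \<mu>"
    "\<And>x. f x = \<Phi> (lam_ratio x) + \<Psi> (inverse (lam_ratio x))"
    "\<And>w. norm w < 1 \<Longrightarrow> \<Phi> w = cauchy_int f w"
    by (rule Privalov_decomposition[OF f \<mu>]) blast
  define \<Phi>1 where "\<Phi>1 z = \<Phi> z - \<Phi> 0" for z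
  have "\<Phi>1 \<in> disc_algebra" unfolding \<Phi>1_def by (intro D.diff D.const PP)
  moreover have "\<Phi>1 0 = 0" by (simp add: \<Phi>1_def)
  ultimately obtain C1 where C1: "C1 \<in> disc_algebra" "\<And>z. \<Phi>1 z = (z - 0) * C1 z"
    using disc_algebra_divide[of \<Phi>1 0] by auto
  have "\<Phi>1 (kap k0) = 0"
    using obs PP(6)[of 0] PP(6)[OF kap_bounds(1)[OF k0]] by (simp add: \<Phi>1_def obstruction_def)
  then have "C1 (kap k0) = 0" using C1(2)[of "kap k0"] kap_bounds(2)[OF k0] by simp
  then obtain C where C: "C \<in> disc_algebra" "\<And>z. C1 z = (z - kap k0) * C z"
    using disc_algebra_divide[OF C1(1) _ kap_bounds(1)[OF k0]] by blast
  define fp where "fp x = \<Phi>1 (lam_ratio x)" for x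
  define fm where "fm x = \<Psi> (inverse (lam_ratio x)) + \<Phi> 0" for x
  have hp: "fp \<in> C_hoelder \<mu>" unfolding fp_def \<Phi>1_def by (intro A.diff A.const PP)
  have "(\<lambda>x. q_fun k0 x * fp x) \<in> C_hoelder \<mu>" using hp \<mu> k0 by (intro A.mult q_fun_hoelder) auto
  moreover have q: "q_fun k0 x * fp x = (1 - kap k0 * lam_ratio x) * C (lam_ratio x)" for x
    using minus_kap_nonzero[OF k0, of "lam_ratio x"]
    by (simp add: q_lam_ratio[OF k0] fp_def C1(2) C(2))
  moreover have "(\<lambda>z. (1 - kap k0 * z) * C z) \<in> disc_algebra"
  proof -
    have "(\<lambda>z. poly [:1, - kap k0:] z * C z) \<in> disc_algebra" by (intro D.mult poly_disc_algebra C)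
    then show ?thesis by (simp add: mult.commute)
  qed
  ultimately have "(\<lambda>x. q_fun k0 x * fp x) \<in> C_plus \<mu>"
    using C_plusI[of "\<lambda>z. (1 - kap k0 * z) * C z" \<mu>] by simp
  moreover have "fp \<in> C_plus \<mu>" using C_plusI[OF \<open>\<Phi>1 \<in> disc_algebra\<close>, of \<mu>] hp by (simp add: fp_def[abs_def])
  moreover have fm: "fm \<in> C_minus \<mu>" unfolding fm_def using C_minusI[OF PP(2,4)] by (intro M.add M.const)
  moreover have "(\<lambda>x. q_fun k0 x * fm x) \<in> C_minus \<mu>" using fm \<mu> k0 by (intro M.mult q_fun_minus) auto
  moreover have "f x = fm x + fp x" for x by (simp add: PP(5) fm_def fp_def \<Phi>1_def)
  ultimately show ?thesis using that by blast
qed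

section \<open>The commutative matrix algebra of the symbol\<close>

text \<open>The matrix of the commutative algebra of \<open>C_Q\<close> with eigenvalues \<open>u\<close> and \<open>v\<close>, the values of its symbol
  over the two components of \<open>\<Gamma>\<close>.  Working with pairs of eigenvalues turns matrix products into
  products of scalar functions.\<close>

definition sym_mat :: "real \<Rightarrow> rdot \<Rightarrow> complex \<Rightarrow> complex \<Rightarrow> complex^2^2" where
  "sym_mat k0 x u v = mk2 ((u + v) / 2) ((u - v) / (2 * root_q k0 x)) (root_q k0 x * (u - v) / 2) ((u + v) / 2)"

lemma sym_mat_mult:
  assumes "k0 > 1"
  shows "sym_mat k0 x u v ** sym_mat k0 x u' v' = sym_mat k0 x (u * u') (v * v')"
proof -
  define s where "s = root_q k0 x"
  have "s \<noteq> 0" unfolding s_def by (rule root_q_nonzero[OF assms])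
  then have s: "p * p' + m / s * (s * m') = p * p' + m * m'" "p * (m' / s) + m / s * p' = (p * m' + m * p') / s"
    "s * m * p' + p * (s * m') = s * (p * m' + m * p')" "s * m * (m' / s) + p * p' = p * p' + m * m'" for p p' m m' :: complex
    by (simp_all add: field_simps)
  have h: "(u * u' + v * v') / 2 = (u + v) / 2 * ((u' + v') / 2) + (u - v) / 2 * ((u' - v') / 2)"
    "(u * u' - v * v') / 2 = (u + v) / 2 * ((u' - v') / 2) + (u - v) / 2 * ((u' + v') / 2)"
    by (simp_all add: field_simps)
  have r: "a / (2 * s) = a / 2 / s" "s * a / 2 = s * (a / 2)" for a by simp_all
  show ?thesis unfolding sym_mat_def mk2_mult s_def[symmetric] r s h ..
qed

lemma det_sym_mat:
  assumes "k0 > 1" shows "det (sym_mat k0 x u v) = u * v"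
  using root_q_nonzero[OF assms, of x] by (simp add: sym_mat_def field_simps)

lemma sym_mat_scalar: "sym_mat k0 x u u = mk2 u 0 0 u"
  by (simp add: sym_mat_def)

lemma C_Q_sym_mat:
  assumes k0: "k0 > 1" and G: "G \<in> C_Q k0 \<mu>"
  shows "G x = sym_mat k0 x (G x $ 1 $ 1 + root_q k0 x * G x $ 1 $ 2) (G x $ 1 $ 1 - root_q k0 x * G x $ 1 $ 2)"
  using C_Q_form[OF G, of x] root_q_nonzero[OF k0, of x] root_q_square[OF k0, of x, symmetric]
  by (simp add: mat2_eq_iff sym_mat_def power2_eq_square)

lemma exp_unit:
  assumes "fun_algebra A" "\<And>f H. f \<in> A \<Longrightarrow> H holomorphic_on UNIV \<Longrightarrow> (\<lambda>x. H (f x)) \<in> A" "a \<in> A"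
  shows "(\<lambda>x. exp (a x)) \<in> units_of_fun A"
proof -
  have "(\<lambda>x. exp (a x)) \<in> A" by (rule assms(2)[OF assms(3)]) (intro holomorphic_intros)
  moreover have "(\<lambda>x. exp (- a x)) \<in> A" by (rule assms(2)[OF assms(3)]) (intro holomorphic_intros)
  ultimately show ?thesis unfolding units_of_fun_def
    by (auto intro!: bexI[of _ "\<lambda>x. exp (- a x)"] simp flip: exp_add)
qed

text \<open>This is the exponential of \<open>a I + b J\<close>, where \<open>J\<close> has rows \<open>(0, 1)\<close> and \<open>(q, 0)\<close> and square \<open>q I\<close>.  Its entries
  are entire functions of \<open>a\<close>, \<open>b\<close> and \<open>q b\<close>.\<close>

lemma sym_exp_unit:
  assumes k0: "k0 > 1" and A: "fun_algebra A"
    and ent: "\<And>f H. f \<in> A \<Longrightarrow> H holomorphic_on UNIV \<Longrightarrow> (\<lambda>x. H (f x)) \<in> A"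
    and a: "a \<in> A" and b: "b \<in> A" "(\<lambda>x. q_fun k0 x * b x) \<in> A"
  shows "(\<lambda>x. sym_mat k0 x (exp (a x + root_q k0 x * b x)) (exp (a x - root_q k0 x * b x))) \<in> units_of_mat A"
proof -
  interpret fun_algebra A by fact
  define ch where "ch x = cosh_sqrt (q_fun k0 x * b x * b x)" for x
  define sh where "sh x = sinhc_sqrt (q_fun k0 x * b x * b x)" for x
  have qbb: "(\<lambda>x. q_fun k0 x * b x * b x) \<in> A" by (rule mult[OF b(2,1)])
  have ch: "ch \<in> A" unfolding ch_def by (rule ent[OF qbb cosh_sqrt_entire])
  have sh: "sh \<in> A" unfolding sh_def by (rule ent[OF qbb sinhc_sqrt_entire])
  have ea: "(\<lambda>x. exp (a x)) \<in> units_of_fun A" by (rule exp_unit[OF A _ a]) (rule ent)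
  then have ea': "(\<lambda>x. exp (a x)) \<in> A" by (simp add: units_of_fun_def)
  have eq: "sym_mat k0 x (exp (a x + root_q k0 x * b x)) (exp (a x - root_q k0 x * b x)) =
      mk2 (exp (a x) * ch x) (exp (a x) * (b x * sh x)) (exp (a x) * (q_fun k0 x * b x * sh x)) (exp (a x) * ch x)" for x
  proof -
    define s where "s = root_q k0 x"
    have s: "s \<noteq> 0" "s * s = q_fun k0 x"
      using root_q_nonzero[OF k0, of x] root_q_square[OF k0, of x] by (auto simp: s_def power2_eq_square)
    have qb: "q_fun k0 x * b x * b x = (s * b x)\<^sup>2" by (simp add: s(2)[symmetric] power2_eq_square)
    have c: "cosh (s * b x) = ch x" unfolding ch_def qb cosh_sqrt ..
    have h: "sinh (s * b x) = s * b x * sh x" unfolding sh_def qb sinhc_sqrt ..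
    have 1: "(exp (a x + s * b x) + exp (a x - s * b x)) / 2 = exp (a x) * ch x"
      unfolding c[symmetric] by (simp add: cosh_def exp_add exp_diff exp_minus field_simps scaleR_conv_of_real)
    have 2: "(exp (a x + s * b x) - exp (a x - s * b x)) / 2 = exp (a x) * (s * b x * sh x)"
      unfolding h[symmetric] by (simp add: sinh_def exp_add exp_diff exp_minus field_simps scaleR_conv_of_real)
    have 3: "(exp (a x + s * b x) - exp (a x - s * b x)) / (2 * s) = exp (a x) * (b x * sh x)"
      using 2 s(1) by (simp add: field_simps)
    have 4: "s * (exp (a x + s * b x) - exp (a x - s * b x)) / 2 = exp (a x) * (q_fun k0 x * b x * sh x)"
      using 2 unfolding s(2)[symmetric] by (simp add: field_simps)
    show ?thesis unfolding sym_mat_def s_def[symmetric] 1 3 4 ..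
  qed
  show ?thesis
  proof (rule units_of_matI[OF A])
    show "(\<lambda>x. sym_mat k0 x (exp (a x + root_q k0 x * b x)) (exp (a x - root_q k0 x * b x))) \<in> mat_over A"
      unfolding eq mat_over_iff mk2_nth by (intro conjI mult[OF ea'] ch mult[OF b(1) sh] mult[OF b(2) sh])
    have "det (sym_mat k0 x (exp (a x + root_q k0 x * b x)) (exp (a x - root_q k0 x * b x))) = exp (a x) * exp (a x)" for x
      unfolding det_sym_mat[OF k0] by (simp flip: exp_add)
    then show "(\<lambda>x. det (sym_mat k0 x (exp (a x + root_q k0 x * b x)) (exp (a x - root_q k0 x * b x)))) \<in> units_of_fun A"
      using units_of_fun_mult[OF A ea ea] by simp
  qed
qed

lemma C_plus_entire: "0 < \<mu> \<Longrightarrow> f \<in> C_plus \<mu> \<Longrightarrow> H holomorphic_on UNIV \<Longrightarrow> (\<lambda>x. H (f x)) \<in> C_plus \<mu>"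
  and C_minus_entire: "0 < \<mu> \<Longrightarrow> f \<in> C_minus \<mu> \<Longrightarrow> H holomorphic_on UNIV \<Longrightarrow> (\<lambda>x. H (f x)) \<in> C_minus \<mu>"
  by (auto simp: C_plus_def C_minus_def intro: hoelder_entire H_inf_entire)

section \<open>Rational elements of the matrix algebra\<close>

text \<open>The denominators of the rational matrices that occur are powers of \<open>lam_ratio - kap\<close>.\<close>

definition poly_pair :: "real \<Rightarrow> (rdot \<Rightarrow> complex) \<Rightarrow> (rdot \<Rightarrow> complex) \<Rightarrow> bool" where
  "poly_pair k0 u v \<longleftrightarrow> (\<exists>P m. \<forall>x. eval_mat P (lam_ratio x) =
     sym_mat k0 x ((lam_ratio x - kap k0) ^ m * u x) ((lam_ratio x - kap k0) ^ m * v x))"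

lemma poly_pair_mult:
  assumes "k0 > 1" "poly_pair k0 u v" "poly_pair k0 u' v'"
  shows "poly_pair k0 (\<lambda>x. u x * u' x) (\<lambda>x. v x * v' x)"
proof -
  obtain P m P' m' where P: "\<And>x. eval_mat P (lam_ratio x) =
      sym_mat k0 x ((lam_ratio x - kap k0) ^ m * u x) ((lam_ratio x - kap k0) ^ m * v x)"
    "\<And>x. eval_mat P' (lam_ratio x) =
      sym_mat k0 x ((lam_ratio x - kap k0) ^ m' * u' x) ((lam_ratio x - kap k0) ^ m' * v' x)"
    using assms(2,3) unfolding poly_pair_def by blast
  have "eval_mat (P ** P') (lam_ratio x) =
      sym_mat k0 x ((lam_ratio x - kap k0) ^ (m + m') * (u x * u' x)) ((lam_ratio x - kap k0) ^ (m + m') * (v x * v' x))" for x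
    unfolding eval_mat_mult P sym_mat_mult[OF assms(1)] by (simp add: power_add mult_ac)
  then show ?thesis unfolding poly_pair_def by blast
qed

lemma poly_pair_power:
  assumes "k0 > 1" "poly_pair k0 u v"
  shows "poly_pair k0 (\<lambda>x. u x ^ n) (\<lambda>x. v x ^ n)"
proof (induction n)
  case 0
  have "eval_mat (mat 1) (lam_ratio x) = sym_mat k0 x ((lam_ratio x - kap k0) ^ 0 * u x ^ 0) ((lam_ratio x - kap k0) ^ 0 * v x ^ 0)" for x
    by (simp add: sym_mat_scalar mat2_eq_iff mat_def)
  then show ?case unfolding poly_pair_def by blast
next
  case (Suc n)
  then show ?case using poly_pair_mult[OF assms(1,2) Suc] by simp
qed

lemma poly_pair_swap:
  assumes "poly_pair k0 u v" shows "poly_pair k0 v u"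
proof -
  obtain P m where P: "\<And>x. eval_mat P (lam_ratio x) =
      sym_mat k0 x ((lam_ratio x - kap k0) ^ m * u x) ((lam_ratio x - kap k0) ^ m * v x)"
    using assms unfolding poly_pair_def by blast
  define R where "R = mk2 (P $ 1 $ 1) (- (P $ 1 $ 2)) (- (P $ 2 $ 1)) (P $ 2 $ 2)"
  have "eval_mat R (lam_ratio x) = sym_mat k0 x ((lam_ratio x - kap k0) ^ m * v x) ((lam_ratio x - kap k0) ^ m * u x)" for x
    using P[of x] by (simp add: R_def mat2_eq_iff sym_mat_def minus_divide_left algebra_simps)
  then show ?thesis unfolding poly_pair_def by blast
qed

text \<open>This root has no winding, unlike \<open>root_q\<close> itself.\<close>

definition unimodular_root_q :: "real \<Rightarrow> rdot \<Rightarrow> complex" where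
  "unimodular_root_q k0 x = root_q k0 x * lam_ratio x"

lemma root_q_times_unimodular:
  assumes "k0 > 1"
  shows "root_q k0 x * unimodular_root_q k0 x * (lam_ratio x - kap k0) = 1 - kap k0 * lam_ratio x"
proof -
  have "root_q k0 x * unimodular_root_q k0 x = q_fun k0 x * lam_ratio x"
    using root_q_square[OF assms, of x] by (simp add: unimodular_root_q_def power2_eq_square)
  then show ?thesis using minus_kap_nonzero[OF assms, of "lam_ratio x"] by (simp add: q_lam_ratio[OF assms])
qed

text \<open>In the model case \<open>unimodular_root_q = 1\<close> these functions are \<open>z\<close> and \<open>1\<close>.  In general they still have
  the winding numbers 1 and 0, and they are the eigenvalues of a matrix that is rational in \<open>z\<close>.
  Together with their exchange they realize every pair of winding numbers.\<close>

definition wind1 :: "real \<Rightarrow> rdot \<Rightarrow> complex" where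
  "wind1 k0 x = (lam_ratio x * (1 + unimodular_root_q k0 x) + (1 - unimodular_root_q k0 x)) / 2"
definition wind0 :: "real \<Rightarrow> rdot \<Rightarrow> complex" where
  "wind0 k0 x = (lam_ratio x * (1 - unimodular_root_q k0 x) + (1 + unimodular_root_q k0 x)) / 2"

lemma poly_pair_wind:
  assumes "k0 > 1" shows "poly_pair k0 (wind1 k0) (wind0 k0)"
proof -
  define P where "P = mk2 ([:- kap k0, 1:] * [:1/2, 1/2:]) ([:- kap k0, 1:] * [:0, -1/2, 1/2:])
    ([:1, - kap k0:] * [:-1/2, 1/2:]) ([:- kap k0, 1:] * [:1/2, 1/2:])"
  have "eval_mat P (lam_ratio x) = sym_mat k0 x ((lam_ratio x - kap k0) ^ 1 * wind1 k0 x) ((lam_ratio x - kap k0) ^ 1 * wind0 k0 x)" for x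
  proof -
    define z s c where abbr: "z = lam_ratio x" "s = root_q k0 x" "c = z - kap k0"
    have s0: "s \<noteq> 0" unfolding abbr by (rule root_q_nonzero[OF assms])
    have sg: "unimodular_root_q k0 x = s * z" by (simp add: unimodular_root_q_def abbr)
    have sq: "s * (s * z) * c = 1 - kap k0 * z" using root_q_times_unimodular[OF assms, of x] by (simp add: abbr unimodular_root_q_def)
    have w: "wind1 k0 x + wind0 k0 x = z + 1" "wind1 k0 x - wind0 k0 x = s * (z * (z - 1))"
      by (simp_all add: wind1_def wind0_def sg abbr(1)[symmetric] field_simps)
    have 1: "(c * wind1 k0 x + c * wind0 k0 x) / 2 = c * ((z + 1) / 2)" unfolding distrib_left[symmetric] w by simp
    have 2: "(c * wind1 k0 x - c * wind0 k0 x) / (2 * s) = c * (z * (z - 1) / 2)"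
      unfolding right_diff_distrib[symmetric] w using s0 by simp
    have 3: "s * (c * wind1 k0 x - c * wind0 k0 x) / 2 = (1 - kap k0 * z) * ((z - 1) / 2)"
      unfolding right_diff_distrib[symmetric] w sq[symmetric] by (simp add: mult_ac)
    show ?thesis unfolding sym_mat_def abbr(1)[symmetric] abbr(2)[symmetric] abbr(3)[symmetric] power_one_right 1 2 3 mat2_eq_iff
      by (simp add: P_def abbr(3) field_simps)
  qed
  then show ?thesis unfolding poly_pair_def by blast
qed

lemma poly_pair_eps:
  assumes "k0 > 1" shows "poly_pair k0 (\<lambda>x. 1 + \<epsilon> * unimodular_root_q k0 x) (\<lambda>x. 1 - \<epsilon> * unimodular_root_q k0 x)"
proof -
  define P where "P = mk2 [:- kap k0, 1:] ([:- kap k0, 1:] * [:0, \<epsilon>:]) ([:1, - kap k0:] * [:\<epsilon>:]) [:- kap k0, 1:]"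
  have "eval_mat P (lam_ratio x) = sym_mat k0 x ((lam_ratio x - kap k0) ^ 1 * (1 + \<epsilon> * unimodular_root_q k0 x)) ((lam_ratio x - kap k0) ^ 1 * (1 - \<epsilon> * unimodular_root_q k0 x))" for x
  proof -
    define z s c where abbr: "z = lam_ratio x" "s = root_q k0 x" "c = z - kap k0"
    have s0: "s \<noteq> 0" unfolding abbr by (rule root_q_nonzero[OF assms])
    have sg: "unimodular_root_q k0 x = s * z" by (simp add: unimodular_root_q_def abbr)
    have sq: "s * (s * z) * c = 1 - kap k0 * z" using root_q_times_unimodular[OF assms, of x] by (simp add: abbr unimodular_root_q_def)
    have 1: "(c * (1 + \<epsilon> * (s * z)) + c * (1 - \<epsilon> * (s * z))) / 2 = c" by (simp add: field_simps)
    have d: "c * (1 + \<epsilon> * (s * z)) - c * (1 - \<epsilon> * (s * z)) = 2 * (c * \<epsilon> * (s * z))" by (simp add: algebra_simps)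
    have 2: "(c * (1 + \<epsilon> * (s * z)) - c * (1 - \<epsilon> * (s * z))) / (2 * s) = c * (z * \<epsilon>)" unfolding d using s0 by simp
    have 3: "s * (c * (1 + \<epsilon> * (s * z)) - c * (1 - \<epsilon> * (s * z))) / 2 = (1 - kap k0 * z) * \<epsilon>"
      unfolding d sq[symmetric] by (simp add: mult_ac)
    show ?thesis unfolding sym_mat_def sg abbr(1)[symmetric] abbr(2)[symmetric] abbr(3)[symmetric] power_one_right 1 2 3 mat2_eq_iff
      by (simp add: P_def abbr(3) algebra_simps)
  qed
  then show ?thesis unfolding poly_pair_def by blast
qed

lemma unimodular_root_q_hoelder: "k0 > 1 \<Longrightarrow> 0 < \<mu> \<Longrightarrow> \<mu> \<le> 1 \<Longrightarrow> unimodular_root_q k0 \<in> C_hoelder \<mu>"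
  using root_q_lam_hoelder[of k0 \<mu>] by (simp add: unimodular_root_q_def[abs_def])

lemma Re_unimodular_root_q: "k0 > 1 \<Longrightarrow> Re (unimodular_root_q k0 x) > 0"
  using root_q_lam_right_half_plane by (simp add: unimodular_root_q_def)

lemma norm_unimodular_root_q:
  assumes "k0 > 1" shows "norm (unimodular_root_q k0 x) = 1"
proof -
  define z where "z = lam_ratio x"
  have z1: "z * cnj z = 1" using complex_norm_square[of z] by (simp add: z_def)
  have "norm (1 - kap k0 * z) = norm (z - kap k0)"
  proof -
    have "1 - kap k0 * z = z * cnj (z - kap k0)" using z1 by (simp add: right_diff_distrib kap_def mult.commute)
    then have "norm (1 - kap k0 * z) = norm z * norm (z - kap k0)" by (metis complex_mod_cnj norm_mult)
    then show ?thesis by (simp add: z_def)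
  qed
  moreover have "unimodular_root_q k0 x ^ 2 * (z - kap k0) = z * (1 - kap k0 * z)"
  proof -
    have "unimodular_root_q k0 x ^ 2 * (z - kap k0) = z * (root_q k0 x * unimodular_root_q k0 x * (z - kap k0))"
      by (simp only: unimodular_root_q_def power2_eq_square z_def mult_ac)
    then show ?thesis unfolding z_def root_q_times_unimodular[OF assms] .
  qed
  then have "norm (unimodular_root_q k0 x) ^ 2 * norm (z - kap k0) = norm (1 - kap k0 * z)"
    by (metis mult_1 norm_lam_ratio norm_mult norm_power z_def)
  moreover have "z - kap k0 \<noteq> 0" using minus_kap_nonzero[OF assms, of z] by (simp add: z_def)
  ultimately have "norm (unimodular_root_q k0 x) ^ 2 = 1" by simp
  then show ?thesis by (simp add: power2_eq_1_iff) (metis norm_ge_zero neg_0_le_iff_le not_one_le_zero)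
qed

lemma Re_pos_Ln_hoelder:
  assumes "f \<in> C_hoelder \<mu>" "\<mu> > 0" "\<And>x. Re (f x) > 0"
  shows "(\<lambda>x. Ln (f x)) \<in> C_hoelder \<mu>" "exp (Ln (f x)) = f x"
proof -
  have "f x \<notin> \<real>\<^sub>\<le>\<^sub>0" for x using assms(3)[of x] by (auto simp: complex_nonpos_Reals_iff)
  then show "(\<lambda>x. Ln (f x)) \<in> C_hoelder \<mu>" by (intro hoelder_Ln assms)
  have "f x \<noteq> 0" using assms(3)[of x] by auto
  then show "exp (Ln (f x)) = f x" by simp
qed

lemma Re_one_plus_pos: "norm w < 1 \<Longrightarrow> Re (1 + w) > 0"
  using complex_Re_le_cmod[of "- w"] by simp

text \<open>Both functions are \<open>(1 + \<sigma>)/2\<close> times \<open>z (1 + w/z)\<close> or \<open>1 + z w\<close>, where \<open>\<sigma>\<close> is the unimodular root and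
  \<open>w = (1 - \<sigma>)/(1 + \<sigma>)\<close> has modulus below 1 because \<open>\<sigma>\<close> has positive real part.\<close>

lemma wind_logs:
  assumes k0: "k0 > 1" and \<mu>: "0 < \<mu>" "\<mu> \<le> 1"
  obtains j1 j0 where "j1 \<in> C_hoelder \<mu>" "j0 \<in> C_hoelder \<mu>"
    "\<And>x. wind1 k0 x = lam_ratio x * exp (j1 x)" "\<And>x. wind0 k0 x = exp (j0 x)"
proof -
  interpret A: fun_algebra "C_hoelder \<mu>" by (rule fun_algebra_hoelder[OF \<mu>(1)])
  have sg: "unimodular_root_q k0 \<in> C_hoelder \<mu>" by (rule unimodular_root_q_hoelder[OF k0 \<mu>])
  have z: "lam_ratio \<in> C_hoelder \<mu>" by (rule hoelder_lam_ratio[OF \<mu>])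
  have nz: "1 + unimodular_root_q k0 x \<noteq> 0" for x using Re_unimodular_root_q[OF k0, of x] by (auto simp: complex_eq_iff)
  define w where "w x = (1 - unimodular_root_q k0 x) / (1 + unimodular_root_q k0 x)" for x
  have wh: "w \<in> C_hoelder \<mu>" unfolding w_def using nz \<mu> by (intro hoelder_divide A.diff A.add A.const sg) auto
  have nw: "norm (w x) < 1" for x
  proof -
    have "norm (1 - unimodular_root_q k0 x) < norm (1 + unimodular_root_q k0 x)"
      unfolding norm_complex_def using Re_unimodular_root_q[OF k0, of x]
      by (intro real_sqrt_less_mono) (simp add: power2_eq_square algebra_simps)
    then show ?thesis using nz[of x] by (simp add: w_def norm_divide)
  qed
  define h where "h x = (1 + unimodular_root_q k0 x) / 2" for x
  have h: "h \<in> C_hoelder \<mu>" unfolding h_def divide_inverse by (intro A.mult A.add A.const sg)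
  have h0: "Re (h x) > 0" for x using Re_unimodular_root_q[OF k0, of x] by (simp add: h_def)
  define a where "a x = 1 + w x / lam_ratio x" for x
  have a: "a \<in> C_hoelder \<mu>" unfolding a_def using \<mu> by (intro A.add A.const hoelder_divide wh z) auto
  have a0: "Re (a x) > 0" for x unfolding a_def by (rule Re_one_plus_pos) (simp add: norm_divide nw)
  define b where "b x = 1 + lam_ratio x * w x" for x
  have b: "b \<in> C_hoelder \<mu>" unfolding b_def by (intro A.add A.const A.mult wh z)
  have b0: "Re (b x) > 0" for x unfolding b_def by (rule Re_one_plus_pos) (simp add: norm_mult nw)
  have "wind1 k0 x = lam_ratio x * (h x * a x)" "wind0 k0 x = h x * b x" for x
  proof -
    have hw: "(1 + unimodular_root_q k0 x) * w x = 1 - unimodular_root_q k0 x" using nz[of x] by (simp add: w_def)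
    have "lam_ratio x * (h x * a x) = (lam_ratio x * (1 + unimodular_root_q k0 x) + (1 + unimodular_root_q k0 x) * w x) / 2"
      by (simp add: h_def a_def field_simps)
    then show "wind1 k0 x = lam_ratio x * (h x * a x)" unfolding hw wind1_def ..
    have "h x * b x = (lam_ratio x * ((1 + unimodular_root_q k0 x) * w x) + (1 + unimodular_root_q k0 x)) / 2"
      by (simp add: h_def b_def algebra_simps)
    then show "wind0 k0 x = h x * b x" unfolding hw wind0_def ..
  qed
  then have "wind1 k0 x = lam_ratio x * exp (Ln (h x) + Ln (a x))" "wind0 k0 x = exp (Ln (h x) + Ln (b x))" for x
    unfolding exp_add Re_pos_Ln_hoelder(2)[OF h \<mu>(1) h0] Re_pos_Ln_hoelder(2)[OF a \<mu>(1) a0] Re_pos_Ln_hoelder(2)[OF b \<mu>(1) b0] by auto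
  moreover have "(\<lambda>x. Ln (h x) + Ln (a x)) \<in> C_hoelder \<mu>" "(\<lambda>x. Ln (h x) + Ln (b x)) \<in> C_hoelder \<mu>"
    by (intro A.add Re_pos_Ln_hoelder(1) h h0 a a0 b b0 \<mu>)+
  ultimately show ?thesis using that by blast
qed

section \<open>Realization of every obstruction by a rational matrix\<close>

text \<open>Half the difference of the logarithms of the eigenvalues \<open>1 \<plusminus> \<epsilon> \<sigma>\<close>, divided by the root of \<open>q\<close>: the
  coefficient of \<open>J\<close> in the logarithm of the rational matrix with these eigenvalues.\<close>

definition eps_log :: "real \<Rightarrow> complex \<Rightarrow> rdot \<Rightarrow> complex" where
  "eps_log k0 \<epsilon> x = (Ln (1 + \<epsilon> * unimodular_root_q k0 x) - Ln (1 - \<epsilon> * unimodular_root_q k0 x)) / (2 * root_q k0 x)"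

lemma eps_unimodular_root_q_Re:
  assumes "k0 > 1" "norm \<epsilon> < 1"
  shows "Re (1 + \<epsilon> * unimodular_root_q k0 x) > 0" "Re (1 - \<epsilon> * unimodular_root_q k0 x) > 0"
  using Re_one_plus_pos[of "\<epsilon> * unimodular_root_q k0 x"] Re_one_plus_pos[of "- (\<epsilon> * unimodular_root_q k0 x)"] assms
  by (simp_all add: norm_mult norm_unimodular_root_q)

lemma eps_unimodular_root_q_hoelder:
  assumes "k0 > 1" "0 < \<mu>" "\<mu> \<le> 1"
  shows "(\<lambda>x. 1 + \<epsilon> * unimodular_root_q k0 x) \<in> C_hoelder \<mu>" "(\<lambda>x. 1 - \<epsilon> * unimodular_root_q k0 x) \<in> C_hoelder \<mu>"
proof -
  interpret A: fun_algebra "C_hoelder \<mu>" by (rule fun_algebra_hoelder[OF assms(2)])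
  show "(\<lambda>x. 1 + \<epsilon> * unimodular_root_q k0 x) \<in> C_hoelder \<mu>" "(\<lambda>x. 1 - \<epsilon> * unimodular_root_q k0 x) \<in> C_hoelder \<mu>"
    by (intro A.add A.diff A.mult A.const unimodular_root_q_hoelder assms)+
qed

lemma eps_log_hoelder:
  assumes "k0 > 1" "0 < \<mu>" "\<mu> \<le> 1" "norm \<epsilon> < 1"
  shows "eps_log k0 \<epsilon> \<in> C_hoelder \<mu>"
proof -
  interpret A: fun_algebra "C_hoelder \<mu>" by (rule fun_algebra_hoelder[OF assms(2)])
  show ?thesis unfolding eps_log_def
    using root_q_nonzero[OF assms(1)]
    by (intro hoelder_divide A.diff A.mult A.const Re_pos_Ln_hoelder(1) eps_unimodular_root_q_hoelder eps_unimodular_root_q_Re root_q_hoelder assms) auto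
qed

lemma eps_log_derivative:
  assumes "k0 > 1" "norm \<epsilon> < 1"
  shows "((\<lambda>\<epsilon>. eps_log k0 \<epsilon> x) has_field_derivative lam_ratio x / (1 - (\<epsilon> * unimodular_root_q k0 x)\<^sup>2)) (at \<epsilon> within S)"
proof -
  define s where "s = root_q k0 x"
  define g where "g = unimodular_root_q k0 x"
  have s: "s \<noteq> 0" unfolding s_def by (rule root_q_nonzero[OF assms(1)])
  have g: "g = s * lam_ratio x" by (simp add: g_def s_def unimodular_root_q_def)
  have r: "Re (1 + \<epsilon> * g) > 0" "Re (1 - \<epsilon> * g) > 0" using eps_unimodular_root_q_Re[OF assms] by (simp_all add: g_def)
  then have nz: "1 + \<epsilon> * g \<noteq> 0" "1 - \<epsilon> * g \<noteq> 0" by (metis less_irrefl zero_complex.sel(1))+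
  have nr: "1 + \<epsilon> * g \<notin> \<real>\<^sub>\<le>\<^sub>0" "1 - \<epsilon> * g \<notin> \<real>\<^sub>\<le>\<^sub>0" using r by (auto simp: complex_nonpos_Reals_iff)
  have "((\<lambda>\<epsilon>. (Ln (1 + \<epsilon> * g) - Ln (1 - \<epsilon> * g)) / (2 * s)) has_field_derivative
      (g / (1 + \<epsilon> * g) + g / (1 - \<epsilon> * g)) / (2 * s)) (at \<epsilon> within S)"
    using nr s by (auto intro!: derivative_eq_intros simp: field_simps)
  moreover have "(g / (1 + \<epsilon> * g) + g / (1 - \<epsilon> * g)) / (2 * s) = lam_ratio x / (1 - (\<epsilon> * g)\<^sup>2)"
  proof -
    have "1 - (\<epsilon> * g)\<^sup>2 = (1 + \<epsilon> * g) * (1 - \<epsilon> * g)" by (simp add: power2_eq_square algebra_simps)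
    moreover have "g / (1 + \<epsilon> * g) + g / (1 - \<epsilon> * g) = 2 * g / ((1 + \<epsilon> * g) * (1 - \<epsilon> * g))"
      using nz by (simp add: divide_simps) (simp add: algebra_simps)
    ultimately show ?thesis using s by (simp add: g)
  qed
  ultimately show ?thesis unfolding eps_log_def s_def[symmetric] g_def[symmetric] by simp
qed

lemma obstruction_eps_log_derivative:
  assumes k0: "k0 > 1" and w: "norm w < 1" and e: "norm \<epsilon> < 1"
  shows "((\<lambda>\<epsilon>. cauchy_int (eps_log k0 \<epsilon>) w) has_field_derivative
     cauchy_int (\<lambda>x. lam_ratio x / (1 - (\<epsilon> * unimodular_root_q k0 x)\<^sup>2)) w) (at \<epsilon>)"
proof -
  have \<mu>: "(0::real) < 1/2" "(1/2::real) \<le> 1" by auto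
  let ?f = "\<lambda>\<epsilon> t. eps_log k0 \<epsilon> (circle_pt (cis t)) / (1 - w * cis (- t))"
  let ?d = "\<lambda>\<epsilon> t. lam_ratio (circle_pt (cis t)) / (1 - (\<epsilon> * unimodular_root_q k0 (circle_pt (cis t)))\<^sup>2) / (1 - w * cis (- t))"
  have nz: "1 - (u * unimodular_root_q k0 x)\<^sup>2 \<noteq> 0" if "norm u < 1" for u x
  proof
    assume "1 - (u * unimodular_root_q k0 x)\<^sup>2 = 0"
    then have "norm ((u * unimodular_root_q k0 x)\<^sup>2) = 1" by (metis eq_iff_diff_eq_0 norm_one)
    then have "norm u ^ 2 = 1" by (simp add: norm_power norm_mult norm_unimodular_root_q[OF k0])
    then show False using that by (simp add: power2_eq_1_iff) (metis norm_ge_zero neg_0_le_iff_le not_one_le_zero)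
  qed
  \<comment> \<open>differentiation under the integral sign\<close>
  have "((\<lambda>\<epsilon>. integral (cbox 0 (2 * pi)) (?f \<epsilon>)) has_field_derivative integral (cbox 0 (2 * pi)) (?d \<epsilon>)) (at \<epsilon> within ball 0 1)"
  proof (rule leibniz_rule_field_derivative)
    show "((\<lambda>\<epsilon>. ?f \<epsilon> t) has_field_derivative ?d u t) (at u within ball 0 1)" if "u \<in> ball 0 1" for u t
      using that by (intro DERIV_cdivide eps_log_derivative[OF k0]) simp
    show "?f u integrable_on cbox 0 (2 * pi)" if "u \<in> ball 0 1" for u
      using cauchy_int_integrable[OF eps_log_hoelder[OF k0 \<mu>, of u] \<mu>(1) w] that by simp
    have "continuous_on UNIV (\<lambda>t. unimodular_root_q k0 (circle_pt (cis t)))"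
      by (rule continuous_circle_trace[OF unimodular_root_q_hoelder[OF k0 \<mu>] \<mu>(1)])
    then have "continuous_on (ball 0 1 \<times> cbox 0 (2 * pi)) (\<lambda>p. unimodular_root_q k0 (circle_pt (cis (snd p))))"
      by (rule continuous_on_compose2) (auto intro!: continuous_intros)
    then show "continuous_on (ball 0 1 \<times> cbox 0 (2 * pi)) (\<lambda>(u, t). ?d u t)"
      unfolding split_beta using nz circle_kernel_nonzero[OF w]
      by (intro continuous_intros) (auto intro!: continuous_intros)
  qed (use e in auto)
  then have "((\<lambda>\<epsilon>. integral {0..2 * pi} (?f \<epsilon>)) has_field_derivative integral {0..2 * pi} (?d \<epsilon>)) (at \<epsilon>)"
    using at_within_open[of \<epsilon> "ball 0 1"] e by simp
  then show ?thesis unfolding cauchy_int_def by (rule DERIV_cdivide)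
qed

text \<open>The obstruction of this family is holomorphic in \<open>\<epsilon>\<close>, zero at \<open>\<epsilon> = 0\<close>, and has the derivative
  \<open>- kap\<close> there.  By the open mapping theorem it takes all small values, and every complex number is
  a multiple of a small one.\<close>

lemma obstruction_realized:
  assumes k0: "k0 > 1"
  obtains \<epsilon> and n :: nat where "norm \<epsilon> < 1" "of_nat n * obstruction k0 (eps_log k0 \<epsilon>) = c"
proof -
  define L where "L \<epsilon> = obstruction k0 (eps_log k0 \<epsilon>)" for \<epsilon>
  define L' where "L' \<epsilon> = obstruction k0 (\<lambda>x. lam_ratio x / (1 - (\<epsilon> * unimodular_root_q k0 x)\<^sup>2))" for \<epsilon>
  have der: "(L has_field_derivative L' \<epsilon>) (at \<epsilon>)" if "norm \<epsilon> < 1" for \<epsilon>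
    unfolding L_def[abs_def] L'_def obstruction_def
    by (intro DERIV_diff obstruction_eps_log_derivative k0 that kap_bounds) auto
  have L0: "L 0 = 0"
  proof -
    have "eps_log k0 0 = (\<lambda>x. 0)" by (simp add: eps_log_def fun_eq_iff)
    then show ?thesis using cauchy_int_const[of 0 0] cauchy_int_const[OF kap_bounds(1)[OF k0], of 0]
      by (simp add: L_def obstruction_def)
  qed
  have L'0: "L' 0 = - kap k0"
    using cauchy_int_entire[of "\<lambda>z. z" 0] cauchy_int_entire[of "\<lambda>z. z" "kap k0"] kap_bounds(1)[OF k0]
    by (simp add: L'_def obstruction_def)
  have holo: "L holomorphic_on ball 0 1"
    unfolding holomorphic_on_open[OF open_ball] by (metis der mem_ball_0)
  have "\<not> L constant_on ball 0 1"
  proof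
    assume "L constant_on ball 0 1"
    then obtain d where d: "\<And>z. z \<in> ball 0 1 \<Longrightarrow> L z = d" by (auto simp: constant_on_def)
    have "(L has_field_derivative 0) (at 0)"
      by (rule has_field_derivative_transform_within_open[of "\<lambda>_. d" _ _ "ball 0 1"]) (auto simp: d)
    from DERIV_unique[OF der this] show False using L'0 kap_bounds(2)[OF k0] by simp
  qed
  then have "open (L ` ball 0 1)" by (intro open_mapping_thm[OF holo]) auto
  moreover have "0 \<in> L ` ball 0 1" using L0 by (metis centre_in_ball imageI zero_less_one)
  ultimately obtain d where d: "d > 0" "ball 0 d \<subseteq> L ` ball 0 1" by (metis openE)
  obtain n where n: "norm c / d < real n" using reals_Archimedean2 by blast
  have n0: "n > 0" using n d by (metis divide_nonneg_pos gr0I norm_ge_zero not_less of_nat_0)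
  have "c / of_nat n \<in> ball 0 d" using n d n0 by (simp add: norm_divide field_simps)
  then obtain \<epsilon> where "norm \<epsilon> < 1" "L \<epsilon> = c / of_nat n" using d(2) by (metis (no_types, lifting) imageE mem_ball_0 subsetD)
  then show ?thesis using that[of \<epsilon> n] n0 by (simp add: L_def)
qed

lemma obstruction_diff:
  assumes k0: "k0 > 1" and "0 < \<mu>" and f: "f \<in> C_hoelder \<mu>" and g: "g \<in> C_hoelder \<mu>"
  shows "obstruction k0 (\<lambda>x. f x - c * g x) = obstruction k0 f - c * obstruction k0 g"
proof -
  interpret A: fun_algebra "C_hoelder \<mu>" by (rule fun_algebra_hoelder) fact
  have cg: "(\<lambda>x. (- c) * g x) \<in> C_hoelder \<mu>" using g by (intro A.mult A.const)
  have "cauchy_int (\<lambda>x. f x - c * g x) w = cauchy_int f w - c * cauchy_int g w" if "norm w < 1" for w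
    using cauchy_int_add[OF f cg assms(2) that] cauchy_int_scale[of "- c" g w] by simp
  then show ?thesis using kap_bounds(1)[OF k0] by (simp add: obstruction_def algebra_simps)
qed

section \<open>The factorization\<close>

lemma lam_power_plus_minus:
  assumes "0 < \<mu>" "\<mu> \<le> 1"
  shows "(\<lambda>x. lam_ratio x ^ n) \<in> C_plus \<mu>" "(\<lambda>x. inverse (lam_ratio x) ^ n) \<in> C_minus \<mu>"
  using fun_algebra.power[OF fun_algebra_C_plus[OF assms(1)] poly_lam_plus(1)[OF assms, of "[:0, 1:]"]]
    fun_algebra.power[OF fun_algebra_C_minus[OF assms(1)] poly_lam_plus(2)[OF assms, of "[:0, 1:]"]] by simp_all

text \<open>Two factorizations of indices \<open>m > n\<close> would identify a unit of \<open>C_plus\<close> with \<open>1/z\<close> times an element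
  of \<open>C_minus\<close>.\<close>

lemma scalar_index_le:
  assumes \<mu>: "0 < \<mu>" "\<mu> \<le> 1"
    and u: "um \<in> units_of_fun (C_minus \<mu>)" "up \<in> units_of_fun (C_plus \<mu>)"
    and v: "vm \<in> units_of_fun (C_minus \<mu>)" "vp \<in> units_of_fun (C_plus \<mu>)"
    and eq: "\<And>x. um x * lam_ratio x powi m * up x = vm x * lam_ratio x powi n * vp x"
  shows "m \<le> n"
proof (rule ccontr)
  assume "\<not> m \<le> n"
  then obtain d where d: "m = n + 1 + int d" by (metis add.commute add.assoc int_one_le_iff_zero_less not_le zle_iff_zadd zless_imp_add1_zle)
  interpret P: fun_algebra "C_plus \<mu>" by (rule fun_algebra_C_plus[OF \<mu>(1)])
  interpret M: fun_algebra "C_minus \<mu>" by (rule fun_algebra_C_minus[OF \<mu>(1)])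
  obtain um' where um': "um' \<in> C_minus \<mu>" "\<And>x. um x * um' x = 1" using u(1) by (auto simp: units_of_fun_def)
  obtain vp' where vp': "vp' \<in> C_plus \<mu>" "\<And>x. vp x * vp' x = 1" using v(2) by (auto simp: units_of_fun_def)
  have upm: "up \<in> C_plus \<mu>" "vm \<in> C_minus \<mu>" using u(2) v(1) by (auto simp: units_of_fun_def)
  define f where "f = (\<lambda>x. up x * vp' x)"
  define h where "h = (\<lambda>x. inverse (lam_ratio x) ^ d * (vm x * um' x))"
  have "f \<in> C_plus \<mu>" unfolding f_def by (intro P.mult upm vp')
  moreover have "h \<in> C_minus \<mu>" unfolding h_def by (intro M.mult upm um' lam_power_plus_minus \<mu>)
  moreover have "f x = inverse (lam_ratio x) * h x" for x
  proof -
    let ?z = "lam_ratio x"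
    have zm: "?z powi m = ?z powi n * (?z * ?z ^ d)"
      unfolding d by (simp add: power_int_add)
    have "?z powi n * (?z * ?z ^ d) * (um x * up x) = ?z powi n * (vm x * vp x)"
      using eq[of x] unfolding zm by (simp add: mult_ac)
    then have "(?z * ?z ^ d) * (um x * up x) = vm x * vp x" by (simp add: mult.assoc)
    then have "(?z * ?z ^ d) * (um x * up x) * (um' x * vp' x) = vm x * vp x * (um' x * vp' x)" by simp
    then have "(?z * ?z ^ d) * (um x * um' x) * (up x * vp' x) = (vm x * um' x) * (vp x * vp' x)" by (simp only: mult_ac)
    then have "(?z * ?z ^ d) * f x = vm x * um' x" by (simp add: um' vp' f_def)
    moreover have "?z * ?z ^ d \<noteq> 0" by simp
    ultimately have "f x = (vm x * um' x) / (?z * ?z ^ d)" by (simp add: field_simps)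
    then show ?thesis unfolding h_def by (simp add: divide_inverse power_inverse mult_ac)
  qed
  ultimately have "f x = 0" for x using plus_eq_inverse_lam_minus[OF \<mu>(1)] by blast
  moreover have "f x \<noteq> 0" for x
    using u(2) vp'(2)[of x] unfolding f_def units_of_fun_def by (auto, metis mult_zero_left zero_neq_one)
  ultimately show False by blast
qed

lemma det_unit:
  assumes "fun_algebra A" "M \<in> units_of_mat A"
  shows "(\<lambda>x. det (M x)) \<in> units_of_fun A"
proof -
  interpret fun_algebra A by fact
  obtain N where N: "N \<in> mat_over A" "\<And>x. M x ** N x = mat 1" "M \<in> mat_over A"
    using assms(2) by (auto simp: units_of_mat_def)
  have d: "(\<lambda>x. det (K x)) \<in> A" if "K \<in> mat_over A" for K
    using that unfolding det_2 mat_over_iff by (intro diff mult) auto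
  have "det (M x) * det (N x) = 1" for x using N(2)[of x] by (metis det_I det_matmul2)
  then show ?thesis unfolding units_of_fun_def using d[OF N(3)] d[OF N(1)]
    by (auto intro!: bexI[of _ "\<lambda>x. det (N x)"])
qed

text \<open>Winding numbers and the obstruction are carried by the rational pair \<open>(u, v)\<close>: the powers of
  \<open>wind1\<close> and \<open>wind0\<close> have the winding numbers of \<open>g1\<close> and \<open>g2\<close>, and the power of
  \<open>1 \<plusminus> \<epsilon> \<sigma>\<close> cancels the obstruction.  What is left has Hoelder logarithms, and these split.
  The factor \<open>z ^ N\<close> makes negative winding numbers nonnegative.\<close>

lemma symmetric_pair_decomposition:
  assumes k0: "k0 > 1" and \<mu>: "0 < \<mu>" "\<mu> < 1" and gh: "g1 \<in> C_hoelder \<mu>" "g2 \<in> C_hoelder \<mu>"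
    and gnz: "\<And>x. g1 x \<noteq> 0" "\<And>x. g2 x \<noteq> 0"
  obtains N Cm Cp Bm Bp u v where "Cm \<in> C_minus \<mu>" "Cp \<in> C_plus \<mu>" "Bm \<in> C_minus \<mu>" "Bp \<in> C_plus \<mu>"
    "(\<lambda>x. q_fun k0 x * Bm x) \<in> C_minus \<mu>" "(\<lambda>x. q_fun k0 x * Bp x) \<in> C_plus \<mu>" "poly_pair k0 u v"
    "\<And>x. lam_ratio x ^ N * g1 x = exp (Cm x + root_q k0 x * Bm x) * u x * exp (Cp x + root_q k0 x * Bp x)"
    "\<And>x. lam_ratio x ^ N * g2 x = exp (Cm x - root_q k0 x * Bm x) * v x * exp (Cp x - root_q k0 x * Bp x)"
proof -
  have \<mu>1: "\<mu> \<le> 1" using \<mu> by simp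
  interpret A: fun_algebra "C_hoelder \<mu>" by (rule fun_algebra_hoelder[OF \<mu>(1)])
  let ?s = "root_q k0" and ?z = lam_ratio
  obtain n1 l1 where l1: "l1 \<in> C_hoelder \<mu>" "\<And>x. g1 x = ?z x powi n1 * exp (l1 x)"
    using hoelder_power_times_exp[OF gh(1) \<mu>(1) \<mu>1 gnz(1)] by metis
  obtain n2 l2 where l2: "l2 \<in> C_hoelder \<mu>" "\<And>x. g2 x = ?z x powi n2 * exp (l2 x)"
    using hoelder_power_times_exp[OF gh(2) \<mu>(1) \<mu>1 gnz(2)] by metis
  obtain j1 j0 where j: "j1 \<in> C_hoelder \<mu>" "j0 \<in> C_hoelder \<mu>"
    "\<And>x. wind1 k0 x = ?z x * exp (j1 x)" "\<And>x. wind0 k0 x = exp (j0 x)"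
    using wind_logs[OF k0 \<mu>(1) \<mu>1] by metis
  \<comment> \<open>the exponents \<open>n1 + N\<close> and \<open>n2 + N\<close> are natural numbers\<close>
  define N where "N = max (nat (- n1)) (nat (- n2))"
  define a where "a = nat (n1 + int N)"
  define b where "b = nat (n2 + int N)"
  have ab: "int a = n1 + int N" "int b = n2 + int N" by (auto simp: a_def b_def N_def)
  \<comment> \<open>the logarithms that remain when the winding factors are divided out\<close>
  define r1 where "r1 = (\<lambda>x. l1 x - of_nat a * j1 x - of_nat b * j0 x)"
  define r2 where "r2 = (\<lambda>x. l2 x - of_nat a * j0 x - of_nat b * j1 x)"
  have rh: "r1 \<in> C_hoelder \<mu>" "r2 \<in> C_hoelder \<mu>"
    unfolding r1_def r2_def by (intro A.diff A.mult A.const l1 l2 j)+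
  have powi: "?z x ^ a = ?z x powi n1 * ?z x ^ N" "?z x ^ b = ?z x powi n2 * ?z x ^ N" for x
    using ab by (simp_all flip: power_int_of_nat add: power_int_add[symmetric])
  have g1f: "?z x ^ N * g1 x = wind1 k0 x ^ a * wind0 k0 x ^ b * exp (r1 x)" for x
  proof -
    have "wind1 k0 x ^ a * wind0 k0 x ^ b * exp (r1 x) = ?z x ^ a * (exp (of_nat a * j1 x) * exp (of_nat b * j0 x) * exp (r1 x))"
      by (simp add: j power_mult_distrib exp_of_nat_mult mult_ac)
    also have "exp (of_nat a * j1 x) * exp (of_nat b * j0 x) * exp (r1 x) = exp (l1 x)"
      by (simp add: r1_def flip: exp_add)
    finally show ?thesis by (simp add: l1(2) powi mult_ac)
  qed
  have g2f: "?z x ^ N * g2 x = wind0 k0 x ^ a * wind1 k0 x ^ b * exp (r2 x)" for x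
  proof -
    have "wind0 k0 x ^ a * wind1 k0 x ^ b * exp (r2 x) = ?z x ^ b * (exp (of_nat a * j0 x) * exp (of_nat b * j1 x) * exp (r2 x))"
      by (simp add: j power_mult_distrib exp_of_nat_mult mult_ac)
    also have "exp (of_nat a * j0 x) * exp (of_nat b * j1 x) * exp (r2 x) = exp (l2 x)"
      by (simp add: r2_def flip: exp_add)
    finally show ?thesis by (simp add: l2(2) powi mult_ac)
  qed
  \<comment> \<open>the coefficient of \<open>J\<close> in the remaining logarithm; only this one is obstructed\<close>
  define \<beta> where "\<beta> = (\<lambda>x. (r1 x - r2 x) / (2 * ?s x))"
  have snz: "?s x \<noteq> 0" for x by (rule root_q_nonzero[OF k0])
  have \<beta>: "\<beta> \<in> C_hoelder \<mu>" unfolding \<beta>_def using snz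
    by (intro hoelder_divide A.diff A.mult A.const rh root_q_hoelder k0 \<mu> \<mu>1) auto
  obtain \<epsilon> n where \<epsilon>: "norm \<epsilon> < 1" "of_nat n * obstruction k0 (eps_log k0 \<epsilon>) = obstruction k0 \<beta>"
    by (rule obstruction_realized[OF k0])
  have eh: "eps_log k0 \<epsilon> \<in> C_hoelder \<mu>" by (rule eps_log_hoelder[OF k0 \<mu>(1) \<mu>1 \<epsilon>(1)])
  define p1 where "p1 = (\<lambda>x. Ln (1 + \<epsilon> * unimodular_root_q k0 x))"
  define p2 where "p2 = (\<lambda>x. Ln (1 - \<epsilon> * unimodular_root_q k0 x))"
  have ph: "p1 \<in> C_hoelder \<mu>" "p2 \<in> C_hoelder \<mu>" unfolding p1_def p2_def
    by (intro Re_pos_Ln_hoelder(1) eps_unimodular_root_q_hoelder eps_unimodular_root_q_Re k0 \<mu> \<mu>1 \<epsilon>)+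
  have pe: "exp (p1 x) = 1 + \<epsilon> * unimodular_root_q k0 x" "exp (p2 x) = 1 - \<epsilon> * unimodular_root_q k0 x" for x
    unfolding p1_def p2_def
    by (rule Re_pos_Ln_hoelder(2)[OF eps_unimodular_root_q_hoelder(1)[OF k0 \<mu>(1) \<mu>1] \<mu>(1) eps_unimodular_root_q_Re(1)[OF k0 \<epsilon>(1)]],
        rule Re_pos_Ln_hoelder(2)[OF eps_unimodular_root_q_hoelder(2)[OF k0 \<mu>(1) \<mu>1] \<mu>(1) eps_unimodular_root_q_Re(2)[OF k0 \<epsilon>(1)]])
  define B where "B = (\<lambda>x. \<beta> x - of_nat n * eps_log k0 \<epsilon> x)"
  define C where "C = (\<lambda>x. (r1 x + r2 x) / 2 - of_nat n * ((p1 x + p2 x) / 2))"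
  have Bh: "B \<in> C_hoelder \<mu>" unfolding B_def by (intro A.diff A.mult A.const \<beta> eh)
  have Ch: "C \<in> C_hoelder \<mu>" unfolding C_def divide_inverse by (intro A.diff A.add A.mult A.const rh ph)
  have "obstruction k0 B = 0" unfolding B_def obstruction_diff[OF k0 \<mu>(1) \<beta> eh] \<epsilon>(2) by simp
  then obtain Bm Bp where BB: "Bm \<in> C_minus \<mu>" "Bp \<in> C_plus \<mu>" "(\<lambda>x. q_fun k0 x * Bm x) \<in> C_minus \<mu>"
    "(\<lambda>x. q_fun k0 x * Bp x) \<in> C_plus \<mu>" "\<And>x. B x = Bm x + Bp x"
    by (rule unobstructed_splitting[OF k0 \<mu> Bh]) blast
  obtain Cm Cp where CC: "Cm \<in> C_minus \<mu>" "Cp \<in> C_plus \<mu>" "\<And>x. C x = Cm x + Cp x"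
  proof -
    obtain \<Phi> \<Psi> where "\<Phi> \<in> disc_algebra" "\<Psi> \<in> disc_algebra"
      "(\<lambda>x. \<Phi> (?z x)) \<in> C_hoelder \<mu>" "(\<lambda>x. \<Psi> (inverse (?z x))) \<in> C_hoelder \<mu>"
      "\<And>x. C x = \<Phi> (?z x) + \<Psi> (inverse (?z x))"
      by (rule Privalov_decomposition[OF Ch \<mu>]) blast
    then show ?thesis using that[of "\<lambda>x. \<Psi> (inverse (?z x))" "\<lambda>x. \<Phi> (?z x)"]
      by (simp add: C_plusI C_minusI add.commute)
  qed
  have cancel: "s * (c / (2 * s) - k * (d / (2 * s))) = c / 2 - k * (d / 2)" if "s \<noteq> 0" for s c d k :: complex
    using that by (simp add: field_simps)
  have r1e: "r1 x = (Cm x + ?s x * Bm x) + of_nat n * p1 x + (Cp x + ?s x * Bp x)" for x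
  proof -
    have "?s x * B x = (r1 x - r2 x) / 2 - of_nat n * ((p1 x - p2 x) / 2)"
      unfolding B_def \<beta>_def eps_log_def p1_def p2_def by (rule cancel[OF snz])
    then have "C x + ?s x * B x + of_nat n * p1 x = r1 x" by (simp add: C_def field_simps)
    then show ?thesis unfolding BB(5) CC(3) by (simp add: algebra_simps)
  qed
  have r2e: "r2 x = (Cm x - ?s x * Bm x) + of_nat n * p2 x + (Cp x - ?s x * Bp x)" for x
  proof -
    have "?s x * B x = (r1 x - r2 x) / 2 - of_nat n * ((p1 x - p2 x) / 2)"
      unfolding B_def \<beta>_def eps_log_def p1_def p2_def by (rule cancel[OF snz])
    then have "C x - ?s x * B x + of_nat n * p2 x = r2 x" by (simp add: C_def field_simps)
    then show ?thesis unfolding BB(5) CC(3) by (simp add: algebra_simps)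
  qed
  define u where "u = (\<lambda>x. wind1 k0 x ^ a * wind0 k0 x ^ b * (1 + \<epsilon> * unimodular_root_q k0 x) ^ n)"
  define v where "v = (\<lambda>x. wind0 k0 x ^ a * wind1 k0 x ^ b * (1 - \<epsilon> * unimodular_root_q k0 x) ^ n)"
  have zg: "?z x ^ N * g1 x = exp (Cm x + ?s x * Bm x) * u x * exp (Cp x + ?s x * Bp x)"
    "?z x ^ N * g2 x = exp (Cm x - ?s x * Bm x) * v x * exp (Cp x - ?s x * Bp x)" for x
    unfolding g1f g2f r1e r2e u_def v_def exp_add exp_of_nat_mult pe by (simp_all add: mult_ac)
  have "poly_pair k0 u v" unfolding u_def v_def
    by (intro poly_pair_mult poly_pair_power poly_pair_wind poly_pair_eps poly_pair_swap[OF poly_pair_wind] k0)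
  then show ?thesis using CC(1,2) BB(1-4) zg by (intro that)
qed

text \<open>The exponential factors commute with the rational one, as all three belong to the algebra of
  \<open>C_Q\<close>.  The minus factor can therefore stand on the left and the plus factor on the right, and
  the polynomial matrix in the middle is factored algebraically.  The denominators
  \<open>z - kap = z (1 - kap / z)\<close> contribute powers of \<open>z\<close> and units of \<open>C_minus\<close>.\<close>

theorem symmetric_factorization_exists:
  assumes k0: "k0 > 1" and \<mu>: "0 < \<mu>" "\<mu> < 1" and G: "G \<in> C_Q k0 \<mu>"
  obtains Gm Gp k1 k2 where "bounded_factorization \<mu> G Gm Gp k1 k2"
proof -
  have \<mu>1: "\<mu> \<le> 1" using \<mu> by simp
  interpret A: fun_algebra "C_hoelder \<mu>" by (rule fun_algebra_hoelder[OF \<mu>(1)])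
  let ?s = "root_q k0" and ?z = lam_ratio
  have Gent: "(\<lambda>x. G x $ i $ j) \<in> C_hoelder \<mu>" for i j using G by (auto simp: C_Q_def units_of_mat_def mat_over_def)
  define g1 where "g1 = (\<lambda>x. G x $ 1 $ 1 + ?s x * G x $ 1 $ 2)"
  define g2 where "g2 = (\<lambda>x. G x $ 1 $ 1 - ?s x * G x $ 1 $ 2)"
  have Gs: "G x = sym_mat k0 x (g1 x) (g2 x)" for x unfolding g1_def g2_def by (rule C_Q_sym_mat[OF k0 G])
  have gh: "g1 \<in> C_hoelder \<mu>" "g2 \<in> C_hoelder \<mu>"
    unfolding g1_def g2_def by (intro A.add A.diff A.mult Gent root_q_hoelder k0 \<mu> \<mu>1)+
  have "(\<lambda>x. det (G x)) \<in> units_of_fun (C_hoelder \<mu>)"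
    using G by (intro det_unit fun_algebra_hoelder \<mu>) (simp add: C_Q_def)
  then have "det (G x) \<noteq> 0" for x unfolding units_of_fun_def by (auto, metis mult_zero_left zero_neq_one)
  then have gnz: "g1 x \<noteq> 0" "g2 x \<noteq> 0" for x unfolding Gs det_sym_mat[OF k0] by auto
  obtain N Cm Cp Bm Bp u v where CC: "Cm \<in> C_minus \<mu>" "Cp \<in> C_plus \<mu>" and BB: "Bm \<in> C_minus \<mu>" "Bp \<in> C_plus \<mu>"
    "(\<lambda>x. q_fun k0 x * Bm x) \<in> C_minus \<mu>" "(\<lambda>x. q_fun k0 x * Bp x) \<in> C_plus \<mu>" and pair: "poly_pair k0 u v"
    and zg: "\<And>x. ?z x ^ N * g1 x = exp (Cm x + ?s x * Bm x) * u x * exp (Cp x + ?s x * Bp x)"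
    "\<And>x. ?z x ^ N * g2 x = exp (Cm x - ?s x * Bm x) * v x * exp (Cp x - ?s x * Bp x)"
    by (rule symmetric_pair_decomposition[OF k0 \<mu> gh gnz]) blast
  define Em where "Em x = sym_mat k0 x (exp (Cm x + ?s x * Bm x)) (exp (Cm x - ?s x * Bm x))" for x
  define Ep where "Ep x = sym_mat k0 x (exp (Cp x + ?s x * Bp x)) (exp (Cp x - ?s x * Bp x))" for x
  have Em: "Em \<in> units_of_mat (C_minus \<mu>)" unfolding Em_def[abs_def]
    by (rule sym_exp_unit[OF k0 fun_algebra_C_minus[OF \<mu>(1)] _ CC(1) BB(1,3)]) (rule C_minus_entire[OF \<mu>(1)])
  have Ep: "Ep \<in> units_of_mat (C_plus \<mu>)" unfolding Ep_def[abs_def]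
    by (rule sym_exp_unit[OF k0 fun_algebra_C_plus[OF \<mu>(1)] _ CC(2) BB(2,4)]) (rule C_plus_entire[OF \<mu>(1)])
  obtain P m where P: "\<And>x. eval_mat P (?z x) = sym_mat k0 x ((?z x - kap k0) ^ m * u x) ((?z x - kap k0) ^ m * v x)"
    using pair unfolding poly_pair_def by blast
  have uv: "u x \<noteq> 0" "v x \<noteq> 0" for x using zg[of x] gnz[of x] by auto
  have knz: "?z x - kap k0 \<noteq> 0" for x by (rule minus_kap_nonzero[OF k0]) simp
  have "poly (det P) z \<noteq> 0" if "norm z = 1" for z
  proof -
    have "det (eval_mat P (?z (circle_pt z))) \<noteq> 0" unfolding P det_sym_mat[OF k0] using uv knz by simp
    then show ?thesis using that by (simp add: det_eval_mat)
  qed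
  then obtain Pm Pp k l where PP: "Pm \<in> units_of_mat (C_minus \<mu>)" "Pp \<in> units_of_mat (C_plus \<mu>)"
    "\<And>x. eval_mat P (?z x) = Pm x ** mk2 (?z x ^ k) 0 0 (?z x ^ l) ** Pp x"
    using polynomial_matrix_factorization[OF \<mu>(1) \<mu>1, of P] by metis
  define t where "t x = inverse ((1 - kap k0 * inverse (?z x)) ^ m)" for x
  have tnz: "1 - kap k0 * inverse (?z x) \<noteq> 0" for x by (rule one_minus_kap_nonzero[OF k0]) (simp add: norm_inverse)
  have t: "(\<lambda>x. mk2 (t x) 0 0 (t x)) \<in> units_of_mat (C_minus \<mu>)"
  proof -
    let ?p = "\<lambda>w. poly [:1, - kap k0:] w ^ m"
    have pn: "?p w \<noteq> 0" if "norm w \<le> 1" for w using one_minus_kap_nonzero[OF k0 that] by (simp add: mult.commute)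
    have "(\<lambda>w. inverse (?p w)) \<in> disc_algebra"
      by (rule disc_algebra_inverse[OF fun_algebra.power[OF fun_algebra_disc_algebra poly_disc_algebra] pn])
    moreover have "(\<lambda>x. inverse (?p (inverse (?z x)))) \<in> C_hoelder \<mu>"
      by (intro hoelder_inverse A.power poly_lam_hoelder \<mu> \<mu>1 pn) (simp add: norm_inverse)
    ultimately have "(\<lambda>x. inverse (?p (inverse (?z x)))) \<in> units_of_fun (C_minus \<mu>)"
      using pn by (intro C_minus_unitI[OF \<mu>(1), of "\<lambda>w. inverse (?p w)"]) auto
    moreover have "(\<lambda>x. inverse (?p (inverse (?z x)))) = t" by (simp add: t_def fun_eq_iff mult.commute)
    ultimately have tu: "t \<in> units_of_fun (C_minus \<mu>)" by simp
    show ?thesis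
    proof (rule units_of_matI[OF fun_algebra_C_minus[OF \<mu>(1)]])
      show "(\<lambda>x. mk2 (t x) 0 0 (t x)) \<in> mat_over (C_minus \<mu>)"
        using tu fun_algebra.const[OF fun_algebra_C_minus[OF \<mu>(1)]] by (simp add: mat_over_iff units_of_fun_def)
      show "(\<lambda>x. det (mk2 (t x) 0 0 (t x))) \<in> units_of_fun (C_minus \<mu>)"
        using units_of_fun_mult[OF fun_algebra_C_minus[OF \<mu>(1)] tu tu] by simp
    qed
  qed
  define Gm where "Gm = (\<lambda>x. Em x ** (mk2 (t x) 0 0 (t x) ** Pm x))"
  define Gp where "Gp = (\<lambda>x. Pp x ** Ep x)"
  define k1 k2 where "k1 = int k - int (N + m)" and "k2 = int l - int (N + m)"
  have "Gm \<in> units_of_mat (C_minus \<mu>)" unfolding Gm_def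
    by (intro units_of_mat_mult[OF fun_algebra_C_minus[OF \<mu>(1)]] Em t PP)
  moreover have "Gp \<in> units_of_mat (C_plus \<mu>)" unfolding Gp_def
    by (intro units_of_mat_mult[OF fun_algebra_C_plus[OF \<mu>(1)]] Ep PP)
  moreover have "G x = Gm x ** mk2 (?z x powi k1) 0 0 (?z x powi k2) ** Gp x" for x
  proof -
    define w where "w = inverse (?z x) ^ (N + m)"
    have pw: "?z x powi k1 = w * ?z x ^ k" "?z x powi k2 = w * ?z x ^ l"
      unfolding k1_def k2_def w_def by (simp_all add: power_int_diff divide_inverse power_inverse mult.commute del: of_nat_add)
    have D: "mk2 (?z x powi k1) 0 0 (?z x powi k2) = mk2 w 0 0 w ** mk2 (?z x ^ k) 0 0 (?z x ^ l)"
      unfolding pw by (simp add: mk2_mult)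
    have comm: "mk2 c 0 0 c ** K = K ** mk2 c 0 0 c" for c :: complex and K
      by (simp add: mat2_eq_iff matmul2 mult.commute)
    have tw: "t x * w * ((?z x - kap k0) ^ m * c) = inverse (?z x) ^ N * c" for c
    proof -
      have "?z x - kap k0 = ?z x * (1 - kap k0 * inverse (?z x))" by (simp add: right_diff_distrib)
      then have "(?z x - kap k0) ^ m = ?z x ^ m * (1 - kap k0 * inverse (?z x)) ^ m" by (simp add: power_mult_distrib)
      then show ?thesis using tnz[of x] by (simp add: t_def w_def power_add power_inverse field_simps)
    qed
    have zz: "inverse (?z x) ^ N * (?z x ^ N * c) = c" for c by (simp add: power_inverse)
    have "Gm x ** mk2 (?z x powi k1) 0 0 (?z x powi k2) ** Gp x =
        Em x ** (mk2 (t x) 0 0 (t x) ** ((Pm x ** mk2 w 0 0 w) ** mk2 (?z x ^ k) 0 0 (?z x ^ l) ** Pp x)) ** Ep x"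
      unfolding Gm_def Gp_def D by (simp only: matrix_mul_assoc)
    also have "\<dots> = Em x ** ((mk2 (t x) 0 0 (t x) ** mk2 w 0 0 w) ** (Pm x ** mk2 (?z x ^ k) 0 0 (?z x ^ l) ** Pp x)) ** Ep x"
      unfolding comm[of w "Pm x", symmetric] by (simp only: matrix_mul_assoc)
    also have "\<dots> = Em x ** (sym_mat k0 x (t x * w) (t x * w) ** eval_mat P (?z x)) ** Ep x"
      unfolding PP(3)[symmetric] by (simp add: mk2_mult sym_mat_scalar)
    also have "\<dots> = sym_mat k0 x (inverse (?z x) ^ N * (?z x ^ N * g1 x)) (inverse (?z x) ^ N * (?z x ^ N * g2 x))"
      unfolding P Em_def Ep_def sym_mat_mult[OF k0] tw zg by (simp add: mult_ac)
    also have "\<dots> = G x" unfolding zz Gs ..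
    finally show ?thesis ..
  qed
  ultimately have "bounded_factorization \<mu> G Gm Gp k1 k2"
    unfolding bounded_factorization_def by (simp add: mk2_def)
  then show ?thesis by (rule that)
qed

lemma partial_indices_sum:
  assumes \<mu>: "0 < \<mu>" "\<mu> \<le> 1" and B: "bounded_factorization \<mu> G Gm Gp k1 k2"
    and fact: "scalar_factorization_index \<mu> (\<lambda>x. det (G x)) m"
  shows "k1 + k2 = m"
proof -
  obtain u v where uv: "u \<in> units_of_fun (C_minus \<mu>)" "v \<in> units_of_fun (C_plus \<mu>)"
    "\<And>x. det (G x) = u x * lam_ratio x powi m * v x"
    using fact by (auto simp: scalar_factorization_index_def)
  have B': "Gm \<in> units_of_mat (C_minus \<mu>)" "Gp \<in> units_of_mat (C_plus \<mu>)"
    "\<And>x. G x = Gm x ** mk2 (lam_ratio x powi k1) 0 0 (lam_ratio x powi k2) ** Gp x"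
    using B by (simp_all add: bounded_factorization_def mk2_def)
  have d: "(\<lambda>x. det (Gm x)) \<in> units_of_fun (C_minus \<mu>)" "(\<lambda>x. det (Gp x)) \<in> units_of_fun (C_plus \<mu>)"
    using det_unit fun_algebra_C_minus fun_algebra_C_plus \<mu>(1) B' by blast+
  have "det (G x) = det (Gm x) * lam_ratio x powi (k1 + k2) * det (Gp x)" for x
    unfolding B'(3) det_matmul2 by (simp add: power_int_add)
  then have "det (Gm x) * lam_ratio x powi (k1 + k2) * det (Gp x) = u x * lam_ratio x powi m * v x" for x
    using uv(3) by metis
  then show ?thesis
    using scalar_index_le[OF \<mu> d uv(1,2)] scalar_index_le[OF \<mu> uv(1,2) d] by (metis order_antisym)
qed

text \<open>A negative index would make a column of the inverse of \<open>Gp\<close> a nonzero solution of the vector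
  problem.\<close>

lemma partial_indices_nonneg:
  assumes k0: "k0 > 1" and \<mu>: "0 < \<mu>" "\<mu> \<le> 1" and G: "G \<in> C_Q k0 \<mu>"
    and fact: "scalar_factorization_index \<mu> (\<lambda>x. det (G x)) 1"
    and B: "bounded_factorization \<mu> G Gm Gp k1 k2"
  shows "k1 \<ge> 0" "k2 \<ge> 0"
proof -
  interpret M: fun_algebra "C_minus \<mu>" by (rule fun_algebra_C_minus[OF \<mu>(1)])
  have B': "Gm \<in> units_of_mat (C_minus \<mu>)" "Gp \<in> units_of_mat (C_plus \<mu>)"
    "\<And>x. G x = Gm x ** mk2 (lam_ratio x powi k1) 0 0 (lam_ratio x powi k2) ** Gp x"
    using B by (simp_all add: bounded_factorization_def mk2_def)
  obtain R where R: "R \<in> mat_over (C_plus \<mu>)" "\<And>x. Gp x ** R x = mat 1"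
    using B'(2) by (auto simp: units_of_mat_def)
  have Gm: "(\<lambda>x. Gm x $ i $ j) \<in> C_minus \<mu>" for i j using B'(1) by (auto simp: units_of_mat_def mat_over_def)
  define kk where "kk j = (if j = 1 then k1 else k2)" for j :: 2
  have "kk j \<ge> 0" for j
  proof (rule ccontr)
    assume "\<not> kk j \<ge> 0"
    \<comment> \<open>one factor \<open>1/z\<close> is kept for the zero that \<open>C_minus0\<close> prescribes\<close>
    define d where "d = nat (- kk j - 1)"
    have kd: "kk j = - 1 - int d" using \<open>\<not> kk j \<ge> 0\<close> by (simp add: d_def)
    define \<phi>p where "\<phi>p x = column j (R x)" for x
    define \<phi>m where "\<phi>m x = (\<chi> i. inverse (lam_ratio x) * (inverse (lam_ratio x) ^ d * Gm x $ i $ j))" for x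
    have "\<phi>p \<in> vec_over (C_plus \<mu>)" using R(1) by (simp add: vec_over_def \<phi>p_def column_def mat_over_def)
    moreover have "(\<lambda>x. \<phi>m x $ i) \<in> C_minus0 \<mu>" for i
      using M.mult[OF lam_power_plus_minus(2)[OF \<mu>, of d] Gm[of i j]] by (auto simp: \<phi>m_def C_minus0_def)
    then have "\<phi>m \<in> vec_over (C_minus0 \<mu>)" by (simp add: vec_over_def)
    moreover have "G x *v \<phi>p x = \<phi>m x" for x
    proof -
      let ?D = "mk2 (lam_ratio x powi k1) 0 0 (lam_ratio x powi k2)"
      have "G x *v \<phi>p x = column j (G x ** R x)"
        by (simp add: \<phi>p_def vec_eq_iff column_def matrix_matrix_mult_def matrix_vector_mult_def)
      also have "G x ** R x = Gm x ** ?D"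
        unfolding B'(3) matrix_mul_assoc[symmetric] R(2) by simp
      finally have e: "(G x *v \<phi>p x) $ i = Gm x $ i $ j * lam_ratio x powi kk j" for i
        using exhaust_2[of j] by (auto simp: column_def matmul2 kk_def)
      have "lam_ratio x powi kk j = inverse (lam_ratio x) * inverse (lam_ratio x) ^ d"
        unfolding kd by (simp add: power_int_diff power_int_minus divide_inverse power_inverse)
      then show ?thesis using e by (simp add: vec_eq_iff \<phi>m_def mult_ac)
    qed
    ultimately have "\<phi>p x = 0" for x by (rule vector_problem_trivial(1)[OF k0 \<mu> G fact])
    then have "R x $ i $ j = 0" for x i by (metis \<phi>p_def column_def vec_lambda_beta zero_index)
    then have "(Gp x ** R x) $ j $ j = 0" for x by (simp add: matmul2)
    then show False unfolding R(2) by (simp add: mat_def)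
  qed
  from this[of 1] this[of 2] show "k1 \<ge> 0" "k2 \<ge> 0" by (auto simp: kk_def)
qed

theorem theorem6p6:
  fixes k0 \<mu> :: real and G :: "rdot \<Rightarrow> complex^2^2" and g :: "surf \<Rightarrow> complex" and m :: int
  assumes "k0 > 1" and "0 < \<mu>" and "\<mu> < 1"
    and "G \<in> C_Q k0 \<mu>"
    and "scalar_factorization_index \<mu> (\<lambda>x. det (G x)) m" and "m = 1"
    and "g = Sigma_symbol k0 G"
  shows "\<not> (\<exists>\<phi>p \<in> vec_over (C_plus \<mu>). \<exists>\<phi>m \<in> vec_over (C_minus0 \<mu>).
           (\<forall>x. G x *v \<phi>p x = \<phi>m x) \<and> ((\<exists>x. \<phi>p x \<noteq> 0) \<or> (\<exists>x. \<phi>m x \<noteq> 0)))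
    \<and> \<not> (\<exists>\<psi>p \<in> CG_plus k0 \<mu>. \<exists>\<psi>m \<in> CG_minus0 k0 \<mu>.
           (\<forall>P\<in>Gam k0. g P * \<psi>p P = tau_over_p1 k0 P * \<psi>m P) \<and>
           ((\<exists>P\<in>Gam k0. \<psi>p P \<noteq> 0) \<or> (\<exists>P\<in>Gam k0. \<psi>m P \<noteq> 0)))
    \<and> (\<exists>Gm Gp k1 k2. bounded_factorization \<mu> G Gm Gp k1 k2 \<and>
           \<not> canonical_indices k1 k2 \<and> {k1, k2} = {0, 1})"
proof (intro conjI notI)
  have \<mu>: "\<mu> \<le> 1" using assms(3) by simp
  have fact: "scalar_factorization_index \<mu> (\<lambda>x. det (G x)) 1" using assms(5,6) by simp
  {
    assume "\<exists>\<phi>p \<in> vec_over (C_plus \<mu>). \<exists>\<phi>m \<in> vec_over (C_minus0 \<mu>).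
           (\<forall>x. G x *v \<phi>p x = \<phi>m x) \<and> ((\<exists>x. \<phi>p x \<noteq> 0) \<or> (\<exists>x. \<phi>m x \<noteq> 0))"
    then show False using vector_problem_trivial[OF assms(1,2) \<mu> assms(4) fact] by blast
  next
    assume "\<exists>\<psi>p \<in> CG_plus k0 \<mu>. \<exists>\<psi>m \<in> CG_minus0 k0 \<mu>.
           (\<forall>P\<in>Gam k0. g P * \<psi>p P = tau_over_p1 k0 P * \<psi>m P) \<and>
           ((\<exists>P\<in>Gam k0. \<psi>p P \<noteq> 0) \<or> (\<exists>P\<in>Gam k0. \<psi>m P \<noteq> 0))"
    then show False using surface_problem_trivial[OF assms(1,2) \<mu> assms(4) fact] unfolding assms(7) by blast
  next
    obtain Gm Gp k1 k2 where B: "bounded_factorization \<mu> G Gm Gp k1 k2"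
      using symmetric_factorization_exists[OF assms(1-4)] by metis
    have "k1 + k2 = 1" by (rule partial_indices_sum[OF assms(2) \<mu> B fact])
    moreover have "k1 \<ge> 0" "k2 \<ge> 0" using partial_indices_nonneg[OF assms(1,2) \<mu> assms(4) fact B] by auto
    ultimately have "k1 = 0 \<and> k2 = 1 \<or> k1 = 1 \<and> k2 = 0" by presburger
    then have "\<not> canonical_indices k1 k2" "{k1, k2} = {0, 1}" by (auto simp: canonical_indices_def)
    then show "\<exists>Gm Gp k1 k2. bounded_factorization \<mu> G Gm Gp k1 k2 \<and> \<not> canonical_indices k1 k2 \<and> {k1, k2} = {0, 1}"
      using B by blast
  }
qed

end
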